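(* For $0<r<\frac12$ there is a homotopy equivalence $$\check{\mathbf C}_{\le}(S^1;r)\simeq\begin{cases} S^{2l+1} & \text{if } \frac{l}{2(l+1)}<r<\frac{l+1}{2(l+2)},\ l=0,1,\ldots,\\ \bigvee^{\mathfrak c} S^{2l} & \text{if } r=\frac{l}{2(l+1)},\ l=0,1,\ldots,\end{cases}$$ where $\mathfrak c$ is the cardinality of the continuum. Moreover, if $\frac{l}{2(l+1)}<r\le r'<\frac{l+1}{2(l+2)}$ then the inclusion $\check{\mathbf C}_{\le}(S^1;r)\hookrightarrow\check{\mathbf C}_{\le}(S^1;r')$ is a homotopy equivalence.
   Context: $S^1$ denotes the circle of circumference $1$ with the arc-length metric. For $X\subseteq S^1$ and $r>0$, the Čech complex $\check{\mathbf C}_{\le}(X;r)$ is the simplicial complex with vertex set $X$ in which a finite subset $\sigma\subseteq X$ is a face if and only if $\bigcap_{x\in\sigma}B_{\le}(x;r)\neq\emptyset$, where $B_{\le}(x;r)$ is the closed ball of radius $r$ about $x$ in $S^1$; equivalently, $\sigma$ is contained in some closed arc of length $2r$. The geometric realization carries the CW (weak) topology with respect to finite subcomplexes. $\bigvee^{\mathfrak c}S^{2l}$ is a wedge of $\mathfrak c$ copies of $S^{2l}$. *)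

theory Defs
  imports "HOL-Analysis.Analysis"
begin

(* The circle S^1 of circumference 1, modelled as [0,1) with the arc-length metric. *)
definition circle :: "real set" where
  "circle = {0..<1}"

definition circ_dist :: "real \<Rightarrow> real \<Rightarrow> real" where
  "circ_dist x y = min \<bar>x - y\<bar> (1 - \<bar>x - y\<bar>)"

definition circ_cball :: "real \<Rightarrow> real \<Rightarrow> real set" where
  "circ_cball x r = {y \<in> circle. circ_dist x y \<le> r}"

definition cech_le :: "real set \<Rightarrow> real \<Rightarrow> real set set" where
  "cech_le X r = {\<sigma>. \<sigma> \<subseteq> X \<and> finite \<sigma> \<and> \<sigma> \<noteq> {} \<and> (\<Inter>x\<in>\<sigma>. circ_cball x r) \<noteq> {}}"

(* Geometric realization of an (abstract) simplicial complex K, given as a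
   set of finite nonempty faces: points are finitely supported barycentric
   coordinate functions whose support is a face. *)
definition realization_set :: "'a set set \<Rightarrow> ('a \<Rightarrow> real) set" where
  "realization_set K = {\<alpha>. (\<forall>v. 0 \<le> \<alpha> v) \<and> finite {v. \<alpha> v \<noteq> 0}
       \<and> {v. \<alpha> v \<noteq> 0} \<in> K \<and> sum \<alpha> {v. \<alpha> v \<noteq> 0} = 1}"

definition closed_simplex :: "'a set \<Rightarrow> ('a \<Rightarrow> real) set" where
  "closed_simplex \<sigma> = {\<alpha>. (\<forall>v. 0 \<le> \<alpha> v) \<and> (\<forall>v. v \<notin> \<sigma> \<longrightarrow> \<alpha> v = 0) \<and> sum \<alpha> \<sigma> = 1}"

(* Each closed simplex carries its Euclidean topology (= product topology, as
   only finitely many coordinates vary); the realization carries the weak (CW)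
   topology coherent with the closed simplices. *)
definition realization :: "'a set set \<Rightarrow> ('a \<Rightarrow> real) topology" where
  "realization K = topology (\<lambda>U. U \<subseteq> realization_set K \<and>
      (\<forall>\<sigma>\<in>K. openin (subtopology (powertop_real UNIV) (closed_simplex \<sigma>)) (U \<inter> closed_simplex \<sigma>)))"

definition quotient_topology :: "'a topology \<Rightarrow> ('a \<Rightarrow> 'b) \<Rightarrow> 'b topology" where
  "quotient_topology X f = topology (\<lambda>U. U \<subseteq> f ` topspace X \<and>
      openin X {x \<in> topspace X. f x \<in> U})"

definition sphere_base :: "nat \<Rightarrow> real" where
  "sphere_base = (\<lambda>i. if i = 0 then 1 else 0)"

(* Wedge of continuum many (indexed by the reals) copies of S^n:
   disjoint union with all base points identified. *)
definition wedge_collapse :: "real \<times> (nat \<Rightarrow> real) \<Rightarrow> real \<times> (nat \<Rightarrow> real)" where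
  "wedge_collapse p = (if snd p = sphere_base then (0, sphere_base) else p)"

definition continuum_wedge_spheres :: "nat \<Rightarrow> (real \<times> (nat \<Rightarrow> real)) topology" where
  "continuum_wedge_spheres n =
     quotient_topology (sum_topology (\<lambda>_::real. nsphere n) UNIV) wedge_collapse"

definition homotopy_equivalence_map :: "'a topology \<Rightarrow> 'b topology \<Rightarrow> ('a \<Rightarrow> 'b) \<Rightarrow> bool" where
  "homotopy_equivalence_map X Y f \<longleftrightarrow> continuous_map X Y f \<and>
     (\<exists>g. continuous_map Y X g \<and> homotopic_with (\<lambda>x. True) X X (g \<circ> f) id
          \<and> homotopic_with (\<lambda>x. True) Y Y (f \<circ> g) id)"

end

theory Submission
  imports Defs
begin

text \<open>
  Put \<open>d = 1 - 2r\<close>. A finite set of points is a face iff it misses an open arc of length \<open>d\<close>. All homotopy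
  equivalences are obtained from the carrier theorem: a monotone assignment of contractible subcomplexes
  to the simplices of a complex carries a continuous map, and two carried maps are homotopic. In
  particular a subcomplex inclusion is a homotopy equivalence once both the retraction and the
  deformation are carried; the values of the carriers are contractible because removing dominated
  vertices reduces them to simplices or cones.

  For \<open>1/m < d < 1/(m - 1)\<close> the length \<open>d\<close> may be changed slightly, on one short interval of left end points
  \<open>a\<close> at a time: the obstruction to pushing the right end point of a gap upwards travels along
  \<open>a + d, a + 2d, \<dots>, a + (m - 1)d\<close> and ends in the gap itself. This reduces to \<open>d = 2/(2m - 1)\<close>, where rounding
  down to the \<open>(2m - 1)\<close>-gon deforms the complex onto the boundary of a simplex with \<open>2m - 1\<close> vertices. For
  \<open>d = 1/m\<close> rounding down to the \<open>m\<close>-gon \<open>C\<close> is obstructed exactly by the faces containing a full coset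
  \<open>C'\<close> of \<open>C\<close>; each such coset contributes the boundary of the simplex on \<open>C \<union> C'\<close>, and all these
  spheres share the simplex on \<open>C\<close>.
\<close>

section \<open>Simplicial complexes and their realizations\<close>

text \<open>The range \<open>l/(2(l+1)) < r < (l+1)/(2(l+2))\<close> is
  \<open>1/(l+2) < d < 1/(l+1)\<close>, so \<open>m = l + 2\<close> there, while the critical radius
  is \<open>d = 1/(l+1)\<close>, so \<open>m = l + 1\<close>. A simplex boundary on
  \<open>2m - 1\<close> vertices is a sphere of dimension \<open>2m - 3\<close>, one on
  \<open>2m\<close> vertices a sphere of dimension \<open>2m - 2\<close>; hence the dimensions
  \<open>2l + 1\<close> and \<open>2l\<close>. The value \<open>2/(2m - 1)\<close> is the mediant of
  \<open>1/m\<close> and \<open>1/(m - 1)\<close>. The vertex set is uncountable, but each carrier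
  value lives on a face together with finitely many added points, so only finite complexes have to
  be contracted. The added points must depend monotonically on the face. A face that is lost when
  \<open>d\<close> grows can have left ends all around the circle, and a point that has to move for
  one of them may have to stay for another. Changing the length only for left ends in a short arc
  \<open>[p, p + w)\<close> confines the moving points to disjoint arcs fixed in advance, whose
  upper ends serve all faces at once. This is why the gap length is a function of the left
  end.\<close>

definition abstract_complex :: "'a set set \<Rightarrow> bool" where
  "abstract_complex K \<longleftrightarrow> (\<forall>\<sigma>\<in>K. finite \<sigma> \<and> \<sigma> \<noteq> {}) \<and>
     (\<forall>\<sigma>\<in>K. \<forall>\<tau>. \<tau> \<subseteq> \<sigma> \<and> \<tau> \<noteq> {} \<longrightarrow> \<tau> \<in> K)"

abbreviation simplex_space :: "'a set \<Rightarrow> ('a \<Rightarrow> real) topology" where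
  "simplex_space \<sigma> \<equiv> subtopology (powertop_real UNIV) (closed_simplex \<sigma>)"

lemma abstract_complexD:
  assumes "abstract_complex K" "\<sigma> \<in> K"
  shows "finite \<sigma>" "\<sigma> \<noteq> {}" "\<And>\<tau>. \<tau> \<subseteq> \<sigma> \<Longrightarrow> \<tau> \<noteq> {} \<Longrightarrow> \<tau> \<in> K"
  using assms unfolding abstract_complex_def by blast+

lemma closed_simplex_mono:
  assumes "finite \<sigma>" "\<tau> \<subseteq> \<sigma>"
  shows "closed_simplex \<tau> \<subseteq> closed_simplex \<sigma>"
proof
  fix \<alpha> assume \<alpha>: "\<alpha> \<in> closed_simplex \<tau>"
  then have "sum \<alpha> \<tau> = sum \<alpha> \<sigma>"
    using assms by (intro sum.mono_neutral_left) (auto simp: closed_simplex_def)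
  then show "\<alpha> \<in> closed_simplex \<sigma>"
    using \<alpha> assms by (auto simp: closed_simplex_def)
qed

lemma closed_simplex_support:
  assumes "finite \<sigma>" "\<alpha> \<in> closed_simplex \<sigma>"
  shows "{v. \<alpha> v \<noteq> 0} \<subseteq> \<sigma>" "{v. \<alpha> v \<noteq> 0} \<noteq> {}" "finite {v. \<alpha> v \<noteq> 0}"
    "\<alpha> \<in> closed_simplex {v. \<alpha> v \<noteq> 0}"
proof -
  show s: "{v. \<alpha> v \<noteq> 0} \<subseteq> \<sigma>"
    using assms by (auto simp: closed_simplex_def)
  show "finite {v. \<alpha> v \<noteq> 0}"
    using s assms(1) finite_subset by blast
  have eq: "sum \<alpha> {v. \<alpha> v \<noteq> 0} = sum \<alpha> \<sigma>"
    using s assms by (intro sum.mono_neutral_left) auto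
  have "sum \<alpha> {v. \<alpha> v \<noteq> 0} = 1"
    using eq assms(2) by (auto simp: closed_simplex_def)
  then show "{v. \<alpha> v \<noteq> 0} \<noteq> {}"
    by (metis sum.empty zero_neq_one)
  show "\<alpha> \<in> closed_simplex {v. \<alpha> v \<noteq> 0}"
    using eq assms(2) by (auto simp: closed_simplex_def)
qed

lemma closed_simplex_le_1:
  assumes "finite \<sigma>" "\<alpha> \<in> closed_simplex \<sigma>"
  shows "\<alpha> v \<le> 1"
proof (cases "v \<in> \<sigma>")
  case True
  then have "\<alpha> v \<le> sum \<alpha> \<sigma>"
    using assms by (intro member_le_sum) (auto simp: closed_simplex_def)
  then show ?thesis using assms by (auto simp: closed_simplex_def)
qed (use assms in \<open>auto simp: closed_simplex_def\<close>)

lemma realization_set_eq: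
  assumes "abstract_complex K"
  shows "realization_set K = (\<Union>\<sigma>\<in>K. closed_simplex \<sigma>)"
proof
  show "realization_set K \<subseteq> (\<Union>\<sigma>\<in>K. closed_simplex \<sigma>)"
    by (force simp: realization_set_def closed_simplex_def)
  show "(\<Union>\<sigma>\<in>K. closed_simplex \<sigma>) \<subseteq> realization_set K"
  proof clarify
    fix \<sigma> \<alpha> assume "\<sigma> \<in> K" "\<alpha> \<in> closed_simplex \<sigma>"
    then have "{v. \<alpha> v \<noteq> 0} \<in> K" "\<alpha> \<in> closed_simplex {v. \<alpha> v \<noteq> 0}" "finite {v. \<alpha> v \<noteq> 0}"
      using abstract_complexD[OF assms] closed_simplex_support by metis+
    then show "\<alpha> \<in> realization_set K"
      by (auto simp: realization_set_def closed_simplex_def)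
  qed
qed

lemma istopology_realization:
  "istopology (\<lambda>U. U \<subseteq> realization_set K \<and>
      (\<forall>\<sigma>\<in>K. openin (simplex_space \<sigma>) (U \<inter> closed_simplex \<sigma>)))"
proof -
  have 1: "S \<inter> T \<inter> closed_simplex \<sigma> = (S \<inter> closed_simplex \<sigma>) \<inter> (T \<inter> closed_simplex \<sigma>)" for S T and \<sigma> :: "'a set"
    by auto
  have 2: "\<Union>\<K> \<inter> closed_simplex \<sigma> = (\<Union>U\<in>\<K>. U \<inter> closed_simplex \<sigma>)" for \<K> and \<sigma> :: "'a set"
    by auto
  show ?thesis
    unfolding istopology_def 1 2 by blast
qed

lemma openin_realization:
  "openin (realization K) U \<longleftrightarrow> U \<subseteq> realization_set K \<and>
      (\<forall>\<sigma>\<in>K. openin (simplex_space \<sigma>) (U \<inter> closed_simplex \<sigma>))"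
  by (simp add: realization_def istopology_realization)

lemma topspace_realization:
  assumes "abstract_complex K"
  shows "topspace (realization K) = realization_set K"
proof -
  have "openin (realization K) (realization_set K)"
    unfolding openin_realization
  proof (intro conjI ballI)
    fix \<sigma> assume "\<sigma> \<in> K"
    then have "realization_set K \<inter> closed_simplex \<sigma> = topspace (simplex_space \<sigma>)"
      using realization_set_eq[OF assms] by auto
    then show "openin (simplex_space \<sigma>) (realization_set K \<inter> closed_simplex \<sigma>)"
      by (metis openin_topspace)
  qed auto
  then show ?thesis
    by (meson openin_realization openin_subset openin_topspace subset_antisym)
qed

lemma simplex_subset_realization:
  assumes "abstract_complex K" "\<sigma> \<in> K"
  shows "closed_simplex \<sigma> \<subseteq> topspace (realization K)"
  using assms topspace_realization realization_set_eq by blast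

text \<open>The universal property of the weak topology. It reduces every later continuity proof to
  one closed simplex, where only coordinates matter.\<close>

lemma continuous_map_from_realization:
  assumes K: "abstract_complex K"
  shows "continuous_map (realization K) Y f \<longleftrightarrow> (\<forall>\<sigma>\<in>K. continuous_map (simplex_space \<sigma>) Y f)"
    (is "?L = ?R")
proof
  assume L: ?L
  show ?R
  proof
    fix \<sigma> assume \<sigma>: "\<sigma> \<in> K"
    show "continuous_map (simplex_space \<sigma>) Y f"
      unfolding continuous_map_def
    proof (intro conjI allI impI)
      show "f \<in> topspace (simplex_space \<sigma>) \<rightarrow> topspace Y"
        using L simplex_subset_realization[OF K \<sigma>] by (auto simp: continuous_map_def)
      fix U assume "openin Y U"
      then have "openin (realization K) {x \<in> topspace (realization K). f x \<in> U}"
        using L by (auto simp: continuous_map_def)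
      then have "openin (simplex_space \<sigma>) ({x \<in> topspace (realization K). f x \<in> U} \<inter> closed_simplex \<sigma>)"
        using \<sigma> openin_realization by blast
      moreover have "{x \<in> topspace (realization K). f x \<in> U} \<inter> closed_simplex \<sigma> = {x \<in> topspace (simplex_space \<sigma>). f x \<in> U}"
        using simplex_subset_realization[OF K \<sigma>] by auto
      ultimately show "openin (simplex_space \<sigma>) {x \<in> topspace (simplex_space \<sigma>). f x \<in> U}"
        by simp
    qed
  qed
next
  assume R: ?R
  show ?L
    unfolding continuous_map_def
  proof (intro conjI allI impI)
    show "f \<in> topspace (realization K) \<rightarrow> topspace Y"
      using R by (fastforce simp: topspace_realization[OF K] realization_set_eq[OF K] continuous_map_def)
    fix U assume U: "openin Y U"
    show "openin (realization K) {x \<in> topspace (realization K). f x \<in> U}"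
      unfolding openin_realization
    proof (intro conjI ballI)
      fix \<sigma> assume \<sigma>: "\<sigma> \<in> K"
      then have "openin (simplex_space \<sigma>) {x \<in> topspace (simplex_space \<sigma>). f x \<in> U}"
        using R U unfolding continuous_map_def by blast
      moreover have "{x \<in> topspace (realization K). f x \<in> U} \<inter> closed_simplex \<sigma> = {x \<in> topspace (simplex_space \<sigma>). f x \<in> U}"
        using simplex_subset_realization[OF K \<sigma>] by auto
      ultimately show "openin (simplex_space \<sigma>) ({x \<in> topspace (realization K). f x \<in> U} \<inter> closed_simplex \<sigma>)"
        by simp
    qed (auto simp: topspace_realization[OF K])
  qed
qed

lemma continuous_map_simplex_realization:
  assumes "abstract_complex K" "\<sigma> \<in> K"
  shows "continuous_map (simplex_space \<sigma>) (realization K) (\<lambda>x. x)"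
  using continuous_map_from_realization[OF assms(1), of "realization K" "\<lambda>x. x"] assms(2)
  by (simp add: continuous_map_id[unfolded id_def])

lemma continuous_map_realization_mono:
  assumes "abstract_complex L" "abstract_complex K" "L \<subseteq> K"
  shows "continuous_map (realization L) (realization K) (\<lambda>x. x)"
  using assms continuous_map_simplex_realization by (auto simp: continuous_map_from_realization)

text \<open>Each summand is open in the disjoint sum, so a box around a point of one summand is also
  a box in the product with the sum. Serves both the homotopies on realizations and those on the
  wedge.\<close>

lemma continuous_map_from_prod_sum:
  assumes h: "\<And>i. i \<in> I \<Longrightarrow> continuous_map (prod_topology Z (X i)) Y (\<lambda>(z,x). h (z,(i,x)))"
  shows "continuous_map (prod_topology Z (sum_topology X I)) Y h"
  unfolding continuous_map_def
proof (intro conjI allI impI)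
  let ?S = "sum_topology X I"
  show "h \<in> topspace (prod_topology Z ?S) \<rightarrow> topspace Y"
  proof
    fix q assume "q \<in> topspace (prod_topology Z ?S)"
    then obtain z i x where q: "q = (z,(i,x))" "z \<in> topspace Z" "i \<in> I" "x \<in> topspace (X i)" by auto
    then show "h q \<in> topspace Y"
      using subsetD[OF continuous_map_image_subset_topspace[OF h[OF q(3)]], OF imageI[of "(z,x)"]] by simp
  qed
  fix U assume U: "openin Y U"
  show "openin (prod_topology Z ?S) {x \<in> topspace (prod_topology Z ?S). h x \<in> U}"
  proof (subst openin_prod_topology_alt, intro allI impI)
    fix z p assume "(z, p) \<in> {x \<in> topspace (prod_topology Z ?S). h x \<in> U}"
    then obtain i x where p: "p = (i,x)" "i \<in> I" "x \<in> topspace (X i)" "z \<in> topspace Z" "h (z,(i,x)) \<in> U"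
      by auto
    let ?A = "{q \<in> topspace (prod_topology Z (X i)). (\<lambda>(z,x). h (z,(i,x))) q \<in> U}"
    have "openin (prod_topology Z (X i)) ?A"
      using h[OF p(2)] U unfolding continuous_map_def by blast
    moreover have "(z,x) \<in> ?A"
      using p by simp
    ultimately obtain A B where AB: "openin Z A" "openin (X i) B" "z \<in> A" "x \<in> B" "A \<times> B \<subseteq> ?A"
      unfolding openin_prod_topology_alt by meson
    have "{x. (j, x) \<in> {i} \<times> B} = (if j = i then B else {})" for j
      by auto
    then have "openin ?S ({i} \<times> B)"
      unfolding openin_sum_topology using p(2) openin_subset[OF AB(2)] AB(2)
      by auto
    moreover have "A \<times> ({i} \<times> B) \<subseteq> {x \<in> topspace (prod_topology Z ?S). h x \<in> U}"
      using AB(5) p(2) by auto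
    ultimately show "\<exists>A B. openin Z A \<and> openin ?S B \<and> z \<in> A \<and> p \<in> B \<and> A \<times> B \<subseteq> {x \<in> topspace (prod_topology Z ?S). h x \<in> U}"
      using AB p by blast
  qed
qed

text \<open>Whitehead's theorem: the product of a quotient map with a locally compact space is a quotient map.\<close>

lemma continuous_map_from_prod_realization:
  fixes Z :: "'z topology"
  assumes K: "abstract_complex K" and Z: "locally_compact_space Z" "Hausdorff_space Z"
    and h: "\<And>\<sigma>. \<sigma> \<in> K \<Longrightarrow> continuous_map (prod_topology Z (simplex_space \<sigma>)) Y h"
  shows "continuous_map (prod_topology Z (realization K)) Y h"
proof -
  let ?S = "sum_topology simplex_space K"
  have q: "quotient_map ?S (realization K) snd"
    unfolding quotient_map_def
  proof (intro conjI allI impI)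
    show "snd ` topspace ?S = topspace (realization K)"
      by (force simp: topspace_realization[OF K] realization_set_eq[OF K])
    fix U assume U: "U \<subseteq> topspace (realization K)"
    have "{x. (\<sigma>, x) \<in> {x \<in> topspace ?S. snd x \<in> U}} = U \<inter> closed_simplex \<sigma>" if "\<sigma> \<in> K" for \<sigma>
      using that by auto
    then have "openin ?S {x \<in> topspace ?S. snd x \<in> U} \<longleftrightarrow> (\<forall>\<sigma>\<in>K. openin (simplex_space \<sigma>) (U \<inter> closed_simplex \<sigma>))"
      unfolding openin_sum_topology by auto
    then show "openin ?S {x \<in> topspace ?S. snd x \<in> U} = openin (realization K) U"
      using U by (simp add: openin_realization topspace_realization[OF K])
  qed
  have qq: "quotient_map (prod_topology Z ?S) (prod_topology Z (realization K)) (\<lambda>(x,y). (x, snd y))"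
    using quotient_map_prod_right[OF Z(1) _ q] Z(2) by blast
  have "continuous_map (prod_topology Z ?S) Y (h \<circ> (\<lambda>(x,y). (x, snd y)))"
    using h by (intro continuous_map_from_prod_sum) (simp add: o_def case_prod_unfold)
  then show ?thesis
    using continuous_compose_quotient_map[OF qq] by blast
qed

text \<open>The compact factor \<open>{0..1}\<close> is what permits testing a homotopy on each
  simplex separately, by the preceding product theorem.\<close>

lemma homotopic_with_realizationI:
  assumes K: "abstract_complex K"
    and h: "\<And>\<sigma>. \<sigma> \<in> K \<Longrightarrow> continuous_map (prod_topology (top_of_set {0..1::real}) (simplex_space \<sigma>)) Y h"
    and h0: "\<And>x. x \<in> topspace (realization K) \<Longrightarrow> h (0,x) = f x"
    and h1: "\<And>x. x \<in> topspace (realization K) \<Longrightarrow> h (1,x) = g x"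
  shows "homotopic_with (\<lambda>x. True) (realization K) Y f g"
proof -
  have "continuous_map (prod_topology (top_of_set {0..1::real}) (realization K)) Y h"
    by (rule continuous_map_from_prod_realization[OF K _ _ h])
       (auto intro!: compact_imp_locally_compact_space simp: compact_space_subtopology Hausdorff_space_subtopology)
  then have "homotopic_with (\<lambda>x. True) (realization K) Y (\<lambda>x. h (0,x)) (\<lambda>x. h (1,x))"
    unfolding homotopic_with_def by auto
  then show ?thesis
    by (rule homotopic_with_eq) (use h0 h1 in auto)
qed

section \<open>Closed simplices are compact Hausdorff spaces\<close>

lemma closedin_closed_simplex:
  assumes "finite \<sigma>"
  shows "closedin (powertop_real UNIV) (closed_simplex \<sigma>)"
proof -
  have 1: "closedin (powertop_real UNIV) {x. 0 \<le> x v}" for v :: 'a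
    using closedin_continuous_map_preimage[OF continuous_map_product_projection[of v UNIV "\<lambda>_. euclideanreal"], of "{0..}"]
    by simp
  have 2: "closedin (powertop_real UNIV) {x. x v = 0}" for v :: 'a
    using closedin_continuous_map_preimage[OF continuous_map_product_projection[of v UNIV "\<lambda>_. euclideanreal"], of "{0}"]
    by simp
  have "continuous_map (powertop_real UNIV) euclideanreal (\<lambda>x. sum x \<sigma>)"
    by (intro continuous_map_sum assms continuous_map_product_projection) auto
  then have 3: "closedin (powertop_real UNIV) {x. sum x \<sigma> = 1}"
    using closedin_continuous_map_preimage[of "powertop_real UNIV" euclideanreal "\<lambda>x. sum x \<sigma>" "{1}"] by simp
  \<comment> \<open>The second intersection runs over all \<open>v\<close>, with \<open>UNIV\<close>
    at the vertices of \<open>\<sigma>\<close>, so that its index set is never empty.\<close>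
  have "closed_simplex \<sigma> = (\<Inter>v. {x. 0 \<le> x v}) \<inter> ((\<Inter>v. if v \<in> \<sigma> then UNIV else {x. x v = 0}) \<inter> {x. sum x \<sigma> = 1})"
    by (auto simp: closed_simplex_def split: if_splits)
  moreover have "closedin (powertop_real UNIV) (\<Inter>v::'a. {x. 0 \<le> x v})"
    by (intro closedin_INT) (use 1 in auto)
  moreover have "closedin (powertop_real UNIV) (\<Inter>v. if v \<in> \<sigma> then UNIV else {x. x v = 0})"
    using 2 closedin_topspace[of "powertop_real (UNIV::'a set)"] by (intro closedin_INT) (auto simp del: closedin_topspace)
  ultimately show ?thesis
    using 3 by (auto intro!: closedin_Int)
qed

text \<open>A closed subset of a cube, which is compact by Tychonoff.\<close>

lemma compactin_closed_simplex:
  assumes "finite \<sigma>"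
  shows "compactin (powertop_real UNIV) (closed_simplex \<sigma>)"
proof -
  have "compactin (powertop_real UNIV) (PiE UNIV (\<lambda>_::'a. {0..1::real}))"
    by (simp add: compactin_PiE)
  moreover have "closed_simplex \<sigma> \<subseteq> PiE UNIV (\<lambda>_. {0..1})"
    using closed_simplex_le_1[OF assms] by (auto simp: closed_simplex_def)
  ultimately show ?thesis
    using closedin_closed_simplex[OF assms] closed_compactin by blast
qed

lemma Hausdorff_simplex_space: "Hausdorff_space (simplex_space \<sigma>)"
  by (simp add: Hausdorff_space_subtopology Hausdorff_space_product_topology)

lemma compact_simplex_space: "finite \<sigma> \<Longrightarrow> compact_space (simplex_space \<sigma>)"
  by (simp add: compact_space_subtopology compactin_closed_simplex)

section \<open>The carrier theorem\<close>

lemma continuous_map_simplex_coord: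
  assumes "continuous_map X (simplex_space \<sigma>) f"
  shows "continuous_map X euclideanreal (\<lambda>x. f x v)"
proof -
  have "continuous_map (simplex_space \<sigma>) euclideanreal (\<lambda>\<alpha>. \<alpha> v)"
    by (intro continuous_map_from_subtopology continuous_map_product_projection) auto
  then show ?thesis
    using continuous_map_compose[OF assms] by (simp add: o_def)
qed

lemma continuous_map_into_simplex_space:
  "continuous_map X (simplex_space \<sigma>) f \<longleftrightarrow>
     (\<forall>v. continuous_map X euclideanreal (\<lambda>x. f x v)) \<and> f \<in> topspace X \<rightarrow> closed_simplex \<sigma>"
  by (auto simp: continuous_map_in_subtopology continuous_map_componentwise_UNIV)

text \<open>One minus \<open>card \<sigma>\<close> times the least coordinate will be the radial
  coordinate of a simplex: it vanishes only at the barycentre and equals 1 on the boundary. This is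
  the inequality behind it, with its equality case.\<close>

lemma Min_le_barycentre:
  assumes "finite \<sigma>" "\<sigma> \<noteq> {}" "\<alpha> \<in> closed_simplex \<sigma>"
  shows "real (card \<sigma>) * Min (\<alpha> ` \<sigma>) \<le> 1"
    and "real (card \<sigma>) * Min (\<alpha> ` \<sigma>) = 1 \<Longrightarrow> v \<in> \<sigma> \<Longrightarrow> \<alpha> v = 1 / card \<sigma>"
proof -
  have n: "card \<sigma> > 0" using assms by (simp add: card_gt_0_iff)
  have s: "sum \<alpha> \<sigma> = 1" using assms by (simp add: closed_simplex_def)
  have le: "Min (\<alpha> ` \<sigma>) \<le> \<alpha> v" if "v \<in> \<sigma>" for v
    using that assms by simp
  have eq: "real (card \<sigma>) * Min (\<alpha> ` \<sigma>) = (\<Sum>v\<in>\<sigma>. Min (\<alpha> ` \<sigma>))" by simp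
  also have "\<dots> \<le> sum \<alpha> \<sigma>" by (intro sum_mono le)
  finally show "real (card \<sigma>) * Min (\<alpha> ` \<sigma>) \<le> 1" using s by simp
  assume m: "real (card \<sigma>) * Min (\<alpha> ` \<sigma>) = 1" and v: "v \<in> \<sigma>"
  have "(\<Sum>v\<in>\<sigma>. Min (\<alpha> ` \<sigma>)) = sum \<alpha> \<sigma>" using eq m s by simp
  then have "\<alpha> v = Min (\<alpha> ` \<sigma>)"
    using sum_mono_inv[of "\<lambda>_. Min (\<alpha> ` \<sigma>)" \<sigma> \<alpha> v] le v assms(1) by simp
  then show "\<alpha> v = 1 / card \<sigma>" using m n by (simp add: field_simps)
qed

text \<open>The cell \<open>[c - w, c + w] \<times> \<sigma>\<close> is the cone over its boundary with apex its centre; the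
  division by \<open>w = 0\<close> yields \<open>0\<close>, so that for \<open>w = 0\<close> this is the statement for \<open>\<sigma>\<close> itself.\<close>

lemma cell_extension:
  fixes \<sigma> :: "'a set" and c w :: real and Z :: "'z topology"
  defines "T \<equiv> prod_topology (top_of_set {c - w..c + w}) (simplex_space \<sigma>)"
  defines "B \<equiv> {(t,\<alpha>). t \<in> {c - w..c + w} \<and> \<alpha> \<in> closed_simplex \<sigma> \<and> (\<bar>t - c\<bar> / w = 1 \<or> (\<exists>v\<in>\<sigma>. \<alpha> v = 0))}"
  assumes \<sigma>: "finite \<sigma>" "\<sigma> \<noteq> {}" and w: "0 \<le> w"
    and Z: "contractible_space Z" "topspace Z \<noteq> {}"
    and h: "continuous_map (subtopology T B) Z h"
  shows "\<exists>H. continuous_map T Z H \<and> (\<forall>x\<in>B. H x = h x)"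
\<comment> \<open>The boundary is empty only for \<open>w = 0\<close> and a single vertex; then
  there is nothing to extend and a constant map will do.\<close>
proof (cases "B = {}")
  case True
  obtain z where "z \<in> topspace Z" using Z(2) by blast
  then have "continuous_map T Z (\<lambda>x. z)" by simp
  then show ?thesis using True by blast
next
  case False
  define n where "n = real (card \<sigma>)"
  have n: "n > 0" using \<sigma> by (simp add: n_def card_gt_0_iff)
  \<comment> \<open>\<open>b\<close> is the barycentre, \<open>q (s, x)\<close> divides the segment
    from the centre \<open>(c, b)\<close> to the boundary point \<open>x\<close> in the ratio
    \<open>s\<close>, and \<open>G\<close> is the ratio belonging to a given point of the
    cell.\<close>
  define b where "b = (\<lambda>v. if v \<in> \<sigma> then 1 / n else 0)"
  define q where "q = (\<lambda>(s::real, (t, \<beta>)). (c + s * (t - c), (\<lambda>v. b v + s * (\<beta> v - b v))))"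
  define S where "S = prod_topology (top_of_set {0..1::real}) (subtopology T B)"
  define G where "G = (\<lambda>(t, \<alpha>). max (\<bar>t - c\<bar> / w) (1 - n * Min (\<alpha> ` \<sigma>)))"
  have topT: "topspace T = {c - w..c + w} \<times> closed_simplex \<sigma>"
    by (simp add: T_def)
  have BT: "B \<subseteq> topspace T" by (auto simp: B_def topT)
  have topS: "topspace S = {0..1} \<times> B"
    using BT by (auto simp: S_def)
  have sumb: "sum b \<sigma> = 1" using \<sigma> n by (simp add: b_def n_def)
  have sums: "(\<Sum>v\<in>\<sigma>. b v + s * (\<beta> v - b v)) = 1" if "sum \<beta> \<sigma> = 1" for s \<beta>
    using that sumb by (simp add: sum.distrib sum_subtractf flip: sum_distrib_left)
  have b0: "0 \<le> b v" for v using n by (simp add: b_def)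
  have tw: "\<bar>t - c\<bar> / w \<le> 1" if "t \<in> {c - w..c + w}" for t
    using that w by (auto simp: divide_le_eq abs_le_iff)
  have cfst: "continuous_map S euclideanreal fst"
    unfolding S_def by (metis continuous_map_fst continuous_map_in_subtopology)
  have csnd: "continuous_map S T snd"
    unfolding S_def using continuous_map_snd continuous_map_in_subtopology by blast
  have cst: "continuous_map S euclideanreal (\<lambda>x. fst (snd x))"
    using continuous_map_compose[OF csnd[unfolded T_def] continuous_map_fst]
    by (simp add: o_def continuous_map_in_subtopology)
  have css: "continuous_map S euclideanreal (\<lambda>x. snd (snd x) v)" for v
    using continuous_map_compose[OF csnd[unfolded T_def] continuous_map_snd]
    by (intro continuous_map_simplex_coord[of _ \<sigma>]) (simp add: o_def)
  have inT: "q x \<in> topspace T" if "x \<in> topspace S" for x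
  proof -
    obtain s t \<beta> where x: "x = (s,(t,\<beta>))" using prod_cases3 by blast
    have s: "0 \<le> s" "s \<le> 1" "(t,\<beta>) \<in> B" using that x topS by auto
    have t: "\<bar>t - c\<bar> \<le> w" and \<beta>: "\<beta> \<in> closed_simplex \<sigma>" using s(3) by (auto simp: B_def abs_le_iff)
    have "\<bar>s * (t - c)\<bar> \<le> 1 * w"
      unfolding abs_mult using s t by (intro mult_mono) auto
    moreover have "0 \<le> b v + s * (\<beta> v - b v)" for v
    proof -
      have "b v + s * (\<beta> v - b v) = (1 - s) * b v + s * \<beta> v" by (simp add: algebra_simps)
      then show ?thesis using s b0 \<beta> by (simp add: closed_simplex_def)
    qed
    ultimately show ?thesis
      using \<beta> sums[of \<beta> s] by (auto simp: x q_def topT closed_simplex_def abs_le_iff b_def)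
  qed
  have qcont: "continuous_map S T q"
  proof -
    have "continuous_map S (top_of_set {c - w..c + w}) (\<lambda>x. c + fst x * (fst (snd x) - c))"
      unfolding continuous_map_in_subtopology
      using inT by (intro conjI continuous_intros cfst cst) (force simp: q_def topT)
    moreover have "continuous_map S (simplex_space \<sigma>) (\<lambda>x. (\<lambda>v. b v + fst x * (snd (snd x) v - b v)))"
      unfolding continuous_map_into_simplex_space
      using inT by (intro conjI allI continuous_intros cfst css) (force simp: q_def topT)
    ultimately have "continuous_map S T (\<lambda>x. (c + fst x * (fst (snd x) - c), (\<lambda>v. b v + fst x * (snd (snd x) v - b v))))"
      unfolding T_def by (rule continuous_map_pairedI)
    then show ?thesis by (simp add: q_def case_prod_unfold)
  qed
  have closedB: "closedin T B"
  proof -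
    have "continuous_map T euclideanreal (\<lambda>x. \<bar>fst x - c\<bar> / w)"
      unfolding T_def divide_inverse
      by (intro continuous_intros) (metis continuous_map_fst continuous_map_in_subtopology)
    then have 1: "closedin T {x \<in> topspace T. \<bar>fst x - c\<bar> / w = 1}"
      using closedin_continuous_map_preimage[of T euclideanreal "\<lambda>x. \<bar>fst x - c\<bar> / w" "{1}"] by simp
    have "continuous_map T euclideanreal (\<lambda>x. snd x v)" for v
      unfolding T_def using continuous_map_simplex_coord continuous_map_snd by fast
    then have 2: "closedin T {x \<in> topspace T. snd x v = 0}" for v
      using closedin_continuous_map_preimage[of T euclideanreal "\<lambda>x. snd x v" "{0}"] by simp
    have "B = {x \<in> topspace T. \<bar>fst x - c\<bar> / w = 1} \<union> (\<Union>v\<in>\<sigma>. {x \<in> topspace T. snd x v = 0})"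
      by (auto simp: B_def topT)
    then show ?thesis
      using 1 2 \<sigma> by (auto intro!: closedin_Un closedin_Union)
  qed
  have compT: "compact_space T"
    unfolding T_def by (simp add: compact_space_prod_topology compact_simplex_space \<sigma> compact_space_subtopology)
  have HT: "Hausdorff_space T"
    unfolding T_def by (simp add: Hausdorff_space_prod_topology Hausdorff_simplex_space Hausdorff_space_subtopology)
  have compS: "compact_space S"
    unfolding S_def using closedin_compact_space[OF compT closedB]
    by (simp add: compact_space_prod_topology compact_space_subtopology)
  have surj: "q ` topspace S = topspace T"
  proof
    show "q ` topspace S \<subseteq> topspace T" using inT by blast
    show "topspace T \<subseteq> q ` topspace S"
    proof
      fix x assume x: "x \<in> topspace T"
      obtain t \<alpha> where tx: "x = (t,\<alpha>)" by fastforce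
      have t: "t \<in> {c - w..c + w}" and \<alpha>: "\<alpha> \<in> closed_simplex \<sigma>" using x by (auto simp: tx topT)
      define g where "g = G x"
      have g0: "0 \<le> g" using w by (auto simp: g_def G_def tx le_max_iff_disj)
      have Min0: "0 \<le> Min (\<alpha> ` \<sigma>)" using \<alpha> \<sigma> by (auto simp: closed_simplex_def)
      have g1: "g \<le> 1" using tw[OF t] Min0 n by (auto simp: g_def G_def tx)
      have gt: "\<bar>t - c\<bar> / w \<le> g" and gM: "1 - n * Min (\<alpha> ` \<sigma>) \<le> g"
        by (auto simp: g_def G_def tx)
      show "x \<in> q ` topspace S"
      proof (cases "g = 0")
        case True
        then have "n * Min (\<alpha> ` \<sigma>) = 1"
          using gM Min_le_barycentre(1)[OF \<sigma> \<alpha>] by (simp add: n_def)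
        then have "\<alpha> = b"
          using Min_le_barycentre(2)[OF \<sigma> \<alpha>] \<alpha> by (auto simp: n_def b_def closed_simplex_def)
        moreover have "t = c" using gt t w True by (auto simp: divide_le_0_iff)
        moreover obtain p where "p \<in> B" using False by blast
        ultimately have "x = q (0,p)" "(0,p) \<in> topspace S"
          by (auto simp: tx q_def topS case_prod_unfold)
        then show ?thesis by blast
      next
        case gn: False
        with g0 have g: "g > 0" by simp
        \<comment> \<open>Scaling by \<open>1 / g\<close> away from the centre. The result lies on
          the boundary because one of the two terms in the maximum defining \<open>G\<close> attains
          it.\<close>
        define t' where "t' = c + (t - c) / g"
        define \<alpha>' where "\<alpha>' = (\<lambda>v. b v + (\<alpha> v - b v) / g)"
        have "w = 0 \<Longrightarrow> t = c" using t by auto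
        then have "\<bar>t - c\<bar> \<le> g * w"
          using gt w by (cases "w = 0") (auto simp: divide_le_eq)
        then have t'P: "t' \<in> {c - w..c + w}"
          using g by (auto simp: t'_def abs_le_iff field_simps)
        have \<alpha>'_eq: "\<alpha>' v = (g - (1 - n * \<alpha> v)) / (g * n)" if "v \<in> \<sigma>" for v
          using that g n by (simp add: \<alpha>'_def b_def field_simps)
        have nn: "0 \<le> \<alpha>' v" for v
        proof (cases "v \<in> \<sigma>")
          case True
          have "1 - n * \<alpha> v \<le> 1 - n * Min (\<alpha> ` \<sigma>)" using True \<sigma> n by simp
          then have "1 - n * \<alpha> v \<le> g" using gM by linarith
          then show ?thesis using g n True by (simp add: \<alpha>'_eq)
        qed (use \<alpha> in \<open>auto simp: \<alpha>'_def b_def closed_simplex_def\<close>)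
        have "sum \<alpha>' \<sigma> = 1"
          using sums[of \<alpha> "1/g"] \<alpha> by (simp add: \<alpha>'_def closed_simplex_def)
        then have \<alpha>'C: "\<alpha>' \<in> closed_simplex \<sigma>"
          using nn \<alpha> by (auto simp: closed_simplex_def \<alpha>'_def b_def)
        have "g = \<bar>t - c\<bar> / w \<or> g = 1 - n * Min (\<alpha> ` \<sigma>)"
          by (auto simp: g_def G_def tx max_def)
        then have "\<bar>t' - c\<bar> / w = 1 \<or> (\<exists>v\<in>\<sigma>. \<alpha>' v = 0)"
        proof
          assume a: "g = \<bar>t - c\<bar> / w"
          have "\<bar>t' - c\<bar> / w = (\<bar>t - c\<bar> / w) / g" using g by (simp add: t'_def)
          then have "\<bar>t' - c\<bar> / w = 1" using a gn by (metis divide_self)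
          then show ?thesis ..
        next
          assume a: "g = 1 - n * Min (\<alpha> ` \<sigma>)"
          have "Min (\<alpha> ` \<sigma>) \<in> \<alpha> ` \<sigma>" using \<sigma> by simp
          then obtain v where v: "v \<in> \<sigma>" "Min (\<alpha> ` \<sigma>) = \<alpha> v" by auto
          have "\<alpha>' v = 0" using a v by (simp add: \<alpha>'_eq)
          then show ?thesis using v by blast
        qed
        then have "(g,(t',\<alpha>')) \<in> topspace S"
          using t'P \<alpha>'C g g1 by (auto simp: topS B_def)
        moreover have "x = q (g,(t',\<alpha>'))"
          using g by (auto simp: tx q_def t'_def \<alpha>'_def)
        ultimately show ?thesis by blast
      qed
    qed
  qed
  \<comment> \<open>\<open>q\<close> goes from a compact to a Hausdorff space, so it is a quotient
    map, and a map on the cell may be defined on \<open>[0,1]\<close> times the boundary.\<close>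
  have "closed_map S T q"
    using continuous_imp_closed_map[OF qcont compS HT] .
  then have quot: "quotient_map S T q"
    using continuous_closed_imp_quotient_map[OF qcont _ surj] by blast
  obtain a where a: "a \<in> topspace Z" using Z(2) by blast
  have "homotopic_with (\<lambda>x. True) Z Z id (\<lambda>x. a)"
    using Z(1) a by (simp add: contractible_space_alt)
  then obtain k where k: "continuous_map (prod_topology (top_of_set {0..1::real}) Z) Z k"
    "\<And>x. x \<in> topspace Z \<Longrightarrow> k (0,x) = x" "\<And>x. x \<in> topspace Z \<Longrightarrow> k (1,x) = a"
    by (auto simp: homotopic_with)
  \<comment> \<open>The contraction \<open>k\<close> run backwards: the prescribed value at
    \<open>s = 1\<close>, and the constant \<open>a\<close> at \<open>s = 0\<close>, where
    \<open>q\<close> identifies all boundary points.\<close>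
  define E where "E = (\<lambda>(s::real, p). k (1 - s, h p))"
  have Econt: "continuous_map S Z E"
  proof -
    have 1: "continuous_map S (top_of_set {0..1::real}) (\<lambda>x. 1 - fst x)"
      unfolding continuous_map_in_subtopology using topS by (intro conjI continuous_intros cfst) auto
    have 2: "continuous_map S Z (\<lambda>x. h (snd x))"
      using continuous_map_compose[OF _ h, of S snd] by (simp add: S_def o_def continuous_map_snd)
    have "continuous_map S Z (k \<circ> (\<lambda>x. (1 - fst x, h (snd x))))"
      by (rule continuous_map_compose[OF continuous_map_pairedI[OF 1 2] k(1)])
    then show ?thesis by (simp add: E_def o_def case_prod_unfold)
  qed
  have GB: "G p = 1" if "p \<in> B" for p
  proof -
    obtain t \<alpha> where p: "p = (t,\<alpha>)" by fastforce
    have t: "t \<in> {c - w..c + w}" and \<alpha>: "\<alpha> \<in> closed_simplex \<sigma>"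
      and or: "\<bar>t - c\<bar> / w = 1 \<or> (\<exists>v\<in>\<sigma>. \<alpha> v = 0)" using that by (auto simp: p B_def)
    have Min0: "0 \<le> Min (\<alpha> ` \<sigma>)" using \<alpha> \<sigma> by (auto simp: closed_simplex_def)
    have M0: "Min (\<alpha> ` \<sigma>) = 0" if z: "\<exists>v\<in>\<sigma>. \<alpha> v = 0"
    proof -
      obtain v where v: "v \<in> \<sigma>" "\<alpha> v = 0" using z by blast
      then have "Min (\<alpha> ` \<sigma>) \<le> \<alpha> v" using \<sigma> by simp
      then show ?thesis using Min0 v by simp
    qed
    have max1: "max x y = 1" if "x \<le> 1" "y \<le> 1" "x = 1 \<or> y = 1" for x y :: real
      using that by auto
    have "1 - n * Min (\<alpha> ` \<sigma>) \<le> 1" using Min0 n by simp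
    moreover have "\<bar>t - c\<bar> / w = 1 \<or> 1 - n * Min (\<alpha> ` \<sigma>) = 1" using or M0 by auto
    ultimately show ?thesis unfolding G_def p prod.case by (intro max1 tw[OF t])
  qed
  \<comment> \<open>\<open>G\<close> recovers the ratio, so \<open>q\<close> is injective away from
    \<open>s = 0\<close>, and \<open>E\<close> is constant on the fibres of
    \<open>q\<close>.\<close>
  have Gq: "G (q (s, p)) = s" if "0 \<le> s" "p \<in> B" for s p
  proof -
    obtain t \<alpha> where p: "p = (t,\<alpha>)" by fastforce
    have "(\<lambda>v. b v + s * (\<alpha> v - b v)) ` \<sigma> = (\<lambda>y. (1 - s) / n + s * y) ` (\<alpha> ` \<sigma>)"
      unfolding image_image using n by (intro image_cong) (auto simp: b_def field_simps)
    moreover have "mono (\<lambda>y. (1 - s) / n + s * y)" using that by (auto intro!: monoI mult_left_mono)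
    ultimately have "Min ((\<lambda>v. b v + s * (\<alpha> v - b v)) ` \<sigma>) = (1 - s) / n + s * Min (\<alpha> ` \<sigma>)"
      using mono_Min_commute[of "\<lambda>y. (1 - s) / n + s * y" "\<alpha> ` \<sigma>"] \<sigma> by auto
    moreover have "1 - n * ((1 - s) / n + s * M) = s * (1 - n * M)" for M
      using n by (simp add: field_simps)
    ultimately have "1 - n * Min ((\<lambda>v. b v + s * (\<alpha> v - b v)) ` \<sigma>) = s * (1 - n * Min (\<alpha> ` \<sigma>))"
      by simp
    moreover have "\<bar>s * (t - c)\<bar> = s * \<bar>t - c\<bar>" using that by (simp add: abs_mult)
    ultimately have "G (q (s, p)) = s * G p"
      using that by (simp add: G_def q_def p max_mult_distrib_left)
    then show ?thesis using GB that by simp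
  qed
  have fib: "E x = E y" if "x \<in> topspace S" "y \<in> topspace S" "q x = q y" for x y
  proof -
    obtain s p s' p' where xy: "x = (s,p)" "y = (s',p')" by (meson surj_pair)
    have *: "0 \<le> s" "0 \<le> s'" "p \<in> B" "p' \<in> B" using that by (auto simp: xy topS)
    then have ss: "s = s'" using Gq[of s p] Gq[of s' p'] that by (simp add: xy)
    have hp: "h p \<in> topspace Z" "h p' \<in> topspace Z"
      using continuous_map_image_subset_topspace[OF h] * BT by auto
    show ?thesis
    proof (cases "s = 0")
      case True
      then show ?thesis using ss hp k(3) by (simp add: E_def xy)
    next
      case False
      have 1: "s * (fst p - c) = s * (fst p' - c)" and 2: "(\<lambda>v. b v + s * (snd p v - b v)) = (\<lambda>v. b v + s * (snd p' v - b v))"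
        using that(3) unfolding xy q_def ss[symmetric] by (auto simp: case_prod_unfold)
      have "fst p = fst p'" using 1 False by simp
      moreover have "snd p = snd p'"
      proof
        fix v show "snd p v = snd p' v" using fun_cong[OF 2, of v] False by simp
      qed
      ultimately have "p = p'" by (simp add: prod_eq_iff)
      then show ?thesis using ss xy by simp
    qed
  qed
  have "\<exists>H. continuous_map T Z H \<and> (\<forall>x\<in>topspace S. H (q x) = E x)"
    by (rule quotient_map_lift_exists[OF quot Econt]) (use fib in blast)+
  then obtain H where H: "continuous_map T Z H" "\<And>x. x \<in> topspace S \<Longrightarrow> H (q x) = E x"
    by blast
  have "H p = h p" if "p \<in> B" for p
  proof -
    have "q (1,p) = p" by (simp add: q_def case_prod_unfold)
    moreover have "(1,p) \<in> topspace S" using that by (simp add: topS)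
    moreover have "h p \<in> topspace Z"
      using continuous_map_image_subset_topspace[OF h] that BT by auto
    ultimately show ?thesis using H(2)[of "(1,p)"] k(2) by (simp add: E_def)
  qed
  then show ?thesis using H(1) by blast
qed

text \<open>Non-emptiness is demanded separately because the empty space counts as
  contractible.\<close>

definition contractible_complex :: "'a set set \<Rightarrow> bool" where
  "contractible_complex L \<longleftrightarrow> abstract_complex L \<and> L \<noteq> {} \<and> contractible_space (realization L)"

text \<open>Continuity is required into the realization of the carrier itself; this spares any
  comparison of its weak topology with the subspace topology of a larger complex.\<close>

definition carried :: "'a set set \<Rightarrow> ('a set \<Rightarrow> 'b set set) \<Rightarrow> (('a \<Rightarrow> real) \<Rightarrow> ('b \<Rightarrow> real)) \<Rightarrow> bool" where
  "carried K \<Phi> f \<longleftrightarrow> (\<forall>\<sigma>\<in>K. continuous_map (simplex_space \<sigma>) (realization (\<Phi> \<sigma>)) f)"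

lemma vertex_in_closed_simplex:
  assumes "finite \<sigma>" "v \<in> \<sigma>"
  shows "(\<lambda>u. if u = v then 1 else 0) \<in> closed_simplex \<sigma>"
  using assms by (auto simp: closed_simplex_def)

lemma realization_nonempty:
  assumes "abstract_complex L" "L \<noteq> {}"
  shows "topspace (realization L) \<noteq> {}"
proof -
  obtain \<sigma> v where "\<sigma> \<in> L" "v \<in> \<sigma>" "finite \<sigma>"
    using assms by (metis abstract_complexD(1,2) all_not_in_conv)
  then have "(\<lambda>u. if u = v then 1 else 0) \<in> topspace (realization L)"
    using vertex_in_closed_simplex[of \<sigma> v] simplex_subset_realization[OF assms(1), of \<sigma>] by (simp add: subset_iff)
  then show ?thesis by auto
qed

lemma continuous_map_face_prod:
  assumes "finite \<sigma>"
  shows "continuous_map (subtopology (prod_topology P (simplex_space \<sigma>)) {x. snd x v = 0})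
           (prod_topology P (simplex_space (\<sigma> - {v}))) (\<lambda>x. x)"
proof -
  let ?X = "subtopology (prod_topology P (simplex_space \<sigma>)) {x. snd x v = 0}"
  have "continuous_map ?X P fst"
    by (simp add: continuous_map_from_subtopology continuous_map_fst)
  moreover have "continuous_map ?X (simplex_space \<sigma>) snd"
    by (simp add: continuous_map_from_subtopology continuous_map_snd)
  then have "continuous_map ?X euclideanreal (\<lambda>x. snd x u)" for u
    by (rule continuous_map_simplex_coord)
  then have "continuous_map ?X (simplex_space (\<sigma> - {v})) snd"
    unfolding continuous_map_into_simplex_space
    using assms by (auto simp: closed_simplex_def sum_diff1)
  ultimately have "continuous_map ?X (prod_topology P (simplex_space (\<sigma> - {v}))) (\<lambda>x. (fst x, snd x))"
    by (rule continuous_map_pairedI)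
  then show ?thesis by simp
qed

text \<open>Induction over skeleta: the boundary of the cell over \<open>\<sigma>\<close> is mapped
  into the carrier of \<open>\<sigma>\<close> by monotonicity, and contractibility extends the map
  over the cell. For \<open>w = 0\<close> no end of the interval is prescribed and a single map
  arises; for \<open>w > 0\<close> maps are prescribed at both ends and a homotopy between them
  arises.\<close>

lemma carrier_extension:
  fixes K :: "'a set set" and \<Phi> :: "'a set \<Rightarrow> 'b set set" and c w :: real
  defines "P \<equiv> {c - w..c + w}"
  defines "Q \<equiv> {t \<in> P. \<bar>t - c\<bar> / w = 1}"
  assumes K: "abstract_complex K" and w: "0 \<le> w"
    and \<Phi>: "\<And>\<sigma>. \<sigma> \<in> K \<Longrightarrow> contractible_complex (\<Phi> \<sigma>)"
    and mono: "\<And>\<sigma> \<tau>. \<sigma> \<in> K \<Longrightarrow> \<tau> \<in> K \<Longrightarrow> \<tau> \<subseteq> \<sigma> \<Longrightarrow> \<Phi> \<tau> \<subseteq> \<Phi> \<sigma>"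
    and h: "\<And>t. t \<in> Q \<Longrightarrow> carried K \<Phi> (\<lambda>\<alpha>. h (t,\<alpha>))"
  shows "\<exists>H. (\<forall>\<sigma>\<in>K. continuous_map (prod_topology (top_of_set P) (simplex_space \<sigma>)) (realization (\<Phi> \<sigma>)) H)
            \<and> (\<forall>t\<in>Q. \<forall>\<alpha>\<in>realization_set K. H (t,\<alpha>) = h (t,\<alpha>))"
proof -
  define T where "T \<sigma> = prod_topology (top_of_set P) (simplex_space \<sigma>)" for \<sigma> :: "'a set"
  define supp where "supp \<alpha> = {v. \<alpha> v \<noteq> 0}" for \<alpha> :: "'a \<Rightarrow> real"
  \<comment> \<open>\<open>n\<close> bounds the number of vertices, so stage \<open>n\<close> is the
    skeleton of dimension \<open>n - 1\<close>.\<close>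
  define good where "good n H \<longleftrightarrow> (\<forall>\<sigma>\<in>K. card \<sigma> \<le> n \<longrightarrow>
      continuous_map (T \<sigma>) (realization (\<Phi> \<sigma>)) H \<and> (\<forall>t\<in>Q. \<forall>\<alpha>\<in>closed_simplex \<sigma>. H (t,\<alpha>) = h (t,\<alpha>)))"
    for n H
  have supp: "supp \<alpha> \<subseteq> \<sigma>" "supp \<alpha> \<in> K" "\<alpha> \<in> closed_simplex (supp \<alpha>)"
    if "\<sigma> \<in> K" "\<alpha> \<in> closed_simplex \<sigma>" for \<sigma> \<alpha>
  proof -
    have fin: "finite \<sigma>" using abstract_complexD(1)[OF K that(1)] .
    show "supp \<alpha> \<subseteq> \<sigma>" "\<alpha> \<in> closed_simplex (supp \<alpha>)"
      unfolding supp_def using closed_simplex_support(1,4)[OF fin that(2)] .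
    show "supp \<alpha> \<in> K"
      unfolding supp_def by (rule abstract_complexD(3)[OF K that(1) closed_simplex_support(1,2)[OF fin that(2)]])
  qed
  have topT: "topspace (T \<sigma>) = P \<times> closed_simplex \<sigma>" for \<sigma> by (simp add: T_def)
  have finQ: "finite Q"
  proof (rule finite_subset)
    show "Q \<subseteq> {c - w, c + w}"
      using w by (auto simp: Q_def abs_if split: if_splits)
  qed simp
  have step: "\<exists>H'. good (Suc n) H' \<and> (\<forall>t \<alpha>. card (supp \<alpha>) \<le> n \<longrightarrow> H' (t,\<alpha>) = H (t,\<alpha>))"
    if H: "good n H" for n H
  proof -
    define B where "B \<sigma> = {(t,\<alpha>). t \<in> P \<and> \<alpha> \<in> closed_simplex \<sigma> \<and> (\<bar>t - c\<bar> / w = 1 \<or> (\<exists>v\<in>\<sigma>. \<alpha> v = 0))}" for \<sigma> :: "'a set"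
    define hb where "hb = (\<lambda>(t,\<alpha>). if t \<in> Q then h (t,\<alpha>) else H (t,\<alpha>))"
    have hcont: "continuous_map (subtopology (T \<sigma>) (B \<sigma>)) (realization (\<Phi> \<sigma>)) hb"
      if \<sigma>: "\<sigma> \<in> K" "card \<sigma> = Suc n" for \<sigma>
    proof -
      have fin: "finite \<sigma>" using abstract_complexD[OF K \<sigma>(1)] by simp
      have face: "\<sigma> - {v} \<in> K \<and> card (\<sigma> - {v}) \<le> n \<and> \<alpha> \<in> closed_simplex (\<sigma> - {v})"
        if "v \<in> \<sigma>" "\<alpha> \<in> closed_simplex \<sigma>" "\<alpha> v = 0" for v \<alpha>
      proof -
        have a: "\<alpha> \<in> closed_simplex (\<sigma> - {v})"
          using that fin by (auto simp: closed_simplex_def sum_diff1)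
        then have "sum \<alpha> (\<sigma> - {v}) = 1" by (simp add: closed_simplex_def)
        then have "\<sigma> - {v} \<noteq> {}" by (metis sum.empty zero_neq_one)
        then show ?thesis using a abstract_complexD(3)[OF K \<sigma>(1)] fin that \<sigma> by simp
      qed
      \<comment> \<open>A finite closed cover of the boundary of the cell: an index
        \<open>Inl t\<close> is an end of the interval, where \<open>h\<close> is prescribed, and
        \<open>Inr v\<close> is the facet opposite to \<open>v\<close>, where \<open>H\<close> is
        already built.\<close>
      define U where "U = case_sum (\<lambda>t. {x :: real \<times> ('a \<Rightarrow> real). fst x = t}) (\<lambda>v. {x. snd x v = 0})"
      define F where "F = case_sum (\<lambda>t x. h (t, snd x)) (\<lambda>v::'a. H)"
      let ?X = "subtopology (T \<sigma>) (B \<sigma>)"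
      have topX: "topspace ?X = B \<sigma>" by (auto simp: topT B_def)
      show ?thesis
      proof (rule pasting_lemma_closed[where I = "Inl ` Q \<union> Inr ` \<sigma>" and T = "\<lambda>i. topspace ?X \<inter> U i" and f = F])
        show "finite (Inl ` Q \<union> Inr ` \<sigma>)" using finQ fin by simp
        fix i assume i: "i \<in> Inl ` Q \<union> Inr ` \<sigma>"
        show "closedin ?X (topspace ?X \<inter> U i)"
        proof (cases i)
          case (Inl t)
          have "continuous_map (T \<sigma>) (top_of_set P) fst"
            unfolding T_def by (rule continuous_map_fst)
          then have "continuous_map ?X euclideanreal fst"
            by (simp add: continuous_map_in_subtopology continuous_map_from_subtopology)
          then have "closedin ?X {x \<in> topspace ?X. fst x \<in> {t}}"
            by (rule closedin_continuous_map_preimage) simp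
          moreover have "{x \<in> topspace ?X. fst x \<in> {t}} = topspace ?X \<inter> U i"
            by (auto simp: Inl U_def)
          ultimately show ?thesis by simp
        next
          case (Inr v)
          have "continuous_map ?X (simplex_space \<sigma>) snd"
            unfolding T_def by (intro continuous_map_from_subtopology continuous_map_snd)
          then have "continuous_map ?X euclideanreal (\<lambda>x. snd x v)"
            by (rule continuous_map_simplex_coord)
          then have "closedin ?X {x \<in> topspace ?X. snd x v \<in> {0}}"
            by (rule closedin_continuous_map_preimage) simp
          moreover have "{x \<in> topspace ?X. snd x v \<in> {0}} = topspace ?X \<inter> U i"
            by (auto simp: Inr U_def)
          ultimately show ?thesis by simp
        qed
        show "continuous_map (subtopology ?X (topspace ?X \<inter> U i)) (realization (\<Phi> \<sigma>)) (F i)"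
        proof (cases i)
          case (Inl t)
          then have "t \<in> Q" using i by auto
          then have "continuous_map (simplex_space \<sigma>) (realization (\<Phi> \<sigma>)) (\<lambda>\<alpha>. h (t,\<alpha>))"
            using h \<sigma> by (simp add: carried_def)
          then have "continuous_map (T \<sigma>) (realization (\<Phi> \<sigma>)) ((\<lambda>\<alpha>. h (t,\<alpha>)) \<circ> snd)"
            unfolding T_def by (intro continuous_map_compose[OF continuous_map_snd])
          then show ?thesis
            by (auto simp: Inl F_def o_def intro: continuous_map_from_subtopology)
        next
          case (Inr v)
          then have v: "v \<in> \<sigma>" using i by auto
          show ?thesis
          \<comment> \<open>A single vertex has no facet in \<open>K\<close>, and the corresponding
            piece of the cover is empty.\<close>
          proof (cases "\<sigma> - {v} = {}")
            case True
            have "x \<notin> topspace ?X \<inter> U i" for x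
            proof
              assume "x \<in> topspace ?X \<inter> U i"
              then have "\<sigma> - {v} \<in> K"
                using face[OF v, of "snd x"] by (auto simp: topX B_def U_def Inr)
              then show False using True abstract_complexD(2)[OF K] by blast
            qed
            then have "topspace ?X \<inter> U i = {}" by blast
            then show ?thesis by (simp add: Inr F_def)
          next
            case False
            then have fK: "\<sigma> - {v} \<in> K" by (intro abstract_complexD(3)[OF K \<sigma>(1)]) auto
            moreover have "card (\<sigma> - {v}) \<le> n" using v \<sigma> fin by simp
            ultimately have 1: "continuous_map (T (\<sigma> - {v})) (realization (\<Phi> (\<sigma> - {v}))) H"
              using H by (auto simp: good_def)
            have 2: "continuous_map (realization (\<Phi> (\<sigma> - {v}))) (realization (\<Phi> \<sigma>)) (\<lambda>x. x)"
              using \<Phi>[OF fK] \<Phi>[OF \<sigma>(1)] mono[OF \<sigma>(1) fK]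
              by (intro continuous_map_realization_mono) (auto simp: contractible_complex_def)
            have 3: "continuous_map (subtopology (T \<sigma>) {x. snd x v = 0}) (T (\<sigma> - {v})) (\<lambda>x. x)"
              unfolding T_def by (rule continuous_map_face_prod[OF fin])
            have "continuous_map (subtopology (T \<sigma>) {x. snd x v = 0}) (realization (\<Phi> \<sigma>)) H"
              using continuous_map_compose[OF continuous_map_compose[OF 3 1] 2] by (simp add: o_def)
            moreover have "subtopology ?X (topspace ?X \<inter> U i) = subtopology (subtopology (T \<sigma>) {x. snd x v = 0}) (B \<sigma>)"
              by (auto simp: subtopology_subtopology U_def Inr topT B_def intro!: arg_cong[of _ _ "subtopology (T \<sigma>)"])
            ultimately show ?thesis
              by (simp add: Inr F_def continuous_map_from_subtopology)
          qed
        qed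
      next
        fix i j x
        assume i: "i \<in> Inl ` Q \<union> Inr ` \<sigma>" and j: "j \<in> Inl ` Q \<union> Inr ` \<sigma>"
          and x: "x \<in> topspace ?X \<inter> (topspace ?X \<inter> U i) \<inter> (topspace ?X \<inter> U j)"
        obtain t \<alpha> where tx: "x = (t,\<alpha>)" by fastforce
        have agree: "H (t,\<alpha>) = h (t,\<alpha>)" if "t \<in> Q" "v \<in> \<sigma>" "\<alpha> v = 0" for v
          using face[of v \<alpha>] H that x by (auto simp: good_def tx topX B_def)
        show "F i x = F j x"
          using i j x agree by (auto simp: F_def U_def tx)
      next
        fix x assume x: "x \<in> topspace ?X"
        obtain t \<alpha> where tx: "x = (t,\<alpha>)" by fastforce
        show "\<exists>j. j \<in> Inl ` Q \<union> Inr ` \<sigma> \<and> x \<in> topspace ?X \<inter> U j \<and> hb x = F j x"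
        proof (cases "t \<in> Q")
          case True
          then show ?thesis using x
            by (intro exI[of _ "Inl t"]) (auto simp: U_def F_def hb_def tx)
        next
          case False
          then obtain v where "v \<in> \<sigma>" "\<alpha> v = 0"
            using x by (auto simp: topX B_def tx Q_def)
          then show ?thesis using x False
            by (intro exI[of _ "Inr v"]) (auto simp: U_def F_def hb_def tx)
        qed
      qed
    qed
    have "\<forall>\<sigma>. \<exists>E. \<sigma> \<in> K \<and> card \<sigma> = Suc n \<longrightarrow>
        continuous_map (T \<sigma>) (realization (\<Phi> \<sigma>)) E \<and> (\<forall>x\<in>B \<sigma>. E x = hb x)"
    proof
      fix \<sigma>
      show "\<exists>E. \<sigma> \<in> K \<and> card \<sigma> = Suc n \<longrightarrow>
        continuous_map (T \<sigma>) (realization (\<Phi> \<sigma>)) E \<and> (\<forall>x\<in>B \<sigma>. E x = hb x)"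
      proof (cases "\<sigma> \<in> K \<and> card \<sigma> = Suc n")
        case True
        have "\<exists>E. continuous_map (T \<sigma>) (realization (\<Phi> \<sigma>)) E \<and> (\<forall>x\<in>B \<sigma>. E x = hb x)"
          unfolding T_def B_def P_def
        proof (rule cell_extension)
          show "finite \<sigma>" "\<sigma> \<noteq> {}" using abstract_complexD(1,2)[OF K] True by auto
          show "contractible_space (realization (\<Phi> \<sigma>))" "topspace (realization (\<Phi> \<sigma>)) \<noteq> {}"
            using \<Phi>[of \<sigma>] True realization_nonempty[of "\<Phi> \<sigma>"] by (auto simp: contractible_complex_def)
        qed (use hcont[of \<sigma>] True w in \<open>auto simp: T_def B_def P_def\<close>)
        then show ?thesis by blast
      qed blast
    qed
    from choice[OF this] obtain E where "\<forall>\<sigma>. \<sigma> \<in> K \<and> card \<sigma> = Suc n \<longrightarrow>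
        continuous_map (T \<sigma>) (realization (\<Phi> \<sigma>)) (E \<sigma>) \<and> (\<forall>x\<in>B \<sigma>. E \<sigma> x = hb x)" ..
    note Eall = this
    have E: "continuous_map (T \<sigma>) (realization (\<Phi> \<sigma>)) (E \<sigma>)" "\<And>x. x \<in> B \<sigma> \<Longrightarrow> E \<sigma> x = hb x"
      if "\<sigma> \<in> K" "card \<sigma> = Suc n" for \<sigma>
      using Eall that by simp_all
    \<comment> \<open>The support of a point selects the cell whose extension is used. Points with
      small support keep their value, which makes the limit over all stages possible.\<close>
    define H' where "H' = (\<lambda>(t,\<alpha>). if card (supp \<alpha>) \<le> n then H (t,\<alpha>) else E (supp \<alpha>) (t,\<alpha>))"
    have H'E: "H' x = E \<sigma> x" if \<sigma>: "\<sigma> \<in> K" "card \<sigma> = Suc n" and x: "x \<in> topspace (T \<sigma>)" for \<sigma> x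
    proof -
      obtain t \<alpha> where tx: "x = (t,\<alpha>)" "t \<in> P" "\<alpha> \<in> closed_simplex \<sigma>" using x by (auto simp: topT)
      have fin: "finite \<sigma>" using abstract_complexD[OF K \<sigma>(1)] by simp
      show ?thesis
      proof (cases "card (supp \<alpha>) \<le> n")
        case True
        then have "supp \<alpha> \<noteq> \<sigma>" using \<sigma> by auto
        then obtain v where v: "v \<in> \<sigma>" "\<alpha> v = 0"
          using supp(1)[OF \<sigma>(1) tx(3)] by (auto simp: supp_def)
        then have "x \<in> B \<sigma>" using tx by (auto simp: B_def)
        then have "E \<sigma> x = hb x" using E(2) \<sigma> by blast
        moreover have "t \<in> Q \<Longrightarrow> H (t,\<alpha>) = h (t,\<alpha>)"
          using H supp[OF \<sigma>(1) tx(3)] True by (auto simp: good_def)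
        ultimately show ?thesis using True by (simp add: H'_def hb_def tx)
      next
        case False
        then have "supp \<alpha> = \<sigma>"
          using supp(1)[OF \<sigma>(1) tx(3)] \<sigma> fin by (metis card_seteq not_less_eq_eq)
        then show ?thesis using False by (simp add: H'_def tx)
      qed
    qed
    have "good (Suc n) H'"
      unfolding good_def
    proof (intro ballI impI)
      fix \<sigma> assume \<sigma>: "\<sigma> \<in> K" "card \<sigma> \<le> Suc n"
      have fin: "finite \<sigma>" using abstract_complexD[OF K \<sigma>(1)] by simp
      show "continuous_map (T \<sigma>) (realization (\<Phi> \<sigma>)) H' \<and> (\<forall>t\<in>Q. \<forall>\<alpha>\<in>closed_simplex \<sigma>. H' (t,\<alpha>) = h (t,\<alpha>))"
      proof (cases "card \<sigma> \<le> n")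
        case True
        have "H' (t,\<alpha>) = H (t,\<alpha>)" if "\<alpha> \<in> closed_simplex \<sigma>" for t \<alpha>
          using card_mono[OF fin supp(1)[OF \<sigma>(1) that]] True by (auto simp: H'_def)
        moreover from this have "continuous_map (T \<sigma>) (realization (\<Phi> \<sigma>)) H'"
          using H \<sigma> True unfolding good_def by (auto simp: topT intro!: continuous_map_eq[of _ _ H H'])
        ultimately show ?thesis
          using H \<sigma> True unfolding good_def by auto
      next
        case False
        then have c: "card \<sigma> = Suc n" using \<sigma> by simp
        have "continuous_map (T \<sigma>) (realization (\<Phi> \<sigma>)) H'"
          using continuous_map_eq[OF E(1)[OF \<sigma>(1) c]] H'E[OF \<sigma>(1) c] by metis
        moreover have "H' (t,\<alpha>) = h (t,\<alpha>)" if "t \<in> Q" "\<alpha> \<in> closed_simplex \<sigma>" for t \<alpha>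
        proof -
          have "(t,\<alpha>) \<in> B \<sigma>" "(t,\<alpha>) \<in> topspace (T \<sigma>)" using that by (auto simp: B_def Q_def topT)
          then have "H' (t,\<alpha>) = hb (t,\<alpha>)" using H'E E(2) \<sigma> c by metis
          then show ?thesis using that by (simp add: hb_def)
        qed
        ultimately show ?thesis by blast
      qed
    qed
    then show ?thesis by (auto simp: H'_def intro!: exI[of _ H'])
  qed
  \<comment> \<open>Vacuous, as every face has at least one vertex.\<close>
  have "good 0 h"
    unfolding good_def using abstract_complexD(1,2)[OF K] by auto
  then have "\<exists>F. \<forall>n. good n (F n) \<and> (\<forall>t \<alpha>. card (supp \<alpha>) \<le> n \<longrightarrow> F (Suc n) (t,\<alpha>) = F n (t,\<alpha>))"
    by (intro dependent_nat_choice) (use step in blast)+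
  then obtain F where F: "\<And>n. good n (F n)" "\<And>n t \<alpha>. card (supp \<alpha>) \<le> n \<Longrightarrow> F (Suc n) (t,\<alpha>) = F n (t,\<alpha>)"
    by blast
  have F_eq: "F n (t,\<alpha>) = F (card (supp \<alpha>)) (t,\<alpha>)" if "card (supp \<alpha>) \<le> n" for n t \<alpha>
    using that by (induction rule: dec_induct) (simp_all add: F(2))
  \<comment> \<open>The value at a point is frozen from the stage that reaches its support, so this
    limit agrees on each simplex with one single stage.\<close>
  define G where "G = (\<lambda>(t,\<alpha>). F (card (supp \<alpha>)) (t,\<alpha>))"
  have GF: "G (t,\<alpha>) = F (card \<sigma>) (t,\<alpha>)" if "\<sigma> \<in> K" "\<alpha> \<in> closed_simplex \<sigma>" for \<sigma> t \<alpha>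
    using F_eq[OF card_mono[OF _ supp(1)[OF that]]] abstract_complexD(1)[OF K that(1)]
    by (simp add: G_def)
  show ?thesis
  proof (intro exI conjI ballI)
    fix \<sigma> assume \<sigma>: "\<sigma> \<in> K"
    have "continuous_map (T \<sigma>) (realization (\<Phi> \<sigma>)) (F (card \<sigma>))"
      using F(1) \<sigma> by (auto simp: good_def)
    then have "continuous_map (T \<sigma>) (realization (\<Phi> \<sigma>)) G"
      by (rule continuous_map_eq) (use GF[OF \<sigma>] in \<open>auto simp: topT\<close>)
    then show "continuous_map (prod_topology (top_of_set P) (simplex_space \<sigma>)) (realization (\<Phi> \<sigma>)) G"
      by (simp add: T_def)
  next
    fix t \<alpha> assume t: "t \<in> Q" and "\<alpha> \<in> realization_set K"
    then obtain \<sigma> where \<sigma>: "\<sigma> \<in> K" "\<alpha> \<in> closed_simplex \<sigma>" using realization_set_eq[OF K] by blast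
    have "F (card \<sigma>) (t,\<alpha>) = h (t,\<alpha>)"
      using F(1)[of "card \<sigma>"] \<sigma> t by (auto simp: good_def)
    then show "G (t,\<alpha>) = h (t,\<alpha>)" using GF[OF \<sigma>] by simp
  qed
qed

theorem carried_map_exists:
  assumes K: "abstract_complex K"
    and \<Phi>: "\<And>\<sigma>. \<sigma> \<in> K \<Longrightarrow> contractible_complex (\<Phi> \<sigma>)"
    and mono: "\<And>\<sigma> \<tau>. \<sigma> \<in> K \<Longrightarrow> \<tau> \<in> K \<Longrightarrow> \<tau> \<subseteq> \<sigma> \<Longrightarrow> \<Phi> \<tau> \<subseteq> \<Phi> \<sigma>"
  obtains f where "carried K \<Phi> f"
proof -
  \<comment> \<open>With \<open>w = 0\<close> the set of prescribed ends is empty, since division by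
    0 yields 0 and not 1; \<open>undefined\<close> merely fills the place of the boundary
    data.\<close>
  have "\<exists>H. (\<forall>\<sigma>\<in>K. continuous_map (prod_topology (top_of_set {0 - 0..0 + 0::real}) (simplex_space \<sigma>)) (realization (\<Phi> \<sigma>)) H)
      \<and> (\<forall>t\<in>{t \<in> {0 - 0..0 + 0}. \<bar>t - 0\<bar> / 0 = 1}. \<forall>\<alpha>\<in>realization_set K. H (t,\<alpha>) = undefined (t,\<alpha>))"
    by (rule carrier_extension[OF K _ \<Phi> mono]) auto
  then obtain H where H: "\<And>\<sigma>. \<sigma> \<in> K \<Longrightarrow>
      continuous_map (prod_topology (top_of_set {0 - 0..0 + 0::real}) (simplex_space \<sigma>)) (realization (\<Phi> \<sigma>)) H"
    by auto
  have "carried K \<Phi> (H \<circ> (\<lambda>\<alpha>. (0,\<alpha>)))"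
    unfolding carried_def
  proof
    fix \<sigma> assume \<sigma>: "\<sigma> \<in> K"
    have "continuous_map (simplex_space \<sigma>) (prod_topology (top_of_set {0 - 0..0 + 0::real}) (simplex_space \<sigma>)) (\<lambda>\<alpha>. (0,\<alpha>))"
      by (intro continuous_map_pairedI) auto
    then show "continuous_map (simplex_space \<sigma>) (realization (\<Phi> \<sigma>)) (H \<circ> (\<lambda>\<alpha>. (0,\<alpha>)))"
      using H[OF \<sigma>] continuous_map_compose by blast
  qed
  then show ?thesis using that by blast
qed

theorem carried_maps_homotopic:
  assumes K: "abstract_complex K" and M: "abstract_complex M"
    and \<Phi>: "\<And>\<sigma>. \<sigma> \<in> K \<Longrightarrow> contractible_complex (\<Phi> \<sigma>)"
    and sub: "\<And>\<sigma>. \<sigma> \<in> K \<Longrightarrow> \<Phi> \<sigma> \<subseteq> M"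
    and mono: "\<And>\<sigma> \<tau>. \<sigma> \<in> K \<Longrightarrow> \<tau> \<in> K \<Longrightarrow> \<tau> \<subseteq> \<sigma> \<Longrightarrow> \<Phi> \<tau> \<subseteq> \<Phi> \<sigma>"
    and f: "carried K \<Phi> f" and g: "carried K \<Phi> g"
  shows "homotopic_with (\<lambda>x. True) (realization K) (realization M) f g"
proof -
  let ?h = "\<lambda>(t::real,\<alpha>). if t = 0 then f \<alpha> else g \<alpha>"
  \<comment> \<open>Centre and half width \<open>1/2\<close> give the interval \<open>[0,1]\<close>
    with both ends prescribed.\<close>
  have P: "{1/2 - 1/2..1/2 + 1/2::real} = {0..1}" by simp
  have Q: "{t \<in> {1/2 - 1/2..1/2 + 1/2::real}. \<bar>t - 1/2\<bar> / (1/2) = 1} = {0,1}"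
    by (auto simp: abs_if)
  have "carried K \<Phi> (\<lambda>\<alpha>. ?h (t,\<alpha>))" if "t \<in> {0,1}" for t
    using that f g by auto
  then have "\<exists>H. (\<forall>\<sigma>\<in>K. continuous_map (prod_topology (top_of_set {1/2 - 1/2..1/2 + 1/2::real}) (simplex_space \<sigma>)) (realization (\<Phi> \<sigma>)) H)
      \<and> (\<forall>t\<in>{t \<in> {1/2 - 1/2..1/2 + 1/2}. \<bar>t - 1/2\<bar> / (1/2) = 1}. \<forall>\<alpha>\<in>realization_set K. H (t,\<alpha>) = ?h (t,\<alpha>))"
    unfolding Q[symmetric] by (intro carrier_extension[OF K _ \<Phi> mono]) auto
  then obtain H where H0: "\<forall>\<sigma>\<in>K. continuous_map (prod_topology (top_of_set {1/2 - 1/2..1/2 + 1/2::real}) (simplex_space \<sigma>)) (realization (\<Phi> \<sigma>)) H"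
      "\<forall>t\<in>{t \<in> {1/2 - 1/2..1/2 + 1/2}. \<bar>t - 1/2\<bar> / (1/2) = 1}. \<forall>\<alpha>\<in>realization_set K. H (t,\<alpha>) = ?h (t,\<alpha>)"
    by (elim exE conjE)
  have H: "continuous_map (prod_topology (top_of_set {0..1::real}) (simplex_space \<sigma>)) (realization (\<Phi> \<sigma>)) H"
    if "\<sigma> \<in> K" for \<sigma>
    using H0(1) that unfolding P by blast
  have H01: "H (0,\<alpha>) = f \<alpha>" "H (1,\<alpha>) = g \<alpha>" if "\<alpha> \<in> realization_set K" for \<alpha>
    using H0(2) that unfolding Q by auto
  show ?thesis
  proof (rule homotopic_with_realizationI[OF K, of _ H])
    fix \<sigma> assume \<sigma>: "\<sigma> \<in> K"
    have "continuous_map (realization (\<Phi> \<sigma>)) (realization M) (\<lambda>x. x)"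
      using \<Phi>[OF \<sigma>] sub[OF \<sigma>] M by (intro continuous_map_realization_mono) (auto simp: contractible_complex_def)
    then show "continuous_map (prod_topology (top_of_set {0..1}) (simplex_space \<sigma>)) (realization M) H"
      using continuous_map_compose[OF H[OF \<sigma>]] by (simp add: o_def)
  qed (use H01 in \<open>auto simp: topspace_realization[OF K]\<close>)
qed

section \<open>Contractible complexes: simplices, cones, unions and dominated vertices\<close>

definition all_faces :: "'a set \<Rightarrow> 'a set set" where
  "all_faces \<sigma> = {\<tau>. \<tau> \<subseteq> \<sigma> \<and> \<tau> \<noteq> {}}"

lemma abstract_complexI:
  assumes "\<And>\<sigma>. \<sigma> \<in> K \<Longrightarrow> finite \<sigma>" "\<And>\<sigma>. \<sigma> \<in> K \<Longrightarrow> \<sigma> \<noteq> {}"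
    and "\<And>\<sigma> \<tau>. \<sigma> \<in> K \<Longrightarrow> \<tau> \<subseteq> \<sigma> \<Longrightarrow> \<tau> \<noteq> {} \<Longrightarrow> \<tau> \<in> K"
  shows "abstract_complex K"
  using assms unfolding abstract_complex_def by simp

lemma abstract_complex_Un:
  assumes "abstract_complex A" "abstract_complex B"
  shows "abstract_complex (A \<union> B)"
proof (rule abstract_complexI)
  fix \<sigma> assume \<sigma>: "\<sigma> \<in> A \<union> B"
  then show "finite \<sigma>" "\<sigma> \<noteq> {}"
    using abstract_complexD(1,2)[OF assms(1), of \<sigma>] abstract_complexD(1,2)[OF assms(2), of \<sigma>] by auto
  fix \<tau> assume "\<tau> \<subseteq> \<sigma>" "\<tau> \<noteq> {}"
  then show "\<tau> \<in> A \<union> B"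
    using \<sigma> abstract_complexD(3)[OF assms(1), of \<sigma> \<tau>] abstract_complexD(3)[OF assms(2), of \<sigma> \<tau>] by auto
qed

lemma abstract_complex_Int:
  assumes "abstract_complex A" "abstract_complex B"
  shows "abstract_complex (A \<inter> B)"
proof (rule abstract_complexI)
  fix \<sigma> assume \<sigma>: "\<sigma> \<in> A \<inter> B"
  then show "finite \<sigma>" "\<sigma> \<noteq> {}"
    using abstract_complexD(1,2)[OF assms(1), of \<sigma>] by auto
  fix \<tau> assume "\<tau> \<subseteq> \<sigma>" "\<tau> \<noteq> {}"
  then show "\<tau> \<in> A \<inter> B"
    using \<sigma> abstract_complexD(3)[OF assms(1), of \<sigma> \<tau>] abstract_complexD(3)[OF assms(2), of \<sigma> \<tau>] by auto
qed

lemma abstract_complex_filter: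
  assumes K: "abstract_complex K" and P: "\<And>\<sigma> \<tau>. \<sigma> \<in> K \<Longrightarrow> P \<sigma> \<Longrightarrow> \<tau> \<subseteq> \<sigma> \<Longrightarrow> \<tau> \<noteq> {} \<Longrightarrow> P \<tau>"
  shows "abstract_complex {\<sigma> \<in> K. P \<sigma>}"
proof (rule abstract_complexI)
  fix \<sigma> assume \<sigma>: "\<sigma> \<in> {\<sigma> \<in> K. P \<sigma>}"
  then show "finite \<sigma>" "\<sigma> \<noteq> {}"
    using abstract_complexD(1,2)[OF K, of \<sigma>] by auto
  fix \<tau> assume "\<tau> \<subseteq> \<sigma>" "\<tau> \<noteq> {}"
  then show "\<tau> \<in> {\<sigma> \<in> K. P \<sigma>}"
    using \<sigma> abstract_complexD(3)[OF K, of \<sigma> \<tau>] P[of \<sigma> \<tau>] by auto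
qed

lemma abstract_complex_all_faces: "finite \<sigma> \<Longrightarrow> abstract_complex (all_faces \<sigma>)"
  by (auto simp: abstract_complex_def all_faces_def intro: finite_subset)

text \<open>The straight-line homotopy to \<open>v\<close> moves the simplex on
  \<open>\<sigma>\<close> inside that on \<open>insert v \<sigma>\<close>, where its continuity is a
  matter of coordinates.\<close>

lemma contractible_cone:
  assumes L: "abstract_complex L" "L \<noteq> {}" and cone: "\<And>\<sigma>. \<sigma> \<in> L \<Longrightarrow> insert v \<sigma> \<in> L"
  shows "contractible_complex L"
proof -
  define e where "e = (\<lambda>u. if u = v then 1 else 0::real)"
  define h where "h = (\<lambda>(t::real, \<alpha>). (\<lambda>u. (1 - t) * \<alpha> u + t * e u))"
  have "homotopic_with (\<lambda>x. True) (realization L) (realization L) id (\<lambda>x. e)"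
  proof (rule homotopic_with_realizationI[OF L(1), of _ h])
    fix \<sigma> assume \<sigma>: "\<sigma> \<in> L"
    let ?X = "prod_topology (top_of_set {0..1::real}) (simplex_space \<sigma>)"
    have fin: "finite \<sigma>" using abstract_complexD(1)[OF L(1) \<sigma>] .
    have 1: "continuous_map ?X euclideanreal fst"
      using continuous_map_fst[of "top_of_set {0..1::real}" "simplex_space \<sigma>"] by (simp add: continuous_map_in_subtopology)
    have 2: "continuous_map ?X euclideanreal (\<lambda>x. snd x u)" for u
      using continuous_map_simplex_coord[OF continuous_map_snd] .
    have "h x \<in> closed_simplex (insert v \<sigma>)" if "x \<in> topspace ?X" for x
    proof -
      obtain t \<alpha> where x: "x = (t,\<alpha>)" "0 \<le> t" "t \<le> 1" "\<alpha> \<in> closed_simplex \<sigma>" using \<open>x \<in> topspace ?X\<close> by auto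
      have \<alpha>: "\<alpha> \<in> closed_simplex (insert v \<sigma>)"
        using x(4) closed_simplex_mono[of "insert v \<sigma>" \<sigma>] fin by auto
      have e: "e \<in> closed_simplex (insert v \<sigma>)"
        unfolding e_def using fin by (intro vertex_in_closed_simplex) auto
      have "(\<Sum>u\<in>insert v \<sigma>. (1 - t) * \<alpha> u + t * e u) = (1 - t) * sum \<alpha> (insert v \<sigma>) + t * sum e (insert v \<sigma>)"
        by (simp only: sum.distrib sum_distrib_left)
      then have "(\<Sum>u\<in>insert v \<sigma>. (1 - t) * \<alpha> u + t * e u) = 1"
        using \<alpha> e unfolding closed_simplex_def by simp
      then show ?thesis
        using \<alpha> e x(2,3) unfolding closed_simplex_def by (simp add: h_def x(1))
    qed
    then have "continuous_map ?X (simplex_space (insert v \<sigma>)) h"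
      unfolding continuous_map_into_simplex_space h_def case_prod_unfold
      by (intro conjI allI continuous_intros 1 2) auto
    then have "continuous_map ?X (realization L) ((\<lambda>x. x) \<circ> h)"
      by (rule continuous_map_compose) (rule continuous_map_simplex_realization[OF L(1) cone[OF \<sigma>]])
    then show "continuous_map ?X (realization L) h" by (simp add: o_def)
  qed (auto simp: h_def)
  then show ?thesis
    using L by (auto simp: contractible_complex_def contractible_space_def)
qed

lemma contractible_all_faces:
  assumes "finite \<sigma>" "\<sigma> \<noteq> {}"
  shows "contractible_complex (all_faces \<sigma>)"
proof -
  obtain v where "v \<in> \<sigma>" using assms by blast
  then show ?thesis
    using assms by (intro contractible_cone[of _ v] abstract_complex_all_faces) (auto simp: all_faces_def)
qed

lemma carried_id:
  assumes "\<And>\<sigma>. \<sigma> \<in> K \<Longrightarrow> abstract_complex (\<Phi> \<sigma>)" "\<And>\<sigma>. \<sigma> \<in> K \<Longrightarrow> \<sigma> \<in> \<Phi> \<sigma>"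
  shows "carried K \<Phi> (\<lambda>x. x)"
  using assms by (auto simp: carried_def intro: continuous_map_simplex_realization)

lemma carried_mono:
  assumes f: "carried K \<Phi> f" and "K' \<subseteq> K"
    and "\<And>\<sigma>. \<sigma> \<in> K' \<Longrightarrow> abstract_complex (\<Phi> \<sigma>) \<and> abstract_complex (\<Phi>' \<sigma>) \<and> \<Phi> \<sigma> \<subseteq> \<Phi>' \<sigma>"
  shows "carried K' \<Phi>' f"
  unfolding carried_def
proof
  fix \<sigma> assume \<sigma>: "\<sigma> \<in> K'"
  then have "continuous_map (simplex_space \<sigma>) (realization (\<Phi> \<sigma>)) f"
    using f \<open>K' \<subseteq> K\<close> by (auto simp: carried_def)
  moreover have "continuous_map (realization (\<Phi> \<sigma>)) (realization (\<Phi>' \<sigma>)) (\<lambda>x. x)"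
    using assms(3)[OF \<sigma>] by (intro continuous_map_realization_mono) auto
  ultimately have "continuous_map (simplex_space \<sigma>) (realization (\<Phi>' \<sigma>)) ((\<lambda>x. x) \<circ> f)"
    by (rule continuous_map_compose)
  then show "continuous_map (simplex_space \<sigma>) (realization (\<Phi>' \<sigma>)) f"
    by (simp add: o_def)
qed

lemma carried_imp_continuous_map:
  assumes K: "abstract_complex K" and M: "abstract_complex M" and f: "carried K \<Phi> f"
    and \<Phi>: "\<And>\<sigma>. \<sigma> \<in> K \<Longrightarrow> abstract_complex (\<Phi> \<sigma>) \<and> \<Phi> \<sigma> \<subseteq> M"
  shows "continuous_map (realization K) (realization M) f"
proof -
  have "carried K (\<lambda>_. M) f"
    by (rule carried_mono[OF f subset_refl]) (use \<Phi> M in blast)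
  then show ?thesis
    by (simp add: continuous_map_from_realization[OF K] carried_def)
qed

text \<open>The identity and the constant map at the vertex \<open>v\<close> are carried by the same
  \<open>\<Phi>\<close>, hence homotopic.\<close>

lemma contractible_complex_carrier:
  assumes K: "abstract_complex K" "K \<noteq> {}"
    and \<Phi>: "\<And>\<sigma>. \<sigma> \<in> K \<Longrightarrow> contractible_complex (\<Phi> \<sigma>)" "\<And>\<sigma>. \<sigma> \<in> K \<Longrightarrow> \<Phi> \<sigma> \<subseteq> K"
    and mono: "\<And>\<sigma> \<tau>. \<sigma> \<in> K \<Longrightarrow> \<tau> \<in> K \<Longrightarrow> \<tau> \<subseteq> \<sigma> \<Longrightarrow> \<Phi> \<tau> \<subseteq> \<Phi> \<sigma>"
    and self: "\<And>\<sigma>. \<sigma> \<in> K \<Longrightarrow> \<sigma> \<in> \<Phi> \<sigma>" and v: "\<And>\<sigma>. \<sigma> \<in> K \<Longrightarrow> {v} \<in> \<Phi> \<sigma>"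
  shows "contractible_complex K"
proof -
  let ?e = "\<lambda>u. if u = v then 1 else 0::real"
  have "carried K \<Phi> (\<lambda>x. ?e)"
    unfolding carried_def
  proof
    fix \<sigma> assume \<sigma>: "\<sigma> \<in> K"
    have "closed_simplex {v} \<subseteq> topspace (realization (\<Phi> \<sigma>))"
      using \<Phi>(1)[OF \<sigma>] by (intro simplex_subset_realization v \<sigma>) (simp add: contractible_complex_def)
    then have "?e \<in> topspace (realization (\<Phi> \<sigma>))"
      by (rule subsetD) (simp add: vertex_in_closed_simplex)
    then show "continuous_map (simplex_space \<sigma>) (realization (\<Phi> \<sigma>)) (\<lambda>x. ?e)" by simp
  qed
  moreover have "carried K \<Phi> (\<lambda>x. x)"
    using \<Phi> self by (intro carried_id) (auto simp: contractible_complex_def)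
  ultimately have "homotopic_with (\<lambda>x. True) (realization K) (realization K) (\<lambda>x. x) (\<lambda>x. ?e)"
    by (intro carried_maps_homotopic[OF K(1) K(1) \<Phi> mono])
  then show ?thesis
    using K by (auto simp: contractible_complex_def contractible_space_def id_def)
qed

text \<open>A carrier with only the three values \<open>A \<inter> B\<close>, \<open>A\<close> and
  \<open>B\<close> suffices. It is monotone because the faces of a simplex of \<open>A\<close> stay
  in \<open>A\<close>, and likewise for \<open>B\<close>.\<close>

lemma contractible_union:
  assumes A: "contractible_complex A" and B: "contractible_complex B" and AB: "contractible_complex (A \<inter> B)"
  shows "contractible_complex (A \<union> B)"
proof -
  have C: "abstract_complex A" "abstract_complex B" "abstract_complex (A \<inter> B)" and "A \<inter> B \<noteq> {}"
    using A B AB by (simp_all add: contractible_complex_def)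
  then obtain \<sigma> where \<sigma>: "\<sigma> \<in> A \<inter> B" by blast
  then obtain v where "v \<in> \<sigma>" using abstract_complexD(2)[OF C(3)] by blast
  then have v: "{v} \<in> A \<inter> B"
    by (intro abstract_complexD(3)[OF C(3) \<sigma>]) auto
  define \<Phi> where "\<Phi> \<sigma> = (if \<sigma> \<in> A \<inter> B then A \<inter> B else if \<sigma> \<in> A then A else B)" for \<sigma>
  show ?thesis
  proof (rule contractible_complex_carrier[of _ \<Phi> v])
    show "abstract_complex (A \<union> B)"
      by (rule abstract_complex_Un[OF C(1,2)])
    fix \<sigma> \<tau> assume *: "\<sigma> \<in> A \<union> B" "\<tau> \<in> A \<union> B" "\<tau> \<subseteq> \<sigma>"
    then have "\<tau> \<noteq> {}" using abstract_complexD(2)[OF C(1)] abstract_complexD(2)[OF C(2)] by blast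
    then show "\<Phi> \<tau> \<subseteq> \<Phi> \<sigma>"
      using * abstract_complexD(3)[OF C(1), of \<sigma> \<tau>] abstract_complexD(3)[OF C(2), of \<sigma> \<tau>] by (auto simp: \<Phi>_def)
  qed (use v assms in \<open>auto simp: \<Phi>_def split: if_splits\<close>)
qed

text \<open>\<open>K\<close> is the union of the deletion of \<open>y\<close> and the closed star of
  \<open>y\<close>. The star is a cone with apex \<open>y\<close>, and their intersection, the link,
  is a cone with apex \<open>g\<close> because \<open>g\<close> dominates \<open>y\<close>.\<close>

lemma contractible_remove_dominated:
  assumes K: "abstract_complex K" and dom: "\<And>\<sigma>. \<sigma> \<in> K \<Longrightarrow> y \<in> \<sigma> \<Longrightarrow> insert g \<sigma> \<in> K" and "g \<noteq> y"
    and del: "contractible_complex {\<sigma> \<in> K. y \<notin> \<sigma>}"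
  shows "contractible_complex K"
proof (cases "\<exists>\<sigma>\<in>K. y \<in> \<sigma>")
  case False
  then have "{\<sigma> \<in> K. y \<notin> \<sigma>} = K" by auto
  then show ?thesis using del by simp
next
  case True
  then have y: "{y} \<in> K" using abstract_complexD(3)[OF K] by blast
  then have g: "{g,y} \<in> K" using dom by auto
  define B where "B = {\<sigma> \<in> K. insert y \<sigma> \<in> K}"
  have sub: "\<tau> \<in> K" if "\<sigma> \<in> K" "\<tau> \<subseteq> \<sigma>" "\<tau> \<noteq> {}" for \<sigma> \<tau>
    using abstract_complexD(3)[OF K] that by blast
  have fin: "finite \<sigma>" "\<sigma> \<noteq> {}" if "\<sigma> \<in> K" for \<sigma> using abstract_complexD[OF K that] by auto
  have Bc: "abstract_complex B"
    unfolding B_def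
  proof (rule abstract_complex_filter[OF K])
    fix \<sigma> \<tau> assume "insert y \<sigma> \<in> K" "\<tau> \<subseteq> \<sigma>"
    then show "insert y \<tau> \<in> K" by (intro sub[of "insert y \<sigma>" "insert y \<tau>"]) auto
  qed
  then have "contractible_complex B"
    using y by (intro contractible_cone[of B y]) (auto simp: B_def)
  moreover have "contractible_complex ({\<sigma> \<in> K. y \<notin> \<sigma>} \<inter> B)"
  proof (rule contractible_cone[of _ g])
    show "abstract_complex ({\<sigma> \<in> K. y \<notin> \<sigma>} \<inter> B)"
      by (intro abstract_complex_Int Bc abstract_complex_filter[OF K]) auto
    have "{g} \<in> {\<sigma> \<in> K. y \<notin> \<sigma>} \<inter> B"
      using g \<open>g \<noteq> y\<close> sub[OF g, of "{g}"] by (auto simp: B_def insert_commute)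
    then show "{\<sigma> \<in> K. y \<notin> \<sigma>} \<inter> B \<noteq> {}" by blast
    fix \<sigma> assume \<sigma>: "\<sigma> \<in> {\<sigma> \<in> K. y \<notin> \<sigma>} \<inter> B"
    then have "insert g (insert y \<sigma>) \<in> K" using dom[of "insert y \<sigma>"] by (auto simp: B_def)
    moreover from this have "insert g \<sigma> \<in> K" by (rule sub) auto
    ultimately show "insert g \<sigma> \<in> {\<sigma> \<in> K. y \<notin> \<sigma>} \<inter> B"
      using \<sigma> \<open>g \<noteq> y\<close> by (auto simp: B_def insert_commute)
  qed
  ultimately have "contractible_complex ({\<sigma> \<in> K. y \<notin> \<sigma>} \<union> B)"
    using del contractible_union by blast
  moreover have "{\<sigma> \<in> K. y \<notin> \<sigma>} \<union> B = K" by (auto simp: B_def insert_absorb)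
  ultimately show ?thesis by simp
qed

text \<open>Any map carried by \<open>\<Psi>\<close> is a homotopy inverse: on \<open>M\<close> the
  identity is also carried by \<open>\<Psi>\<close>, and on \<open>K\<close> both maps are carried
  by \<open>\<Theta>\<close>.\<close>

theorem inclusion_homotopy_equivalence:
  assumes K: "abstract_complex K" and M: "abstract_complex M" and MK: "M \<subseteq> K"
    and \<Psi>: "\<And>\<sigma>. \<sigma> \<in> K \<Longrightarrow> contractible_complex (\<Psi> \<sigma>)" "\<And>\<sigma>. \<sigma> \<in> K \<Longrightarrow> \<Psi> \<sigma> \<subseteq> M"
      "\<And>\<sigma> \<tau>. \<sigma> \<in> K \<Longrightarrow> \<tau> \<in> K \<Longrightarrow> \<tau> \<subseteq> \<sigma> \<Longrightarrow> \<Psi> \<tau> \<subseteq> \<Psi> \<sigma>"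
      "\<And>\<sigma>. \<sigma> \<in> M \<Longrightarrow> \<sigma> \<in> \<Psi> \<sigma>"
    and \<Theta>: "\<And>\<sigma>. \<sigma> \<in> K \<Longrightarrow> contractible_complex (\<Theta> \<sigma>)" "\<And>\<sigma>. \<sigma> \<in> K \<Longrightarrow> \<Theta> \<sigma> \<subseteq> K"
      "\<And>\<sigma> \<tau>. \<sigma> \<in> K \<Longrightarrow> \<tau> \<in> K \<Longrightarrow> \<tau> \<subseteq> \<sigma> \<Longrightarrow> \<Theta> \<tau> \<subseteq> \<Theta> \<sigma>"
      "\<And>\<sigma>. \<sigma> \<in> K \<Longrightarrow> \<sigma> \<in> \<Theta> \<sigma>"
    and \<Psi>\<Theta>: "\<And>\<sigma>. \<sigma> \<in> K \<Longrightarrow> \<Psi> \<sigma> \<subseteq> \<Theta> \<sigma>"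
  shows "homotopy_equivalence_map (realization M) (realization K) id"
proof -
  have c: "abstract_complex (\<Psi> \<sigma>)" "abstract_complex (\<Theta> \<sigma>)" if "\<sigma> \<in> K" for \<sigma>
    using \<Psi>(1)[OF that] \<Theta>(1)[OF that] by (auto simp: contractible_complex_def)
  obtain g where g: "carried K \<Psi> g"
    using carried_map_exists[of K \<Psi>] K \<Psi> by blast
  have gM: "continuous_map (realization K) (realization M) g"
    using carried_imp_continuous_map[OF K M g] \<Psi>(2) c by blast
  have "homotopic_with (\<lambda>x. True) (realization M) (realization M) g (\<lambda>x. x)"
  proof (rule carried_maps_homotopic[OF M M, of \<Psi>])
    show "carried M \<Psi> g" using carried_mono[OF g MK] c MK by blast
    show "carried M \<Psi> (\<lambda>x. x)" using c MK \<Psi>(4) by (intro carried_id) auto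
    show "\<Psi> \<tau> \<subseteq> \<Psi> \<sigma>" if "\<sigma> \<in> M" "\<tau> \<in> M" "\<tau> \<subseteq> \<sigma>" for \<sigma> \<tau>
      using that MK by (intro \<Psi>(3)) auto
  qed (use MK \<Psi>(1,2) in blast)+
  moreover have "homotopic_with (\<lambda>x. True) (realization K) (realization K) g (\<lambda>x. x)"
  proof (rule carried_maps_homotopic[OF K K, of \<Theta>])
    show "carried K \<Theta> g" using carried_mono[OF g subset_refl] c \<Psi>\<Theta> by blast
    show "carried K \<Theta> (\<lambda>x. x)" using c \<Theta>(4) by (intro carried_id) auto
  qed (use \<Theta>(1,2,3) in blast)+
  moreover have "continuous_map (realization M) (realization K) id"
    using continuous_map_realization_mono[OF M K MK] by (simp add: id_def)
  ultimately show ?thesis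
    unfolding homotopy_equivalence_map_def using gM by (auto simp: id_def o_def)
qed

section \<open>Gap complexes on the circle\<close>

text \<open>A finite set lies in a closed arc of length \<open>1 - d\<close> iff it misses an open arc \<open>(a, a + d)\<close>. The
  length of the missed arc is allowed to depend on \<open>a\<close>, which need not belong to the set.\<close>

definition gap_complex :: "(real \<Rightarrow> real) \<Rightarrow> real set \<Rightarrow> real set set" where
  "gap_complex e X = {\<sigma>. \<sigma> \<subseteq> X \<and> finite \<sigma> \<and> \<sigma> \<noteq> {} \<and>
     (\<exists>a\<in>circle. \<forall>x\<in>\<sigma>. frac (x - a) = 0 \<or> e a \<le> frac (x - a))}"

section \<open>Fractional parts: \<open>frac (x - a)\<close> is the position of \<open>x\<close>
  measured upwards from \<open>a\<close>\<close>

declare frac_eq_0_iff [simp del] frac_gt_0_iff [simp del]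

lemma frac_add_of_int: "frac (x + of_int k) = frac x"
  by (simp add: frac_def)

lemma frac_diff:
  fixes u v :: real
  shows "frac (u - v) = (if frac v \<le> frac u then frac u - frac v else frac u - frac v + 1)"
proof -
  have 1: "u - v - (frac u - frac v) \<in> \<int>" by (simp add: frac_def)
  then have "u - v - (frac u - frac v) - 1 \<in> \<int>" by (intro Ints_diff[OF _ Ints_1])
  then have 2: "u - v - (frac u - frac v + 1) \<in> \<int>" by (simp add: algebra_simps)
  have "frac (u - v) = frac u - frac v" if "frac v \<le> frac u"
    unfolding frac_unique_iff
    by (intro conjI 1) (use that frac_ge_0[of v] frac_lt_1[of u] in linarith)+
  moreover have "frac (u - v) = frac u - frac v + 1" if "\<not> frac v \<le> frac u"
    unfolding frac_unique_iff
    by (intro conjI 2) (use that frac_ge_0[of u] frac_lt_1[of v] in linarith)+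
  ultimately show ?thesis by simp
qed

text \<open>Change of origin: positions relative to \<open>v\<close> are computed from positions
  relative to an auxiliary point \<open>a\<close>. Nearly all arguments about order on the circle go
  through this rule.\<close>

lemma frac_diff_swap:
  fixes u v a :: real
  shows "frac (u - v) = (if frac (v - a) \<le> frac (u - a) then frac (u - a) - frac (v - a)
           else frac (u - a) - frac (v - a) + 1)"
  using frac_diff[of "u - a" "v - a"] by simp

lemma frac_in_circle: "frac x \<in> circle"
  by (simp add: circle_def frac_lt_1)

lemma frac_circle: "x \<in> circle \<Longrightarrow> frac x = x"
  by (simp add: circle_def frac_eq)

lemma frac_diff_eq_0:
  assumes "x \<in> circle" "y \<in> circle" "frac (x - y) = 0"
  shows "x = y"
proof -
  have "frac x = x" "frac y = y" using assms frac_circle by auto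
  then show ?thesis
    using assms(3) frac_diff[of x y] frac_lt_1[of y] frac_ge_0[of x] by (cases "y \<le> x") auto
qed

lemma frac_diff_frac: "frac (frac x - a) = frac (x - a)"
proof -
  have "frac x - a = (x - a) + of_int (- \<lfloor>x\<rfloor>)" by (simp add: frac_def)
  then show ?thesis by (metis frac_add_of_int)
qed

lemma frac_diff_frac2: "frac (a - frac x) = frac (a - x)"
proof -
  have "a - frac x = (a - x) + of_int \<lfloor>x\<rfloor>" by (simp add: frac_def)
  then show ?thesis by (metis frac_add_of_int)
qed

lemma abstract_complex_gap: "abstract_complex (gap_complex e X)"
proof (rule abstract_complexI)
  fix \<sigma> \<tau> assume "\<sigma> \<in> gap_complex e X" "\<tau> \<subseteq> \<sigma>" "\<tau> \<noteq> {}"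
  then show "\<tau> \<in> gap_complex e X"
    unfolding gap_complex_def mem_Collect_eq by (meson finite_subset subset_iff)
qed (auto simp: gap_complex_def)

lemma gap_complexI:
  assumes "\<sigma> \<subseteq> X" "finite \<sigma>" "\<sigma> \<noteq> {}" "a \<in> circle" "\<And>x. x \<in> \<sigma> \<Longrightarrow> frac (x - a) = 0 \<or> e a \<le> frac (x - a)"
  shows "\<sigma> \<in> gap_complex e X"
  using assms unfolding gap_complex_def by blast

lemma gap_complex_delete: "{\<sigma> \<in> gap_complex e X. y \<notin> \<sigma>} = gap_complex e (X - {y})"
  by (auto simp: gap_complex_def)

lemma gap_complex_mono: "X \<subseteq> Y \<Longrightarrow> gap_complex e X \<subseteq> gap_complex e Y"
  by (auto simp: gap_complex_def)

lemma gap_complex_full: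
  assumes "X \<in> gap_complex e Y"
  shows "gap_complex e X = all_faces X"
proof
  show "gap_complex e X \<subseteq> all_faces X" by (auto simp: gap_complex_def all_faces_def)
  show "all_faces X \<subseteq> gap_complex e X"
    using abstract_complexD(3)[OF abstract_complex_gap assms] by (auto simp: gap_complex_def all_faces_def)
qed

text \<open>The closed ball of radius \<open>r\<close> about \<open>y\<close> is the complement of
  the open arc of length \<open>1 - 2 * r\<close> that starts at \<open>y + r\<close>, so a common
  point \<open>y\<close> of the balls corresponds to the left end \<open>y + r\<close> of a
  gap.\<close>

lemma cech_le_eq_gap_complex:
  assumes r: "0 < r" "r < 1/2"
  shows "cech_le circle r = gap_complex (\<lambda>_. 1 - 2 * r) circle"
proof -
  have key: "circ_dist x y \<le> r \<longleftrightarrow> frac (x - (y + r)) = 0 \<or> 1 - 2 * r \<le> frac (x - (y + r))"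
    if "x \<in> circle" "y \<in> circle" for x y
  proof -
    have f: "frac (x - y) = (if y \<le> x then x - y else x - y + 1)"
      using frac_diff[of x y] frac_circle that by simp
    have fr: "frac r = r" using r by (simp add: frac_eq)
    have "frac (x - (y + r)) = frac ((x - y) - r)" by (simp add: algebra_simps)
    then have "frac (x - (y + r)) = (if r \<le> frac (x - y) then frac (x - y) - r else frac (x - y) - r + 1)"
      using frac_diff[of "x - y" r] fr by simp
    then show ?thesis
      using that r unfolding f circ_dist_def circle_def by (auto simp: min_def abs_if split: if_splits)
  qed
  show ?thesis
  proof (intro subset_antisym subsetI)
    fix \<sigma> assume "\<sigma> \<in> cech_le circle r"
    then obtain y where \<sigma>: "\<sigma> \<subseteq> circle" "finite \<sigma>" "\<sigma> \<noteq> {}" and y: "\<And>x. x \<in> \<sigma> \<Longrightarrow> y \<in> circ_cball x r"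
      by (auto simp: cech_le_def)
    then have yc: "y \<in> circle" by (auto simp: circ_cball_def)
    show "\<sigma> \<in> gap_complex (\<lambda>_. 1 - 2 * r) circle"
    proof (rule gap_complexI[of _ _ "frac (y + r)"])
      fix x assume x: "x \<in> \<sigma>"
      then have "x \<in> circle" "circ_dist x y \<le> r" using \<sigma> y[OF x] by (auto simp: circ_cball_def)
      then show "frac (x - frac (y + r)) = 0 \<or> 1 - 2 * r \<le> frac (x - frac (y + r))"
        using key yc unfolding frac_diff_frac2 by blast
    qed (use \<sigma> in \<open>simp_all add: frac_in_circle\<close>)
  next
    fix \<sigma> assume "\<sigma> \<in> gap_complex (\<lambda>_. 1 - 2 * r) circle"
    then obtain a where \<sigma>: "\<sigma> \<subseteq> circle" "finite \<sigma>" "\<sigma> \<noteq> {}"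
      and a: "\<And>x. x \<in> \<sigma> \<Longrightarrow> frac (x - a) = 0 \<or> 1 - 2 * r \<le> frac (x - a)"
      unfolding gap_complex_def by blast
    have "frac (x - (frac (a - r) + r)) = frac (x - a)" for x
    proof -
      have "x - (frac (a - r) + r) = (x - a) + of_int \<lfloor>a - r\<rfloor>" by (simp add: frac_def)
      then show ?thesis by (metis frac_add_of_int)
    qed
    then have "frac (a - r) \<in> circ_cball x r" if "x \<in> \<sigma>" for x
      using a[OF that] key[of x "frac (a - r)"] \<sigma> that by (auto simp: circ_cball_def frac_in_circle)
    then show "\<sigma> \<in> cech_le circle r"
      using \<sigma> by (auto simp: cech_le_def)
  qed
qed

text \<open>Slide the left end back to the nearest point of \<open>\<sigma>\<close> at or before it:
  no point is passed, so the missed arc only grows. The length must be constant, since it is kept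
  while the left end moves.\<close>

lemma gap_leader:
  assumes "\<sigma> \<in> gap_complex (\<lambda>_. d) X" "0 < d"
  obtains a where "a \<in> \<sigma>" "\<And>x. x \<in> \<sigma> \<Longrightarrow> frac (x - a) = 0 \<or> d \<le> frac (x - a)"
proof -
  obtain a where \<sigma>: "finite \<sigma>" "\<sigma> \<noteq> {}" and a: "\<And>x. x \<in> \<sigma> \<Longrightarrow> frac (x - a) = 0 \<or> d \<le> frac (x - a)"
    using assms(1) unfolding gap_complex_def by blast
  have "Min ((\<lambda>x. frac (a - x)) ` \<sigma>) \<in> (\<lambda>x. frac (a - x)) ` \<sigma>" using \<sigma> by simp
  then obtain b where b: "b \<in> \<sigma>" "Min ((\<lambda>x. frac (a - x)) ` \<sigma>) = frac (a - b)" by auto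
  have min: "frac (a - b) \<le> frac (a - x)" if "x \<in> \<sigma>" for x
    using that \<sigma> b(2)[symmetric] by simp
  show ?thesis
  proof (rule that[OF b(1)])
    fix x assume x: "x \<in> \<sigma>"
    have 1: "frac (a - x) = (if frac (x - a) = 0 then 0 else 1 - frac (x - a))"
      using frac_diff_swap[of a x a] frac_ge_0[of "x - a"] by (auto simp: not_le)
    have "frac (x - b) = frac ((a - b) + (x - a))" by simp
    then have "frac (x - b) = (if frac (a - b) + frac (x - a) < 1 then frac (a - b) + frac (x - a) else frac (a - b) + frac (x - a) - 1)"
      by (simp only: frac_add)
    note eq = this
    from a[OF x] show "frac (x - b) = 0 \<or> d \<le> frac (x - b)"
    proof
      assume f0: "frac (x - a) = 0"
      then have "frac (a - x) = 0" using 1 by simp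
      then have "frac (a - b) = 0"
        using min[OF x] frac_ge_0[of "a - b"] by linarith
      then show ?thesis using eq f0 by simp
    next
      assume f: "d \<le> frac (x - a)"
      then have "frac (a - b) \<le> 1 - frac (x - a)"
        using min[OF x] 1 assms(2) by simp
      then consider "frac (a - b) + frac (x - a) < 1" | "frac (a - b) + frac (x - a) = 1" by linarith
      then show ?thesis
      proof cases
        case 1
        then have "frac (x - b) = frac (a - b) + frac (x - a)" using eq by simp
        then show ?thesis using f frac_ge_0[of "a - b"] by linarith
      qed (use eq in simp)
    qed
  qed
qed

text \<open>If \<open>t\<close> falls into the gap at \<open>a\<close> while \<open>y\<close> does
  not, then \<open>a\<close> lies in the arc from \<open>y\<close> to \<open>t\<close>, and the gap
  can be restarted at \<open>t\<close>. A point spoiling the new gap would lie at least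
  \<open>\<delta>\<close> after \<open>y\<close> but less than \<open>\<delta>'\<close> after
  \<open>t\<close>, which \<open>clear\<close> forbids.\<close>

lemma insert_gap_face_up:
  assumes e: "\<And>a. a \<in> circle \<Longrightarrow> \<delta> \<le> e a \<and> e a \<le> \<delta>'"
    and \<rho>: "\<rho> \<in> gap_complex e X" and y: "y \<in> \<rho>" and t: "t \<in> X" "t \<in> circle"
    and \<eta>: "0 < frac (t - y)" "frac (t - y) < \<delta>" "frac (t - y) \<le> 1 - \<delta>'"
    and clear: "\<And>x. x \<in> \<rho> \<Longrightarrow> \<not> (\<delta> \<le> frac (x - y) \<and> frac (x - y) < frac (t - y) + \<delta>')"
  shows "insert t \<rho> \<in> gap_complex e X"
proof -
  obtain a where \<rho>': "\<rho> \<subseteq> X" "finite \<rho>" and ac: "a \<in> circle"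
    and a: "\<And>x. x \<in> \<rho> \<Longrightarrow> frac (x - a) = 0 \<or> e a \<le> frac (x - a)"
    using \<rho> unfolding gap_complex_def by blast
  define s where "s = frac (t - a)"
  show ?thesis
  proof (cases "s = 0 \<or> e a \<le> s")
    case True
    then show ?thesis
      using \<rho>' t a ac by (intro gap_complexI[of _ _ a]) (auto simp: s_def)
  next
    case False
    then have s: "0 < s" "s < e a" by (auto simp: s_def less_le)
    have "frac (t - y) = (if frac (y - a) \<le> s then s - frac (y - a) else s - frac (y - a) + 1)"
      unfolding s_def by (rule frac_diff_swap)
    then have s\<eta>: "s \<le> frac (t - y)"
      using a[OF y] s frac_lt_1[of "y - a"] by (auto split: if_splits)
    show ?thesis
    proof (rule gap_complexI[of _ _ t])
      fix x assume "x \<in> insert t \<rho>"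
      then consider "x = t" | "x \<in> \<rho>" by blast
      then show "frac (x - t) = 0 \<or> e t \<le> frac (x - t)"
      proof cases
        case 2
        have xt: "frac (x - t) = (if s \<le> frac (x - a) then frac (x - a) - s else frac (x - a) - s + 1)"
          unfolding s_def by (rule frac_diff_swap)
        from a[OF 2] show ?thesis
        proof
          \<comment> \<open>Such an \<open>x\<close> sits at the old left end, at position
            \<open>1 - s\<close> after \<open>t\<close>; the bound
            \<open>frac (t - y) \<le> 1 - \<delta>'\<close> keeps it out of the new gap.\<close>
          assume "frac (x - a) = 0"
          then show ?thesis using xt s s\<eta> \<eta> e[OF t(2)] by auto
        next
          assume g: "e a \<le> frac (x - a)"
          then have xt': "frac (x - t) = frac (x - a) - s" using xt s by simp
          show ?thesis
          proof (rule ccontr)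
            assume "\<not> ?thesis"
            then have lt: "frac (x - t) < \<delta>'" using e[OF t(2)] by auto
            have "frac (x - y) = frac ((x - t) + (t - y))" by simp
            also have "\<dots> = frac (x - t) + frac (t - y)"
              using lt \<eta> by (simp only: frac_add) auto
            finally have "frac (x - y) = frac (x - t) + frac (t - y)" .
            then show False
              using clear[OF 2] lt xt' s\<eta> g e[OF ac] by auto
          qed
        qed
      qed simp
    qed (use \<rho>' t in auto)
  qed
qed

text \<open>A gap blocks \<open>g\<close> only if it contains \<open>g\<close> but not
  \<open>y\<close>; its left end then precedes \<open>g\<close> by less than \<open>d\<close> but by
  at least \<open>d - frac (y - g)\<close>. With a left end chosen in the face itself,
  \<open>clear\<close> has to speak of points of \<open>X\<close> only.\<close>

lemma insert_gap_face_down: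
  assumes d: "0 < d" "d < 1"
    and \<rho>: "\<rho> \<in> gap_complex (\<lambda>_. d) X" and X: "X \<subseteq> circle" and y: "y \<in> \<rho>" and g: "g \<in> X"
    and \<eta>: "0 < frac (y - g)"
    and clear: "\<And>a. a \<in> X \<Longrightarrow> \<not> (d - frac (y - g) \<le> frac (g - a) \<and> frac (g - a) < d)"
  shows "insert g \<rho> \<in> gap_complex (\<lambda>_. d) X"
proof -
  obtain a where a: "a \<in> \<rho>" "\<And>x. x \<in> \<rho> \<Longrightarrow> frac (x - a) = 0 \<or> d \<le> frac (x - a)"
    using gap_leader[OF \<rho> d(1)] by blast
  have \<rho>': "\<rho> \<subseteq> X" "finite \<rho>" using \<rho> by (auto simp: gap_complex_def)
  have "frac (g - a) = 0 \<or> d \<le> frac (g - a)"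
  proof (rule ccontr)
    assume "\<not> ?thesis"
    then have s: "0 < frac (g - a)" "frac (g - a) < d" by (auto simp: less_le)
    then have lt: "frac (y - g) + frac (g - a) < d" using clear[of a] a(1) \<rho>' by force
    have "frac (y - a) = frac ((y - g) + (g - a))" by simp
    also have "\<dots> = frac (y - g) + frac (g - a)"
      using lt d by (simp only: frac_add) auto
    finally show False using a(2)[OF y] lt \<eta> s by auto
  qed
  then show ?thesis
    using \<rho>' g a X by (intro gap_complexI[of _ _ a]) auto
qed

section \<open>Rounding down to a regular polygon\<close>

definition grid_floor :: "nat \<Rightarrow> real \<Rightarrow> real" where
  "grid_floor q x = of_int \<lfloor>real q * x\<rfloor> / real q"

lemma grid_floor_offset:
  assumes "q > 0"
  shows "x - grid_floor q x = frac (real q * x) / real q"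
  using assms by (simp add: grid_floor_def frac_def field_simps)

lemma grid_floor_circle:
  assumes "q > 0" "x \<in> circle"
  shows "grid_floor q x \<in> circle"
proof -
  have "0 \<le> \<lfloor>real q * x\<rfloor>" using assms by (simp add: circle_def)
  moreover have "real q * x < real q" using assms by (simp add: circle_def)
  then have "of_int \<lfloor>real q * x\<rfloor> < real q" by linarith
  ultimately show ?thesis using assms by (simp add: grid_floor_def circle_def)
qed

text \<open>A point with least offset from the grid that cannot be pushed down is blocked by the point at
  distance exactly \<open>d\<close> before it, which has the same offset; so blocked points fill a whole orbit.\<close>

lemma contractible_grid_rounding:
  fixes p q :: nat and X :: "real set"
  defines "d \<equiv> real p / real q"
  assumes p: "0 < p" "p < q"
    and fin: "finite X" and X: "X \<subseteq> circle" and \<phi>: "grid_floor q ` X \<subseteq> X"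
    and orbit: "\<And>y. y \<in> X \<Longrightarrow> frac (real q * y) \<noteq> 0 \<Longrightarrow> \<exists>k::nat. frac (y - real k * d) \<notin> X"
    and grid: "contractible_complex (gap_complex (\<lambda>_. d) {x \<in> X. frac (real q * x) = 0})"
  shows "contractible_complex (gap_complex (\<lambda>_. d) X)"
  using fin X \<phi> orbit grid
proof (induction "card {x \<in> X. frac (real q * x) \<noteq> 0}" arbitrary: X)
  case 0
  then have "{x \<in> X. frac (real q * x) = 0} = X" by auto
  then show ?case using 0 by simp
next
  case (Suc n)
  have q: "real q > 0" and d: "0 < d" "d < 1" "1 / real q \<le> d"
    using p by (auto simp: d_def field_simps)
  let ?N = "{x \<in> X. frac (real q * x) \<noteq> 0}"
  define o' where "o' x = x - grid_floor q x" for x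
  have o': "o' x = frac (real q * x) / real q" for x
    using grid_floor_offset[of q x] q by (simp add: o'_def)
  have o1: "0 \<le> o' x" "o' x < 1 / real q" for x
    using q frac_lt_1[of "real q * x"] by (auto simp: o' divide_strict_right_mono)
  have oN: "0 < o' x" if "x \<in> ?N" for x
  proof -
    have "frac (real q * x) \<noteq> 0" using that by simp
    then have "0 < frac (real q * x)" using frac_ge_0[of "real q * x"] by linarith
    then show ?thesis using q by (simp add: o')
  qed
  have finN: "finite ?N" using Suc.prems(1) by simp
  have neN: "?N \<noteq> {}"
  proof
    assume "?N = {}"
    then have "card ?N = 0" by (simp only: card.empty)
    then show False using Suc.hyps(2) by linarith
  qed
  have fry: "frac (y - grid_floor q y) = o' y" for y
  proof -
    have "o' y < 1" using o1(2)[of y] d by linarith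
    then show ?thesis using o1(1)[of y] unfolding o'_def by (simp add: frac_eq)
  qed
  \<comment> \<open>Some off-grid point is dominated by its rounding; it is then removed and the
    induction applies.\<close>
  have "\<exists>y\<in>?N. \<forall>a\<in>X. \<not> (d - o' y \<le> frac (grid_floor q y - a) \<and> frac (grid_floor q y - a) < d)"
  proof (rule ccontr)
    assume neg: "\<not> ?thesis"
    \<comment> \<open>\<open>m\<close> is the least offset from the grid. If every off-grid point is
      blocked, the points with offset \<open>m\<close> are closed under going back by
      \<open>d\<close>.\<close>
    define m where "m = Min (o' ` ?N)"
    have "m \<in> o' ` ?N" unfolding m_def using finN neN by (intro Min_in) auto
    then obtain y where y: "y \<in> ?N" "o' y = m" by auto
    have m_le: "m \<le> o' x" if "x \<in> ?N" for x
      unfolding m_def using finN that by (intro Min_le) auto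
    have step: "frac (z - d) \<in> ?N \<and> o' (frac (z - d)) = m" if z: "z \<in> ?N" "o' z = m" for z
    proof -
      obtain a where a: "a \<in> X" "d - m \<le> frac (grid_floor q z - a)" "frac (grid_floor q z - a) < d"
        using neg z by auto
      \<comment> \<open>\<open>d\<close> is a multiple of \<open>1 / q\<close>, so the blocking
        point \<open>a\<close> has offset exactly \<open>u\<close>. As \<open>0 < u \<le> m\<close>
        and \<open>m\<close> is minimal, \<open>u = m\<close>, which places \<open>a\<close> at
        \<open>z - d\<close>.\<close>
      define u where "u = d - frac (grid_floor q z - a)"
      have u: "0 < u" "u \<le> m" using a by (auto simp: u_def)
      have m1: "m < 1 / real q" using o1(2)[of z] z by simp
      define k where "k = \<lfloor>grid_floor q z - a\<rfloor>"
      have aeq: "a = grid_floor q z - d + u - of_int k"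
        by (simp add: u_def k_def frac_def)
      have "real q * a = of_int (\<lfloor>real q * z\<rfloor> - int p - int q * k) + real q * u"
        using q unfolding aeq by (simp add: grid_floor_def d_def field_simps)
      moreover have "frac (real q * u) = real q * u"
      proof -
        have "u < 1 / real q" using u m1 by linarith
        then have "real q * u < 1" using q by (simp add: field_simps)
        then show ?thesis using u q by (simp add: frac_eq)
      qed
      ultimately have fa: "frac (real q * a) = real q * u"
        by (metis frac_add_of_int add.commute)
      then have aN: "a \<in> ?N" and oa: "o' a = u" using a u q by (auto simp: o')
      have um: "u = m" using m_le[OF aN] oa u by simp
      have "z - d = a + of_int k" using aeq um z(2) by (simp add: o'_def)
      then have "frac (z - d) = frac a" by (metis frac_add_of_int)
      then have "frac (z - d) = a" using a(1) Suc.prems(2) frac_circle by auto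
      then show ?thesis using aN oa um by simp
    qed
    \<comment> \<open>The whole backward orbit of \<open>y\<close> would lie in \<open>X\<close>,
      contrary to the orbit hypothesis.\<close>
    have "frac (y - real k * d) \<in> ?N \<and> o' (frac (y - real k * d)) = m" for k :: nat
    proof (induction k)
      case 0
      then show ?case using y Suc.prems(2) frac_circle by auto
    next
      case (Suc k)
      have "frac (frac (y - real k * d) - d) = frac (y - real (Suc k) * d)"
        unfolding frac_diff_frac by (simp add: algebra_simps)
      then show ?case using step[of "frac (y - real k * d)"] Suc by simp
    qed
    then show False using Suc.prems(4)[of y] y by auto
  qed
  then obtain y where y: "y \<in> ?N" and free: "\<And>a. a \<in> X \<Longrightarrow> \<not> (d - o' y \<le> frac (grid_floor q y - a) \<and> frac (grid_floor q y - a) < d)"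
    by blast
  have gne: "frac (real q * grid_floor q x) = 0" for x
    using q by (simp add: grid_floor_def)
  have gy: "grid_floor q y \<in> X" using Suc.prems(3) y by auto
  have N': "{x \<in> X - {y}. frac (real q * x) \<noteq> 0} = ?N - {y}" by auto
  have "contractible_complex (gap_complex (\<lambda>_. d) (X - {y}))"
  proof (rule Suc.hyps(1))
    show "n = card {x \<in> X - {y}. frac (real q * x) \<noteq> 0}"
      unfolding N' using Suc.hyps(2) y finN by simp
    show "grid_floor q ` (X - {y}) \<subseteq> X - {y}"
      using Suc.prems(3) y gne by fastforce
    have "{x \<in> X - {y}. frac (real q * x) = 0} = {x \<in> X. frac (real q * x) = 0}" using y by auto
    then show "contractible_complex (gap_complex (\<lambda>_. d) {x \<in> X - {y}. frac (real q * x) = 0})"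
      using Suc.prems(5) by simp
    show "\<exists>k::nat. frac (z - real k * d) \<notin> X - {y}" if "z \<in> X - {y}" "frac (real q * z) \<noteq> 0" for z
      using Suc.prems(4)[of z] that by blast
  qed (use Suc.prems(1,2) in auto)
  moreover have "insert (grid_floor q y) \<rho> \<in> gap_complex (\<lambda>_. d) X" if "\<rho> \<in> gap_complex (\<lambda>_. d) X" "y \<in> \<rho>" for \<rho>
  proof (rule insert_gap_face_down[OF d(1,2) that(1) Suc.prems(2) that(2) gy])
    show "0 < frac (y - grid_floor q y)" using fry oN[OF y] by simp
    show "\<not> (d - frac (y - grid_floor q y) \<le> frac (grid_floor q y - a) \<and> frac (grid_floor q y - a) < d)" if "a \<in> X" for a
      using free[OF that] fry by simp
  qed
  moreover have "grid_floor q y \<noteq> y" using gne[of y] y by auto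
  ultimately show ?case
    by (intro contractible_remove_dominated[OF abstract_complex_gap, where y = y and g = "grid_floor q y"])
      (simp_all add: gap_complex_delete)
qed

subsection \<open>Varying the gap length\<close>

lemma gap_complex_antimono:
  assumes "\<And>a. a \<in> circle \<Longrightarrow> e a \<le> e' a"
  shows "gap_complex e' X \<subseteq> gap_complex e X"
proof
  fix \<sigma> assume "\<sigma> \<in> gap_complex e' X"
  then obtain a where "\<sigma> \<subseteq> X" "finite \<sigma>" "\<sigma> \<noteq> {}" "a \<in> circle"
    and a: "\<And>x. x \<in> \<sigma> \<Longrightarrow> frac (x - a) = 0 \<or> e' a \<le> frac (x - a)"
    unfolding gap_complex_def by blast
  then show "\<sigma> \<in> gap_complex e X"
    using assms[of a] by (intro gap_complexI[of _ _ a]) (use a order_trans in blast)+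
qed

text \<open>Zone \<open>i\<close> reaches from \<open>i * \<delta>\<close> to
  \<open>w + i * \<delta>'\<close> above \<open>p\<close>: the possible positions after
  \<open>i\<close> steps of length between \<open>\<delta>\<close> and \<open>\<delta>'\<close> from
  a left end in \<open>[p, p + w]\<close>. For \<open>i \<le> m\<close> its length is at most
  \<open>w + m * (\<delta>' - \<delta>)\<close>. By \<open>c3\<close> this is less than
  \<open>\<delta>\<close>, so the zones are disjoint; by \<open>c2\<close> zone \<open>m - 1\<close>
  ends before the circle closes; by \<open>c1\<close> and \<open>c2\<close> zone \<open>m\<close>,
  after one turn, lies strictly between \<open>p + w\<close> and
  \<open>p + \<delta>\<close>.\<close>

context
  fixes m :: nat and \<delta> \<delta>' w p :: real
  assumes m: "2 \<le> m" and \<delta>: "\<delta> \<le> \<delta>'" and w: "0 < w"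
    and c1: "w + real m * (\<delta>' - \<delta>) < real m * \<delta> - 1"
    and c2: "w + real m * (\<delta>' - \<delta>) < 1 - (real m - 1) * \<delta>"
    and c3: "w + real m * (\<delta>' - \<delta>) < \<delta>"
begin

lemma gap_pos: "0 < \<delta>"
proof -
  have "0 \<le> real m * (\<delta>' - \<delta>)" using \<delta> by simp
  then show ?thesis using c3 w by linarith
qed

lemma zone_top_less_1:
  assumes "i < m"
  shows "w + real i * \<delta>' < 1"
proof -
  have "real i * \<delta>' \<le> (real m - 1) * \<delta>'" using assms \<delta> gap_pos by (intro mult_right_mono) auto
  also have "\<dots> = (real m - 1) * \<delta> + real m * (\<delta>' - \<delta>) - (\<delta>' - \<delta>)" by (simp add: algebra_simps)
  finally show ?thesis using c2 \<delta> by linarith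
qed

lemma zone_top_coord:
  assumes "i < m"
  shows "frac (frac (p + w + real i * \<delta>') - p) = w + real i * \<delta>'"
proof -
  have "frac (frac (p + w + real i * \<delta>') - p) = frac (w + real i * \<delta>')"
    unfolding frac_diff_frac by (simp add: algebra_simps)
  moreover have "0 \<le> w + real i * \<delta>'" using w \<delta> gap_pos by simp
  ultimately show ?thesis using zone_top_less_1[OF assms] by (simp add: frac_eq)
qed

text \<open>Zones start \<open>\<delta>\<close> apart and are shorter than that by
  \<open>c3\<close>.\<close>

lemma zone_top_unique:
  assumes "real i * \<delta> \<le> w + real j * \<delta>'" "w + real j * \<delta>' \<le> w + real i * \<delta>'" "i < m" "j < m"
  shows "i = j"
proof (rule ccontr)
  assume "i \<noteq> j"
  then consider "i < j" | "j < i" by linarith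
  then show False
  proof cases
    case 1
    then have "real i * \<delta>' < real j * \<delta>'" using \<delta> gap_pos by (intro mult_strict_right_mono) auto
    then show False using assms by simp
  next
    case 2
    then have "(real j + 1) * \<delta> \<le> real i * \<delta>" using gap_pos by (intro mult_right_mono) auto
    then have "real j * \<delta> + \<delta> \<le> w + real j * \<delta>'"
      using assms by (simp add: algebra_simps)
    moreover have "real j * (\<delta>' - \<delta>) \<le> real m * (\<delta>' - \<delta>)"
      using assms \<delta> by (intro mult_right_mono) auto
    moreover have "real j * \<delta>' = real j * \<delta> + real j * (\<delta>' - \<delta>)" by (simp add: algebra_simps)
    ultimately show False using c3 by linarith
  qed
qed

text \<open>A point \<open>y\<close> of zone \<open>i\<close> can be blocked from moving to the top
  \<open>t i\<close> only by a point of zone \<open>i + 1\<close> strictly below its top. So the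
  zones are collapsed onto their tops beginning with the last one. Behind zone \<open>m - 1\<close>
  a blocking point would lie in the arc between \<open>w\<close> and \<open>\<delta>\<close>, inside
  the original gap, where \<open>A\<close> allows no points.\<close>

lemma contractible_zone_rounding:
  defines "u \<equiv> \<lambda>x. frac (x - p)"
  defines "zone \<equiv> \<lambda>i x. real i * \<delta> \<le> u x \<and> u x \<le> w + real i * \<delta>'"
  defines "t \<equiv> \<lambda>i. frac (p + w + real i * \<delta>')"
  assumes e: "\<And>a. a \<in> circle \<Longrightarrow> \<delta> \<le> e a \<and> e a \<le> \<delta>'"
    and fin: "finite X" "X \<noteq> {}" and X: "X \<subseteq> circle"
    and A: "\<And>x. x \<in> X \<Longrightarrow> u x \<le> w \<or> \<delta> \<le> u x"
    and B: "\<And>x i. x \<in> X \<Longrightarrow> 1 \<le> i \<Longrightarrow> i < m \<Longrightarrow> zone i x \<Longrightarrow> t i \<in> X"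
    and a: "a \<in> circle" "u a < w" "\<And>x. x \<in> X \<Longrightarrow> frac (x - a) = 0 \<or> \<delta> \<le> frac (x - a)"
  shows "contractible_complex (gap_complex e X)"
proof -
  note \<delta>0 = gap_pos and top1 = zone_top_less_1
  have mD: "real i * (\<delta>' - \<delta>) \<le> real m * (\<delta>' - \<delta>)" if "i \<le> m" for i
    using that \<delta> by (intro mult_right_mono) auto
  have mD0: "0 \<le> real i * (\<delta>' - \<delta>)" for i using \<delta> by simp
  have i\<delta>': "real i * \<delta>' = real i * \<delta> + real i * (\<delta>' - \<delta>)" for i by (simp add: algebra_simps)
  have w\<delta>'1: "w + \<delta>' < 1" using top1[of 1] m by simp
  have u0: "0 \<le> u x" "u x < 1" for x by (auto simp: u_def frac_lt_1)
  have ut: "u (t i) = w + real i * \<delta>'" if "i < m" for i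
    unfolding u_def t_def by (rule zone_top_coord[OF that])
  have tc: "t i \<in> circle" for i by (simp add: t_def frac_in_circle)
  have fu: "frac (x - y) = (if u y \<le> u x then u x - u y else u x - u y + 1)" for x y
    unfolding u_def by (rule frac_diff_swap)
  have u_inj: "x = y" if "x \<in> circle" "y \<in> circle" "u x = u y" for x y
    using frac_diff_eq_0[OF that(1,2)] fu[of x y] that(3) by simp
  have zone_top: "i = j" if "zone i (t j)" "i < m" "j < m" for i j
    using that zone_top_unique[of i j] ut[of j] by (simp add: zone_def)
  show ?thesis
    using fin X A B a(3)
  proof (induction "card {x \<in> X. \<exists>i\<in>{1..<m}. zone i x \<and> x \<noteq> t i}" arbitrary: X)
    case 0
    have none: "x = t i" if "x \<in> X" "i \<in> {1..<m}" "zone i x" for x i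
      using 0(1,2) that by (auto simp: card_eq_0_iff)
    \<comment> \<open>With all zones reduced to their tops, \<open>X\<close> spans a simplex: a
      point at distance between \<open>\<delta>\<close> and \<open>\<delta>'\<close> after
      \<open>a\<close> would lie in zone 1 strictly below \<open>t 1\<close>, because
      \<open>u a < w\<close>. So the gap at \<open>a\<close> has length \<open>\<delta>'\<close>,
      enough for every \<open>e\<close>.\<close>
    have "X \<in> gap_complex e X"
    proof (rule gap_complexI[of _ _ a])
      fix x assume x: "x \<in> X"
      from 0(7)[OF x] show "frac (x - a) = 0 \<or> e a \<le> frac (x - a)"
      proof
        assume f: "\<delta> \<le> frac (x - a)"
        have "\<delta>' \<le> frac (x - a)"
        proof (rule ccontr)
          assume lt: "\<not> ?thesis"
          show False
          proof (cases "u a \<le> u x")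
            case True
            then have ux: "frac (x - a) = u x - u a" using fu[of x a] by simp
            then have "zone 1 x" using f lt a(2) u0(1)[of a] by (simp add: zone_def)
            then have "x = t 1" using none[OF x, of 1] m by simp
            then show False using ut[of 1] m lt ux a(2) by simp
          next
            case False
            then have "frac (x - a) = u x - u a + 1" using fu[of x a] by simp
            then show False using lt a(2) u0(1)[of x] w\<delta>'1 by linarith
          qed
        qed
        then show ?thesis using e[OF a(1)] by linarith
      qed simp
    qed (use 0 a in auto)
    then show ?case
      using contractible_all_faces[of X] 0 gap_complex_full[of X e X] by simp
  next
    case (Suc n)
    note A = Suc.prems(4) and B = Suc.prems(5) and C = Suc.prems(6)
    define J where "J = {i \<in> {1..<m}. \<exists>x\<in>X. zone i x \<and> x \<noteq> t i}"
    let ?N = "{x \<in> X. \<exists>i\<in>{1..<m}. zone i x \<and> x \<noteq> t i}"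
    have "?N \<noteq> {}"
    proof
      assume "?N = {}"
      then have "card ?N = 0" by (simp only: card.empty)
      then show False using Suc.hyps(2) by linarith
    qed
    then have "J \<noteq> {}" "finite J" by (auto simp: J_def)
    then have iJ: "Max J \<in> J" and imax: "\<And>j. j \<in> J \<Longrightarrow> j \<le> Max J" by auto
    \<comment> \<open>The last zone with a point below its top: in zone \<open>i + 1\<close> only
      the top can be occupied, and that is just out of reach.\<close>
    define i where "i = Max J"
    have i: "1 \<le> i" "i < m" using iJ by (auto simp: i_def J_def)
    obtain y where y: "y \<in> X" "zone i y" "y \<noteq> t i" using iJ by (auto simp: i_def J_def)
    have yc: "y \<in> circle" using y Suc.prems by auto
    have tX: "t i \<in> X" using B[OF y(1) i y(2)] .
    have "u y \<le> u (t i)" using y(2) ut[OF i(2)] by (simp add: zone_def)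
    moreover have "u y \<noteq> u (t i)" using u_inj[OF yc tc, of i] y(3) by blast
    ultimately have uyt: "u y < u (t i)" by linarith
    then have \<eta>: "frac (t i - y) = w + real i * \<delta>' - u y" using fu[of "t i" y] ut[OF i(2)] by simp
    have \<eta>_le: "frac (t i - y) \<le> w + real i * (\<delta>' - \<delta>)"
      using \<eta> y(2) i\<delta>'[of i] by (simp add: zone_def)
    have "contractible_complex (gap_complex e (X - {y}))"
    proof (rule Suc.hyps(1))
      have "{x \<in> X - {y}. \<exists>i\<in>{1..<m}. zone i x \<and> x \<noteq> t i} = ?N - {y}" by auto
      moreover have "y \<in> ?N" using y i by auto
      ultimately have "card {x \<in> X - {y}. \<exists>i\<in>{1..<m}. zone i x \<and> x \<noteq> t i} = card ?N - 1"
        by (simp only: card_Diff_singleton)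
      then show "n = card {x \<in> X - {y}. \<exists>i\<in>{1..<m}. zone i x \<and> x \<noteq> t i}"
        using Suc.hyps(2) by linarith
      show "X - {y} \<noteq> {}" using tX y(3) by auto
      show "t j \<in> X - {y}" if "x \<in> X - {y}" "1 \<le> j" "j < m" "zone j x" for x j
      proof -
        have "t j \<noteq> y" using zone_top[of i j] y i that by metis
        then show ?thesis using B[of x j] that by blast
      qed
      show "u x \<le> w \<or> \<delta> \<le> u x" if "x \<in> X - {y}" for x using A[of x] that by blast
      show "frac (x - a) = 0 \<or> \<delta> \<le> frac (x - a)" if "x \<in> X - {y}" for x using C[of x] that by blast
    qed (use Suc.prems(1,3) in auto)
    moreover have "insert (t i) \<rho> \<in> gap_complex e X" if \<rho>: "\<rho> \<in> gap_complex e X" "y \<in> \<rho>" for \<rho>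
    proof (rule insert_gap_face_up[OF e \<rho> tX tc])
      show "0 < frac (t i - y)" using \<eta> uyt ut[OF i(2)] by simp
      show "frac (t i - y) < \<delta>" using \<eta>_le mD[of i] i c3 by linarith
      have "\<delta> \<le> (real m - 1) * \<delta>" using m \<delta>0 by simp
      moreover have "real i * (\<delta>' - \<delta>) \<le> (real m - 1) * (\<delta>' - \<delta>)"
        using i \<delta> by (intro mult_right_mono) auto
      moreover have "(real m - 1) * (\<delta>' - \<delta>) = real m * (\<delta>' - \<delta>) - (\<delta>' - \<delta>)" by (simp add: algebra_simps)
      ultimately show "frac (t i - y) \<le> 1 - \<delta>'" using \<eta>_le c2 by linarith
      fix x assume "x \<in> \<rho>"
      then have x: "x \<in> X" using \<rho> by (auto simp: gap_complex_def)
      show "\<not> (\<delta> \<le> frac (x - y) \<and> frac (x - y) < frac (t i - y) + \<delta>')"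
      proof
        assume f: "\<delta> \<le> frac (x - y) \<and> frac (x - y) < frac (t i - y) + \<delta>'"
        have S: "real (Suc i) * \<delta> = real i * \<delta> + \<delta>" "real (Suc i) * \<delta>' = real i * \<delta>' + \<delta>'"
          by (simp_all add: algebra_simps)
        have iy: "real i * \<delta> \<le> u y" using y(2) by (simp add: zone_def)
        show False
        proof (cases "u y \<le> u x")
          case True
          then have fx: "frac (x - y) = u x - u y" using fu[of x y] by simp
          have lo: "real (Suc i) * \<delta> \<le> u x" using f fx iy S by linarith
          have hi: "u x < w + real (Suc i) * \<delta>'" using f fx \<eta> S by linarith
          show False
          proof (cases "Suc i < m")
            case True
            then have "x \<noteq> t (Suc i)" using ut[of "Suc i"] hi by auto
            then have "Suc i \<in> J" using lo hi x True by (auto simp: J_def zone_def)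
            then show False using imax[of "Suc i"] by (simp add: i_def)
          next
            case False
            then have "Suc i = m" using i by simp
            then show False using lo u0(2)[of x] c1 mD0[of m] w by auto
          qed
        next
          case False
          then have fx: "frac (x - y) = u x - u y + 1" using fu[of x y] by simp
          have lo: "real (Suc i) * \<delta> \<le> u x + 1" using f fx iy S by linarith
          have hi: "u x + 1 < w + real (Suc i) * \<delta>'" using f fx \<eta> S by linarith
          show False
          proof (cases "Suc i < m")
            case True
            then show False using hi top1[of "Suc i"] u0(1)[of x] by linarith
          next
            case False
            then have im: "Suc i = m" using i by simp
            \<comment> \<open>Zone \<open>m\<close> has wrapped around the circle and falls strictly
              between \<open>w\<close> and \<open>\<delta>\<close>.\<close>
            have lo': "real m * \<delta> \<le> u x + 1" and hi': "u x + 1 < w + real m * \<delta>'"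
              using lo hi unfolding im by blast+
            have "u x < \<delta>" using hi' c2 by (simp add: algebra_simps)
            moreover have "w < u x" using lo' c1 mD0[of m] by linarith
            ultimately show False using A[OF x] by linarith
          qed
        qed
      qed
    qed
    ultimately show ?case
      using y(3) by (intro contractible_remove_dominated[OF abstract_complex_gap, where y = y and g = "t i"])
        (simp_all add: gap_complex_delete)
  qed
qed

text \<open>The gap length is raised only at left ends in one arc of length \<open>w\<close>. A face
  lost by this has a left end in that arc with missed length at least \<open>\<delta>\<close>, which
  is the situation of the zone lemma.\<close>

lemma gap_stage:
  defines "e \<equiv> \<lambda>S a. if a \<in> S then \<delta>' else \<delta>"
  assumes I: "I = {a \<in> circle. frac (a - p) < w}"
  shows "homotopy_equivalence_map (realization (gap_complex (e (S \<union> I)) circle))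
           (realization (gap_complex (e S) circle)) id"
proof -
  define K where "K = gap_complex (e S) circle"
  define M where "M = gap_complex (e (S \<union> I)) circle"
  define zone where "zone = (\<lambda>i x. real i * \<delta> \<le> frac (x - p) \<and> frac (x - p) \<le> w + real i * \<delta>')"
  define t where "t = (\<lambda>i. frac (p + w + real i * \<delta>'))"
  \<comment> \<open>Exactly the tops that hypothesis \<open>B\<close> of the zone lemma asks for;
    which tops are added depends monotonically on \<open>\<sigma>\<close>.\<close>
  define X where "X \<sigma> = \<sigma> \<union> t ` {i \<in> {1..<m}. \<exists>y\<in>\<sigma>. zone i y}" for \<sigma>
  have K: "abstract_complex K" and M: "abstract_complex M"
    by (simp_all add: K_def M_def abstract_complex_gap)
  have anti: "gap_complex (e (S \<union> I)) Y \<subseteq> gap_complex (e S) Y" for Y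
    using \<delta> by (intro gap_complex_antimono) (auto simp: e_def)
  have MK: "M \<subseteq> K" unfolding M_def K_def by (rule anti)
  note \<delta>0 = gap_pos
  have ut: "frac (t i - p) = w + real i * \<delta>'" if "i < m" for i
    unfolding t_def by (rule zone_top_coord[OF that])
  have mono_X: "X \<tau> \<subseteq> X \<sigma>" if "\<tau> \<subseteq> \<sigma>" for \<tau> \<sigma> using that by (auto simp: X_def)
  have X_circle: "X \<sigma> \<subseteq> circle" if "\<sigma> \<subseteq> circle" for \<sigma>
    using that by (auto simp: X_def t_def frac_in_circle)
  have \<sigma>X: "\<sigma> \<subseteq> X \<sigma>" for \<sigma> by (simp add: X_def)
  \<comment> \<open>The lengths \<open>e'\<close> stay arbitrary between the bounds, so that one
    proof serves the new lengths in \<open>\<Psi>\<close> and the old ones in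
    \<open>\<Theta>\<close>.\<close>
  have contr: "contractible_complex (gap_complex e' (X \<sigma>))"
    if \<sigma>: "\<sigma> \<in> K" "\<sigma> \<notin> M" and e': "\<And>a. a \<in> circle \<Longrightarrow> \<delta> \<le> e' a \<and> e' a \<le> \<delta>'" for \<sigma> e'
  proof -
    obtain a where \<sigma>': "\<sigma> \<subseteq> circle" "finite \<sigma>" "\<sigma> \<noteq> {}" and ac: "a \<in> circle"
      and a: "\<And>x. x \<in> \<sigma> \<Longrightarrow> frac (x - a) = 0 \<or> e S a \<le> frac (x - a)"
      using \<sigma>(1) unfolding K_def gap_complex_def by blast
    \<comment> \<open>An unchanged length at \<open>a\<close> would leave \<open>\<sigma>\<close> a
      face; so \<open>a\<close> is in \<open>I\<close>, and its old length is
      \<open>\<delta>\<close>.\<close>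
    have "e (S \<union> I) a \<noteq> e S a"
    proof
      assume "e (S \<union> I) a = e S a"
      then have "\<sigma> \<in> M" unfolding M_def using \<sigma>' ac a by (intro gap_complexI[of _ _ a]) auto
      then show False using \<sigma> by blast
    qed
    then have aw: "frac (a - p) < w" and eS: "e S a = \<delta>" by (auto simp: e_def I split: if_splits)
    have fu: "frac (x - y) = (if frac (y - p) \<le> frac (x - p) then frac (x - p) - frac (y - p) else frac (x - p) - frac (y - p) + 1)" for x y
      by (rule frac_diff_swap)
    have at: "frac (t i - p) = w + real i * \<delta>'" "\<delta> \<le> frac (t i - p)" "\<delta> \<le> frac (t i - a)" if "1 \<le> i" "i < m" for i
    proof -
      show 1: "frac (t i - p) = w + real i * \<delta>'" by (rule ut[OF that(2)])
      have "1 * \<delta>' \<le> real i * \<delta>'" using that \<delta> \<delta>0 by (intro mult_right_mono) auto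
      then have 2: "w + \<delta> \<le> frac (t i - p)" using 1 \<delta> by linarith
      then show "\<delta> \<le> frac (t i - p)" using w by linarith
      have "frac (a - p) \<le> frac (t i - p)" using 2 aw \<delta>0 by linarith
      then have "frac (t i - a) = frac (t i - p) - frac (a - p)" using fu[of "t i" a] by simp
      then show "\<delta> \<le> frac (t i - a)" using 2 aw by linarith
    qed
    show ?thesis
    proof (rule contractible_zone_rounding[OF e', where a = a])
      show "finite (X \<sigma>)" "X \<sigma> \<noteq> {}" "X \<sigma> \<subseteq> circle"
        using \<sigma>' X_circle by (auto simp: X_def)
      show "frac (x - a) = 0 \<or> \<delta> \<le> frac (x - a)" if "x \<in> X \<sigma>" for x
        using that a eS at(3) by (auto simp: X_def)
      show "frac (x - p) \<le> w \<or> \<delta> \<le> frac (x - p)" if "x \<in> X \<sigma>" for x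
      proof (cases "x \<in> \<sigma>")
        case True
        then have "frac (x - a) = 0 \<or> \<delta> \<le> frac (x - a)" using a eS by simp
        then show ?thesis
        proof
          assume "frac (x - a) = 0"
          then have "x = a" using frac_diff_eq_0[of x a] True \<sigma>' ac by auto
          then show ?thesis using aw by simp
        next
          assume f: "\<delta> \<le> frac (x - a)"
          show ?thesis
          proof (cases "frac (a - p) \<le> frac (x - p)")
            case True
            then have "frac (x - a) = frac (x - p) - frac (a - p)" using fu[of x a] by simp
            then show ?thesis using f frac_ge_0[of "a - p"] by linarith
          next
            case False
            then show ?thesis using aw by linarith
          qed
        qed
      next
        case False
        then show ?thesis using that at(2) by (auto simp: X_def)
      qed
      show "frac (p + w + real i * \<delta>') \<in> X \<sigma>"
        if x: "x \<in> X \<sigma>" and i: "1 \<le> i" "i < m"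
          and z: "real i * \<delta> \<le> frac (x - p) \<and> frac (x - p) \<le> w + real i * \<delta>'" for x i
      proof (cases "x \<in> \<sigma>")
        case True
        then have "t i \<in> X \<sigma>" using i z by (auto simp: X_def zone_def)
        then show ?thesis by (simp add: t_def)
      next
        case False
        then obtain j where j: "x = t j" "1 \<le> j" "j < m" using x by (auto simp: X_def)
        have "i = j" using zone_top_unique[of i j] z i j ut[of j] by simp
        then show ?thesis using x j by (simp add: t_def)
      qed
    qed (use ac aw in auto)
  qed
  have eb: "\<delta> \<le> e T a \<and> e T a \<le> \<delta>'" for T a using \<delta> by (simp add: e_def)
  have faces: "all_faces \<sigma> \<subseteq> L" if "abstract_complex L" "\<sigma> \<in> L" for \<sigma> :: "real set" and L
    using abstract_complexD(3)[OF that] by (auto simp: all_faces_def)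
  have sub: "\<sigma> \<subseteq> circle" "finite \<sigma>" "\<sigma> \<noteq> {}" if "\<sigma> \<in> K" for \<sigma> using that by (auto simp: K_def gap_complex_def)
  \<comment> \<open>A face that survives in \<open>M\<close> may have no left end in the changed
    arc, so the zone lemma says nothing about it; its carrier is the simplex it spans.\<close>
  define \<Psi> where "\<Psi> \<sigma> = (if \<sigma> \<in> M then all_faces \<sigma> else gap_complex (e (S \<union> I)) (X \<sigma>))" for \<sigma>
  define \<Theta> where "\<Theta> \<sigma> = (if \<sigma> \<in> M then all_faces \<sigma> else gap_complex (e S) (X \<sigma>))" for \<sigma>
  have restr: "\<rho> \<in> gap_complex e' Y" if "\<rho> \<in> gap_complex e' circle" "\<rho> \<subseteq> Y" for \<rho> e' Y
    using that by (auto simp: gap_complex_def)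
  have monoM: "all_faces \<tau> \<subseteq> gap_complex (e (S \<union> I)) (X \<sigma>)" if "\<tau> \<in> M" "\<tau> \<subseteq> \<sigma>" for \<tau> \<sigma>
  proof
    fix \<rho> assume \<rho>: "\<rho> \<in> all_faces \<tau>"
    show "\<rho> \<in> gap_complex (e (S \<union> I)) (X \<sigma>)"
    proof (rule restr)
      show "\<rho> \<in> gap_complex (e (S \<union> I)) circle"
        using subsetD[OF faces[OF M that(1)] \<rho>] by (simp add: M_def)
      have "\<rho> \<subseteq> \<tau>" using \<rho> by (simp add: all_faces_def)
      then show "\<rho> \<subseteq> X \<sigma>" using \<sigma>X[of \<sigma>] that(2) by blast
    qed
  qed
  have "homotopy_equivalence_map (realization M) (realization K) id"
  proof (rule inclusion_homotopy_equivalence[OF K M MK, of \<Psi> \<Theta>])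
    fix \<sigma> assume \<sigma>: "\<sigma> \<in> K"
    show "contractible_complex (\<Psi> \<sigma>)" "contractible_complex (\<Theta> \<sigma>)"
      using contr[OF \<sigma>] eb contractible_all_faces sub[OF \<sigma>] by (auto simp: \<Psi>_def \<Theta>_def)
    show "\<Psi> \<sigma> \<subseteq> M"
      using faces[OF M, of \<sigma>] gap_complex_mono[OF X_circle[OF sub(1)[OF \<sigma>]]] by (simp add: \<Psi>_def M_def)
    show "\<Theta> \<sigma> \<subseteq> K"
      using faces[OF K \<sigma>] gap_complex_mono[OF X_circle[OF sub(1)[OF \<sigma>]]] by (simp add: \<Theta>_def K_def)
    show "\<sigma> \<in> \<Theta> \<sigma>"
      using \<sigma> restr[OF \<sigma>[unfolded K_def] \<sigma>X] sub[OF \<sigma>] by (simp add: \<Theta>_def all_faces_def)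
    show "\<Psi> \<sigma> \<subseteq> \<Theta> \<sigma>" using anti by (simp add: \<Psi>_def \<Theta>_def)
    fix \<tau> assume \<tau>: "\<tau> \<in> K" "\<tau> \<subseteq> \<sigma>"
    have M\<tau>: "\<tau> \<in> M" if "\<sigma> \<in> M" using abstract_complexD(3)[OF M that \<tau>(2)] sub(3)[OF \<tau>(1)] by blast
    have af: "all_faces \<tau> \<subseteq> all_faces \<sigma>" using \<tau> by (auto simp: all_faces_def)
    show "\<Psi> \<tau> \<subseteq> \<Psi> \<sigma>"
      using M\<tau> af monoM[OF _ \<tau>(2)] gap_complex_mono[OF mono_X[OF \<tau>(2)]] by (simp add: \<Psi>_def)
    show "\<Theta> \<tau> \<subseteq> \<Theta> \<sigma>"
      using M\<tau> af order_trans[OF monoM[OF _ \<tau>(2)] anti] gap_complex_mono[OF mono_X[OF \<tau>(2)]]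
      by (simp add: \<Theta>_def)
  next
    fix \<sigma> assume \<sigma>: "\<sigma> \<in> M"
    then show "\<sigma> \<in> \<Psi> \<sigma>" using MK sub(3) by (auto simp: \<Psi>_def all_faces_def)
  qed
  then show ?thesis by (simp add: M_def K_def)
qed

end

section \<open>Composing the stages\<close>

lemma homotopy_equivalence_map_id_refl: "homotopy_equivalence_map X X id"
  unfolding homotopy_equivalence_map_def by (intro conjI exI[of _ id]) auto

lemma homotopy_equivalence_map_id_trans:
  assumes XY: "homotopy_equivalence_map X Y id" and YZ: "homotopy_equivalence_map Y Z id"
  shows "homotopy_equivalence_map X Z id"
proof -
  obtain g where c: "continuous_map X Y id" "continuous_map Y X g"
    and g: "homotopic_with (\<lambda>x. True) X X g id" "homotopic_with (\<lambda>x. True) Y Y g id"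
    using XY unfolding homotopy_equivalence_map_def comp_id id_comp by blast
  obtain h where d: "continuous_map Y Z id" "continuous_map Z Y h"
    and h: "homotopic_with (\<lambda>x. True) Y Y h id" "homotopic_with (\<lambda>x. True) Z Z h id"
    using YZ unfolding homotopy_equivalence_map_def comp_id id_comp by blast
  have 1: "homotopic_with (\<lambda>x. True) X X (g \<circ> h) id"
  proof -
    have "homotopic_with (\<lambda>x. True) X Y (h \<circ> id) (id \<circ> id)"
      by (rule homotopic_with_compose_continuous_map_right[OF h(1) c(1)]) simp
    then have "homotopic_with (\<lambda>x. True) X X (g \<circ> (h \<circ> id)) (g \<circ> (id \<circ> id))"
      by (rule homotopic_with_compose_continuous_map_left[OF _ c(2)]) simp
    then have "homotopic_with (\<lambda>x. True) X X (g \<circ> h) g" by simp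
    then show ?thesis using g(1) by (rule homotopic_with_trans)
  qed
  have 2: "homotopic_with (\<lambda>x. True) Z Z (g \<circ> h) id"
  proof -
    have "homotopic_with (\<lambda>x. True) Z Y (g \<circ> h) (id \<circ> h)"
      by (rule homotopic_with_compose_continuous_map_right[OF g(2) d(2)]) simp
    then have "homotopic_with (\<lambda>x. True) Z Z (id \<circ> (g \<circ> h)) (id \<circ> (id \<circ> h))"
      by (rule homotopic_with_compose_continuous_map_left[OF _ d(1)]) simp
    then have "homotopic_with (\<lambda>x. True) Z Z (g \<circ> h) h" by simp
    then show ?thesis using h(2) by (rule homotopic_with_trans)
  qed
  show ?thesis
    unfolding homotopy_equivalence_map_def
    using 1 2 continuous_map_compose[OF c(1) d(1)] continuous_map_compose[OF d(2) c(2)]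
    by (intro conjI exI[of _ "g \<circ> h"]) auto
qed

lemma gap_complex_cong:
  assumes "\<And>a. a \<in> circle \<Longrightarrow> e a = e' a"
  shows "gap_complex e X = gap_complex e' X"
  using assms unfolding gap_complex_def by auto

text \<open>The circle is covered by finitely many arcs of length \<open>w\<close>, and the length
  is raised on one after the other. The three strict inequalities leave room for a positive
  \<open>w\<close>.\<close>

lemma gap_step:
  fixes m :: nat and \<delta> \<delta>' :: real
  assumes m: "2 \<le> m" and \<delta>: "\<delta> \<le> \<delta>'"
    and c1: "real m * (\<delta>' - \<delta>) < real m * \<delta> - 1"
    and c2: "real m * (\<delta>' - \<delta>) < 1 - (real m - 1) * \<delta>"
    and c3: "real m * (\<delta>' - \<delta>) < \<delta>"
  shows "homotopy_equivalence_map (realization (gap_complex (\<lambda>_. \<delta>') circle))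
           (realization (gap_complex (\<lambda>_. \<delta>) circle)) id"
proof -
  define \<mu> where "\<mu> = min (real m * \<delta> - 1) (min (1 - (real m - 1) * \<delta>) \<delta>)"
  \<comment> \<open>Half of the slack left by the three inequalities.\<close>
  define w where "w = (\<mu> - real m * (\<delta>' - \<delta>)) / 2"
  have "real m * (\<delta>' - \<delta>) < \<mu>" using c1 c2 c3 by (simp add: \<mu>_def)
  then have w: "0 < w" and w\<mu>: "w + real m * (\<delta>' - \<delta>) < \<mu>" by (auto simp: w_def field_simps)
  define I where "I j = {a \<in> circle. frac (a - real j * w) < w}" for j
  define S where "S n = (\<Union>j<n. I j)" for n
  have chain: "homotopy_equivalence_map (realization (gap_complex (\<lambda>a. if a \<in> S n then \<delta>' else \<delta>) circle))
           (realization (gap_complex (\<lambda>_. \<delta>) circle)) id" for n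
  proof (induction n)
    case 0
    have "(\<lambda>a. if a \<in> S 0 then \<delta>' else \<delta>) = (\<lambda>_. \<delta>)" by (simp add: S_def)
    then show ?case by (simp only: homotopy_equivalence_map_id_refl)
  next
    case (Suc n)
    have eq: "S (Suc n) = S n \<union> I n" by (auto simp: S_def less_Suc_eq)
    have "homotopy_equivalence_map (realization (gap_complex (\<lambda>a. if a \<in> S n \<union> I n then \<delta>' else \<delta>) circle))
           (realization (gap_complex (\<lambda>a. if a \<in> S n then \<delta>' else \<delta>) circle)) id"
      using w\<mu> by (intro gap_stage[OF m \<delta> w]) (auto simp: \<mu>_def I_def)
    then show ?case unfolding eq by (rule homotopy_equivalence_map_id_trans[OF _ Suc])
  qed
  obtain N :: nat where N: "1 / w < real N" using reals_Archimedean2 by blast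
  have "a \<in> S N" if "a \<in> circle" for a
  proof -
    define j where "j = nat \<lfloor>a / w\<rfloor>"
    have a: "0 \<le> a" "a < 1" using that by (auto simp: circle_def)
    have j: "real j \<le> a / w" "a / w < real j + 1"
      using a w by (auto simp: j_def)
    have 1: "0 \<le> a - real j * w" "a - real j * w < w"
      using j w by (auto simp: field_simps)
    moreover have "a - real j * w < 1" using a w by (smt (verit) mult_nonneg_nonneg of_nat_0_le_iff)
    ultimately have "a \<in> I j" using that by (simp add: I_def frac_eq)
    moreover have "a / w < 1 / w" using a w by (intro divide_strict_right_mono) auto
    then have "j < N" using j N by linarith
    ultimately show ?thesis by (auto simp: S_def)
  qed
  then have "gap_complex (\<lambda>a. if a \<in> S N then \<delta>' else \<delta>) circle = gap_complex (\<lambda>_. \<delta>') circle"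
    by (intro gap_complex_cong) auto
  then show ?thesis using chain[of N] by (simp only:)
qed

lemma gap_complex_inclusion_equivalence:
  fixes m :: nat and \<delta> \<delta>' :: real
  assumes m: "2 \<le> m" and \<delta>: "1 < real m * \<delta>" "\<delta> \<le> \<delta>'" "(real m - 1) * \<delta>' < 1"
  shows "homotopy_equivalence_map (realization (gap_complex (\<lambda>_. \<delta>') circle))
           (realization (gap_complex (\<lambda>_. \<delta>) circle)) id"
proof -
  \<comment> \<open>The least slack over the whole interval of lengths: the first and third term are
    smallest at \<open>\<delta>\<close>, the second at \<open>\<delta>'\<close>. One step size
    therefore works throughout.\<close>
  define \<mu> where "\<mu> = min (real m * \<delta> - 1) (min (1 - (real m - 1) * \<delta>') \<delta>)"
  have "0 < real m * \<delta>" using \<delta> by linarith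
  then have \<delta>0: "0 < \<delta>" using m by (simp add: zero_less_mult_iff)
  have \<mu>: "0 < \<mu>" using \<delta> \<delta>0 by (simp add: \<mu>_def)
  obtain N :: nat where N: "real m * (\<delta>' - \<delta>) / \<mu> < real N" using reals_Archimedean2 by blast
  have "0 \<le> real m * (\<delta>' - \<delta>) / \<mu>" using \<delta> \<mu> by simp
  then have N0: "0 < real N" using N by linarith
  define D where "D = (\<delta>' - \<delta>) / real N"
  have D: "0 \<le> D" "real m * D < \<mu>" "\<delta> + real N * D = \<delta>'"
    using \<delta> N0 N \<mu> by (auto simp: D_def field_simps)
  have "homotopy_equivalence_map (realization (gap_complex (\<lambda>_. \<delta> + real k * D) circle))
           (realization (gap_complex (\<lambda>_. \<delta>) circle)) id" if "k \<le> N" for k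
    using that
  proof (induction k)
    case 0
    have "(\<lambda>_. \<delta> + real 0 * D) = (\<lambda>_::real. \<delta>)" by simp
    then show ?case by (simp only: homotopy_equivalence_map_id_refl)
  next
    case (Suc k)
    have x: "\<delta> \<le> \<delta> + real k * D" "\<delta> + real k * D \<le> \<delta>'"
    proof -
      show "\<delta> \<le> \<delta> + real k * D" using D by simp
      have "real k * D \<le> real N * D" using Suc.prems D by (intro mult_right_mono) auto
      then show "\<delta> + real k * D \<le> \<delta>'" using D by linarith
    qed
    have "homotopy_equivalence_map (realization (gap_complex (\<lambda>_. \<delta> + real (Suc k) * D) circle))
           (realization (gap_complex (\<lambda>_. \<delta> + real k * D) circle)) id"
    proof (rule gap_step[OF m])
      have eq: "\<delta> + real (Suc k) * D - (\<delta> + real k * D) = D" by (simp add: algebra_simps)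
      show "\<delta> + real k * D \<le> \<delta> + real (Suc k) * D" using eq D by linarith
      have "real m * \<delta> \<le> real m * (\<delta> + real k * D)" using x by (intro mult_left_mono) auto
      then show "real m * (\<delta> + real (Suc k) * D - (\<delta> + real k * D)) < real m * (\<delta> + real k * D) - 1"
        unfolding eq using D(2) by (simp add: \<mu>_def)
      have "(real m - 1) * (\<delta> + real k * D) \<le> (real m - 1) * \<delta>'" using x m by (intro mult_left_mono) auto
      then show "real m * (\<delta> + real (Suc k) * D - (\<delta> + real k * D)) < 1 - (real m - 1) * (\<delta> + real k * D)"
        unfolding eq using D(2) by (simp add: \<mu>_def)
      show "real m * (\<delta> + real (Suc k) * D - (\<delta> + real k * D)) < \<delta> + real k * D"
        unfolding eq using D(2) x by (simp add: \<mu>_def)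
    qed
    then show ?case
      by (rule homotopy_equivalence_map_id_trans[OF _ Suc.IH[OF Suc_leD[OF Suc.prems]]])
  qed
  from this[of N] show ?thesis unfolding D(3) by blast
qed

subsection \<open>A regular value of the gap length\<close>

text \<open>For \<open>d = 2/(2m - 1)\<close> rounding down retracts the complex onto the proper subsets of the
  \<open>(2m - 1)\<close>-gon: a set of grid points has a gap of two steps iff it is not the whole grid.\<close>

definition grid :: "nat \<Rightarrow> real set" where
  "grid q = (\<lambda>k. real k / real q) ` {..<q}"

lemma frac_of_nat_eq_0 [simp]: "frac (real k) = 0"
  by (simp add: frac_def)

lemma grid_iff:
  assumes "q > 0"
  shows "x \<in> grid q \<longleftrightarrow> x \<in> circle \<and> frac (real q * x) = 0"
proof
  assume "x \<in> grid q"
  then show "x \<in> circle \<and> frac (real q * x) = 0"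
    using assms by (auto simp: grid_def circle_def)
next
  assume x: "x \<in> circle \<and> frac (real q * x) = 0"
  then have "real q * x = of_int \<lfloor>real q * x\<rfloor>" by (simp add: frac_def)
  moreover have "0 \<le> \<lfloor>real q * x\<rfloor>" using x by (simp add: circle_def)
  ultimately have eq: "real q * x = real (nat \<lfloor>real q * x\<rfloor>)" by simp
  moreover have "real q * x < real q" using x assms by (simp add: circle_def)
  ultimately have "nat \<lfloor>real q * x\<rfloor> < q" by linarith
  moreover have "x = real (nat \<lfloor>real q * x\<rfloor>) / real q" using eq assms by (simp add: field_simps)
  ultimately show "x \<in> grid q" unfolding grid_def by blast
qed

lemma grid_floor_in_grid:
  assumes "q > 0" "x \<in> circle"
  shows "grid_floor q x \<in> grid q"
  using assms grid_floor_circle[OF assms] unfolding grid_iff[OF assms(1)] by (simp add: grid_floor_def)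

lemma grid_floor_id:
  assumes "q > 0" "frac (real q * x) = 0"
  shows "grid_floor q x = x"
  using grid_floor_offset[OF assms(1), of x] assms(2) by simp

lemma finite_grid: "finite (grid q)" by (simp add: grid_def)

lemma step_closed_imp_orbit:
  assumes "x \<in> A" "A \<subseteq> circle" "\<And>y. y \<in> A \<Longrightarrow> frac (y + h) \<in> A"
  shows "frac (x + real k * h) \<in> A"
proof (induction k)
  case 0
  then show ?case using assms frac_circle by auto
next
  case (Suc k)
  have "frac (frac (x + real k * h) + h) = frac (x + real (Suc k) * h)"
    using frac_diff_frac[of "x + real k * h" "- h"] by (simp add: algebra_simps)
  then show ?case using assms(3)[OF Suc] by simp
qed

text \<open>Points of equal offset differ by an integer multiple of \<open>1 / q\<close>; as this
  step has order \<open>q\<close> on the circle, the multiple can be reduced to a natural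
  number.\<close>

lemma same_offset_orbit:
  assumes q: "q > 0" and z: "z \<in> circle" and eq: "frac (real q * z) = frac (real q * x)"
  obtains k :: nat where "z = frac (x + real k * (1 / real q))"
proof -
  define j where "j = \<lfloor>real q * z\<rfloor> - \<lfloor>real q * x\<rfloor>"
  have "real q * z = real q * x + of_int j" using eq by (simp add: frac_def j_def)
  then have zx: "z = x + of_int j / real q" using q by (simp add: field_simps)
  define k where "k = nat (j mod int q)"
  have k: "int k = j - int q * (j div int q)" using q by (simp add: k_def minus_mult_div_eq_mod)
  have "real k = of_int (int k)" by simp
  also have "\<dots> = of_int j - real q * of_int (j div int q)" unfolding k by simp
  finally have "x + real k * (1 / real q) = z + of_int (- (j div int q))"
    using q unfolding zx by (simp add: field_simps)
  then have "frac (x + real k * (1 / real q)) = frac z" by (metis frac_add_of_int)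
  then show ?thesis using that frac_circle[OF z] by metis
qed

text \<open>Rounding down cannot hit the grid point that follows the rounded left end
  \<open>a\<close> of a gap: a preimage would lie strictly between \<open>a\<close> and
  \<open>a + 2/q\<close>. So images of faces are proper subsets of the grid, and since all of these
  are faces, they serve as simplices in the carrier of the retraction.\<close>

lemma gap_two_steps:
  fixes m :: nat
  defines "q \<equiv> 2 * m - 1"
  assumes m: "2 \<le> m"
  shows "homotopy_equivalence_map (realization (all_faces (grid q) - {grid q}))
           (realization (gap_complex (\<lambda>_. 2 / real q) circle)) id"
proof -
  have q: "q > 0" "3 \<le> q" and q2m: "2 * m = q + 1" using m by (auto simp: q_def)
  define d where "d = 2 / real q"
  have d: "0 < d" "d < 1" using q by (auto simp: d_def)
  define K where "K = gap_complex (\<lambda>_. d) circle"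
  define M where "M = all_faces (grid q) - {grid q}"
  let ?f = "grid_floor q"
  have K: "abstract_complex K" by (simp add: K_def abstract_complex_gap)
  have M: "abstract_complex M"
    by (rule abstract_complexI) (auto simp: M_def all_faces_def intro: finite_subset[OF _ finite_grid])
  have MK: "M \<subseteq> K"
  proof
    fix \<sigma> assume \<sigma>: "\<sigma> \<in> M"
    then have sg: "\<sigma> \<subseteq> grid q" "\<sigma> \<noteq> {}" "\<sigma> \<noteq> grid q" by (auto simp: M_def all_faces_def)
    have sc: "\<sigma> \<subseteq> circle" using sg grid_iff[OF q(1)] by blast
    \<comment> \<open>A non-empty subset closed under the step \<open>1 / q\<close> would be the
      whole grid. Where the successor of \<open>a\<close> is missing, a gap of two steps
      opens.\<close>
    have "\<exists>a\<in>\<sigma>. frac (a + 1 / real q) \<notin> \<sigma>"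
    proof (rule ccontr)
      assume neg: "\<not> ?thesis"
      obtain x where x: "x \<in> \<sigma>" using sg by blast
      have "z \<in> \<sigma>" if "z \<in> grid q" for z
      proof -
        have zc: "z \<in> circle" "frac (real q * z) = frac (real q * x)"
          using that x sg grid_iff[OF q(1)] by auto
        obtain k :: nat where "z = frac (x + real k * (1 / real q))"
          using same_offset_orbit[OF q(1) zc] by blast
        then show ?thesis using step_closed_imp_orbit[OF x sc] neg by blast
      qed
      then show False using sg by blast
    qed
    then obtain a where a: "a \<in> \<sigma>" "frac (a + 1 / real q) \<notin> \<sigma>" by blast
    show "\<sigma> \<in> K"
      unfolding K_def
    proof (rule gap_complexI[of _ _ a])
      fix x assume x: "x \<in> \<sigma>"
      have "frac (real q * x) = 0" "frac (real q * a) = 0" using x a sg grid_iff[OF q(1)] by auto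
      then obtain i j where ij: "real q * x = of_int i" "real q * a = of_int j"
        by (metis frac_eq_0_iff Ints_cases)
      define n where "n = i - j - int q * \<lfloor>x - a\<rfloor>"
      have "real q * frac (x - a) = of_int n"
        using ij by (simp add: frac_def n_def algebra_simps)
      then have fn: "frac (x - a) = of_int n / real q" using q by (simp add: field_simps)
      have "n \<noteq> 1"
      proof
        assume "n = 1"
        then have "frac (x - a) = 1 / real q" using fn by simp
        then have "x - a - of_int \<lfloor>x - a\<rfloor> = 1 / real q" by (simp add: frac_def)
        then have "a + 1 / real q = x + of_int (- \<lfloor>x - a\<rfloor>)" by simp
        then have "frac (a + 1 / real q) = frac x" by (metis frac_add_of_int)
        then show False using a x sc frac_circle by auto
      qed
      moreover have "0 \<le> n" using frac_ge_0[of "x - a"] fn q by (simp add: zero_le_divide_iff)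
      ultimately consider "n = 0" | "2 \<le> n" by linarith
      then show "frac (x - a) = 0 \<or> d \<le> frac (x - a)"
      proof cases
        case 2
        then have "2 \<le> real_of_int n" by simp
        then have "d \<le> frac (x - a)" unfolding fn d_def by (intro divide_right_mono) auto
        then show ?thesis ..
      qed (use fn in simp)
    qed (use sg sc a finite_subset[OF _ finite_grid] in auto)
  qed
  have sub: "\<sigma> \<subseteq> circle" "finite \<sigma>" "\<sigma> \<noteq> {}" if "\<sigma> \<in> K" for \<sigma> using that by (auto simp: K_def gap_complex_def)
  have fM: "?f ` \<sigma> \<in> M" if \<sigma>: "\<sigma> \<in> K" for \<sigma>
  proof -
    obtain a where a: "a \<in> \<sigma>" "\<And>x. x \<in> \<sigma> \<Longrightarrow> frac (x - a) = 0 \<or> d \<le> frac (x - a)"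
      using gap_leader[OF \<sigma>[unfolded K_def] d(1)] by blast
    have "?f ` \<sigma> \<noteq> grid q"
    proof
      assume eq: "?f ` \<sigma> = grid q"
      \<comment> \<open>The successor on the grid of the rounded left end.\<close>
      define g where "g = frac (?f a + 1 / real q)"
      have fa: "frac (real q * ?f a) = 0" using grid_floor_in_grid[OF q(1)] a sub[OF \<sigma>] grid_iff[OF q(1)] by blast
      have "real q * g = of_int (\<lfloor>real q * a\<rfloor> + 1 - int q * \<lfloor>?f a + 1 / real q\<rfloor>)"
        using q by (simp add: g_def frac_def grid_floor_def algebra_simps)
      then have "frac (real q * g) = 0" by (metis frac_of_int)
      then have "g \<in> grid q" using grid_iff[OF q(1)] by (simp add: g_def frac_in_circle)
      then obtain x where x: "x \<in> \<sigma>" "?f x = g" using eq by (metis imageE)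
      define oa where "oa = a - ?f a"
      define ox where "ox = x - ?f x"
      have o: "0 \<le> oa" "oa < 1 / real q" "0 \<le> ox" "ox < 1 / real q"
        using grid_floor_offset[OF q(1)] frac_lt_1 q unfolding oa_def ox_def
        by (auto intro!: divide_strict_right_mono)
      have "x - a = (1 / real q + ox - oa) + of_int (- \<lfloor>?f a + 1 / real q\<rfloor>)"
        using x(2) unfolding g_def oa_def ox_def frac_def by simp
      then have "frac (x - a) = frac (1 / real q + ox - oa)" by (metis frac_add_of_int)
      moreover have "0 < 1 / real q + ox - oa" "1 / real q + ox - oa < d"
        using o unfolding d_def by (auto simp: field_simps)
      ultimately have "frac (x - a) = 1 / real q + ox - oa" using d by (simp add: frac_eq)
      then show False using a(2)[OF x(1)] \<open>0 < 1 / real q + ox - oa\<close> \<open>1 / real q + ox - oa < d\<close> by linarith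
    qed
    moreover have "?f ` \<sigma> \<subseteq> grid q" using grid_floor_in_grid[OF q(1)] sub[OF \<sigma>] by blast
    ultimately show ?thesis using sub[OF \<sigma>] by (auto simp: M_def all_faces_def)
  qed
  have contr: "contractible_complex (gap_complex (\<lambda>_. d) (\<sigma> \<union> ?f ` \<sigma>))" if \<sigma>: "\<sigma> \<in> K" for \<sigma>
  proof -
    let ?X = "\<sigma> \<union> ?f ` \<sigma>"
    have Xc: "?X \<subseteq> circle" using sub[OF \<sigma>] grid_floor_circle[OF q(1)] by blast
    have g0: "frac (real q * ?f x) = 0" for x using q by (simp add: grid_floor_def)
    have "contractible_complex (gap_complex (\<lambda>_. real 2 / real q) ?X)"
    proof (rule contractible_grid_rounding)
      show "(2::nat) < q" using q by simp
      show "finite ?X" using sub[OF \<sigma>] by simp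
      show "?f ` ?X \<subseteq> ?X" using grid_floor_id[OF q(1) g0] by auto
      show "\<exists>k::nat. frac (y - real k * (real 2 / real q)) \<notin> ?X" if y: "y \<in> ?X" "frac (real q * y) \<noteq> 0" for y
      proof (rule ccontr)
        assume neg: "\<not> ?thesis"
        obtain a where a: "a \<in> \<sigma>" "\<And>x. x \<in> \<sigma> \<Longrightarrow> frac (x - a) = 0 \<or> d \<le> frac (x - a)"
          using gap_leader[OF \<sigma>[unfolded K_def] d(1)] by blast
        \<comment> \<open>Chosen so that going back \<open>j\<close> steps of \<open>1 / q\<close>
          brings \<open>y\<close> into the arc from \<open>a\<close>, excluded, to
          \<open>a + 1/q\<close>, included, inside the gap of \<open>\<sigma>\<close>.\<close>
        define j where "j = \<lceil>real q * (y - a)\<rceil> - 1"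
        have j: "0 < real q * (y - a) - of_int j" "real q * (y - a) - of_int j \<le> 1"
          unfolding j_def by linarith+
        \<comment> \<open>\<open>m\<close> is the inverse of 2 modulo \<open>q = 2 * m - 1\<close>,
          so \<open>k\<close> steps of \<open>2 / q\<close> amount to \<open>j\<close> steps of
          \<open>1 / q\<close> on the circle. Thus the orbit of \<open>y\<close> meets the gap,
          although it advances by two grid steps at a time.\<close>
        define k where "k = nat (j * int m mod int q)"
        define n where "n = j - 2 * (j * int m div int q)"
        have "int k = j * int m - int q * (j * int m div int q)"
          using q by (simp add: k_def minus_mult_div_eq_mod)
        then have "2 * int k = j * (2 * int m) - int q * (2 * (j * int m div int q))"
          by (simp add: algebra_simps)
        moreover have "2 * int m = int q + 1" using q2m by linarith
        ultimately have n: "2 * int k = j + int q * n" by (simp add: n_def algebra_simps)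
        have "2 * real k = of_int (2 * int k)" by simp
        also have "\<dots> = of_int j + real q * of_int n" unfolding n by simp
        finally have k2: "real k * (real 2 / real q) = of_int j / real q + of_int n"
          using q by (simp add: field_simps)
        define z where "z = frac (y - real k * (real 2 / real q))"
        have zX: "z \<in> ?X" using neg by (auto simp: z_def)
        have "real q * z = real q * y + of_int (- j - int q * n - int q * \<lfloor>y - real k * (real 2 / real q)\<rfloor>)"
          unfolding z_def frac_def k2 using q by (simp add: algebra_simps)
        then have "frac (real q * z) \<noteq> 0" using y(2) by (metis frac_add_of_int)
        then have z\<sigma>: "z \<in> \<sigma>" using zX g0 by auto
        have "frac (z - a) = frac ((real q * (y - a) - of_int j) / real q)"
        proof -
          have "frac (z - a) = frac (y - real k * (real 2 / real q) - a)" unfolding z_def by (rule frac_diff_frac)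
          also have "y - real k * (real 2 / real q) - a = (real q * (y - a) - of_int j) / real q + of_int (- n)"
            unfolding k2 using q by (simp add: field_simps)
          finally show ?thesis by (simp only: frac_add_of_int)
        qed
        moreover have "(real q * (y - a) - of_int j) / real q \<le> 1 / real q" using j by (intro divide_right_mono) auto
        moreover have "1 / real q < d" "0 < (real q * (y - a) - of_int j) / real q"
          using q j by (auto simp: d_def divide_strict_right_mono)
        ultimately have "0 < frac (z - a)" "frac (z - a) < d" using d by (auto simp: frac_eq)
        then show False using a(2)[OF z\<sigma>] by linarith
      qed
      have "{x \<in> ?X. frac (real q * x) = 0} = ?f ` \<sigma>"
        using g0 grid_floor_id[OF q(1)] by force
      moreover have "gap_complex (\<lambda>_. d) (?f ` \<sigma>) = all_faces (?f ` \<sigma>)"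
        using fM[OF \<sigma>] MK by (intro gap_complex_full[of _ _ circle]) (auto simp: K_def)
      ultimately show "contractible_complex (gap_complex (\<lambda>_. real 2 / real q) {x \<in> ?X. frac (real q * x) = 0})"
        using contractible_all_faces[of "?f ` \<sigma>"] sub[OF \<sigma>] by (simp add: d_def)
    qed (use Xc in auto)
    then show ?thesis by (simp add: d_def)
  qed
  have "homotopy_equivalence_map (realization M) (realization K) id"
  proof (rule inclusion_homotopy_equivalence[OF K M MK, of "\<lambda>\<sigma>. all_faces (?f ` \<sigma>)" "\<lambda>\<sigma>. gap_complex (\<lambda>_. d) (\<sigma> \<union> ?f ` \<sigma>)"])
    fix \<sigma> assume \<sigma>: "\<sigma> \<in> K"
    have f: "?f ` \<sigma> \<in> M" by (rule fM[OF \<sigma>])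
    show "contractible_complex (all_faces (?f ` \<sigma>))" using sub[OF \<sigma>] by (intro contractible_all_faces) auto
    show fm: "all_faces (?f ` \<sigma>) \<subseteq> M" using abstract_complexD(3)[OF M f] by (auto simp: all_faces_def)
    show "contractible_complex (gap_complex (\<lambda>_. d) (\<sigma> \<union> ?f ` \<sigma>))" by (rule contr[OF \<sigma>])
    show "gap_complex (\<lambda>_. d) (\<sigma> \<union> ?f ` \<sigma>) \<subseteq> K"
      unfolding K_def using sub[OF \<sigma>] grid_floor_circle[OF q(1)] by (intro gap_complex_mono) blast
    show "\<sigma> \<in> gap_complex (\<lambda>_. d) (\<sigma> \<union> ?f ` \<sigma>)"
      using \<sigma> by (auto simp: K_def gap_complex_def)
    show "all_faces (?f ` \<sigma>) \<subseteq> gap_complex (\<lambda>_. d) (\<sigma> \<union> ?f ` \<sigma>)"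
    proof
      fix \<rho> assume \<rho>: "\<rho> \<in> all_faces (?f ` \<sigma>)"
      then have "\<rho> \<in> K" using fm MK by blast
      then show "\<rho> \<in> gap_complex (\<lambda>_. d) (\<sigma> \<union> ?f ` \<sigma>)"
        using \<rho> by (auto simp: K_def gap_complex_def all_faces_def)
    qed
    fix \<tau> assume \<tau>: "\<tau> \<in> K" "\<tau> \<subseteq> \<sigma>"
    show "all_faces (?f ` \<tau>) \<subseteq> all_faces (?f ` \<sigma>)"
      using image_mono[OF \<tau>(2), of ?f] unfolding all_faces_def by blast
    show "gap_complex (\<lambda>_. d) (\<tau> \<union> ?f ` \<tau>) \<subseteq> gap_complex (\<lambda>_. d) (\<sigma> \<union> ?f ` \<sigma>)"
      using \<tau> by (intro gap_complex_mono) blast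
  next
    fix \<sigma> assume \<sigma>: "\<sigma> \<in> M"
    then have "?f x = x" if "x \<in> \<sigma>" for x
      using that grid_iff[OF q(1)] by (intro grid_floor_id[OF q(1)]) (auto simp: M_def all_faces_def)
    then have "?f ` \<sigma> = \<sigma>" by simp
    then show "\<sigma> \<in> all_faces (?f ` \<sigma>)" using \<sigma> by (auto simp: M_def all_faces_def)
  qed
  then show ?thesis by (simp add: M_def K_def d_def)
qed

subsection \<open>Critical gap lengths\<close>

text \<open>For \<open>d = 1/m\<close> the circle is partitioned into the cosets of the \<open>m\<close>-gon \<open>grid m\<close>; a face contains
  at most one full coset. The complex deforms onto the spheres formed by the proper subsets of
  \<open>coset m s \<union> grid m\<close>, which share the simplex \<open>grid m\<close>.\<close>

definition coset :: "nat \<Rightarrow> real \<Rightarrow> real set" where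
  "coset m s = {x \<in> circle. frac (real m * x) = s}"

text \<open>The value \<open>s = 0\<close> is left out: the polygon \<open>grid m\<close> itself may
  be contained.\<close>

definition coset_free :: "nat \<Rightarrow> real set \<Rightarrow> bool" where
  "coset_free m \<rho> \<longleftrightarrow> (\<forall>s\<in>{0<..<1}. \<not> coset m s \<subseteq> \<rho>)"

text \<open>Strict inclusion makes each \<open>s\<close> contribute the boundary of a simplex on
  \<open>2 * m\<close> vertices, a sphere of dimension \<open>2 * m - 2\<close>.\<close>

definition sphere_bouquet :: "nat \<Rightarrow> real set set" where
  "sphere_bouquet m = {\<rho>. \<rho> \<noteq> {} \<and> (\<exists>s\<in>{0<..<1}. \<rho> \<subset> coset m s \<union> grid m)}"

text \<open>The point of \<open>grid m\<close> in the open arc between neighbours of \<open>coset m s\<close> that contains \<open>x\<close>.\<close>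

definition arc_point :: "nat \<Rightarrow> real \<Rightarrow> real \<Rightarrow> real" where
  "arc_point m s x = frac (x - frac (real m * x - s) / real m + (1 - s) / real m)"

context
  fixes m :: nat
  assumes m: "2 \<le> m"
begin

lemma m0: "0 < m" "0 < real m" using m by auto

lemma grid_coset: "grid m = coset m 0"
  using grid_iff[OF m0(1)] by (auto simp: coset_def)

text \<open>\<open>z\<close> is the first point of the coset at or after \<open>a\<close>; it is
  reached before \<open>a + 1/m\<close>, so every half-open arc of length \<open>1/m\<close> meets
  every coset.\<close>

lemma next_in_coset:
  fixes s a :: real
  assumes "0 \<le> s" "s < 1"
  defines "z \<equiv> frac (a + frac (s - real m * a) / real m)"
  shows "z \<in> coset m s" "frac (z - a) = frac (s - real m * a) / real m"
proof -
  have "real m * z = s + of_int (- \<lfloor>s - real m * a\<rfloor> - int m * \<lfloor>a + frac (s - real m * a) / real m\<rfloor>)"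
    unfolding z_def frac_def using m0 by (simp add: field_simps)
  then have "frac (real m * z) = frac s" by (metis frac_add_of_int)
  then show "z \<in> coset m s" using assms by (simp add: coset_def z_def frac_in_circle frac_eq)
  have "frac (z - a) = frac (frac (s - real m * a) / real m)"
    unfolding z_def frac_diff_frac by simp
  moreover have "frac (s - real m * a) / real m < 1"
    using frac_lt_1[of "s - real m * a"] m0 by (simp add: divide_less_eq)
  ultimately show "frac (z - a) = frac (s - real m * a) / real m"
    using m0 by (simp add: frac_eq)
qed

lemma coset_nonempty: "0 \<le> s \<Longrightarrow> s < 1 \<Longrightarrow> coset m s \<noteq> {}"
  using next_in_coset(1) by blast

lemma card_coset:
  assumes s: "0 \<le> s" "s < 1"
  shows "card (coset m s) = m"
proof -
  have "coset m s = (\<lambda>k. (real k + s) / real m) ` {..<m}"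
  proof (intro subset_antisym subsetI)
    fix x assume x: "x \<in> coset m s"
    then have c: "0 \<le> x" "x < 1" "frac (real m * x) = s" by (auto simp: coset_def circle_def)
    have "0 \<le> \<lfloor>real m * x\<rfloor>" using c by simp
    then have eq: "real m * x = real (nat \<lfloor>real m * x\<rfloor>) + s" using c(3) by (simp add: frac_def)
    have "real m * x < real m" using c m0 by simp
    then have "nat \<lfloor>real m * x\<rfloor> < m" using eq s by linarith
    moreover have "x = (real (nat \<lfloor>real m * x\<rfloor>) + s) / real m" using eq m0 by (simp add: field_simps)
    ultimately show "x \<in> (\<lambda>k. (real k + s) / real m) ` {..<m}" by blast
  next
    fix x assume "x \<in> (\<lambda>k. (real k + s) / real m) ` {..<m}"
    then obtain k where k: "k < m" "x = (real k + s) / real m" by blast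
    have "real k + 1 \<le> real m" using k(1) by linarith
    then have "real k + s < real m" using s by linarith
    then have "x \<in> circle" using k(2) s m0 by (simp add: circle_def)
    moreover have "real m * x = s + of_int (int k)" using k(2) m0 by simp
    then have "frac (real m * x) = s" using s by (simp only: frac_add_of_int) (simp add: frac_eq)
    ultimately show "x \<in> coset m s" by (simp add: coset_def)
  qed
  moreover have "inj_on (\<lambda>k. (real k + s) / real m) {..<m}" using m0 by (auto simp: inj_on_def)
  ultimately show ?thesis by (simp add: card_image)
qed

lemma finite_coset: "finite (coset m s)"
proof (cases "0 \<le> s \<and> s < 1")
  case True
  then have "0 < card (coset m s)" using card_coset m0 by simp
  then show ?thesis by (rule card_ge_0_finite)
next
  case False
  then have "coset m s = {}" using frac_lt_1 by (auto simp: coset_def)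
  then show ?thesis by simp
qed

lemma coset_disjoint: "x \<in> coset m s \<Longrightarrow> x \<in> coset m s' \<Longrightarrow> s = s'"
  by (simp add: coset_def)

lemma coset_sub_circle: "coset m s \<subseteq> circle"
  by (auto simp: coset_def)

lemma coset_sub_coset:
  assumes "0 \<le> s" "s < 1" "coset m s \<subseteq> coset m s' \<union> grid m" "s \<noteq> 0"
  shows "s = s'"
  using coset_nonempty[OF assms(1,2)] assms(3,4) coset_disjoint unfolding grid_coset by blast

lemma frac_coset_diff:
  assumes "x \<in> coset m s" "a \<in> coset m s"
  shows "frac (x - a) = 0 \<or> 1 / real m \<le> frac (x - a)"
proof -
  have "real m * frac (x - a) = of_int (\<lfloor>real m * x\<rfloor> - \<lfloor>real m * a\<rfloor> - int m * \<lfloor>x - a\<rfloor>)"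
    using assms by (simp add: coset_def frac_def algebra_simps)
  then obtain n :: int where n: "real m * frac (x - a) = of_int n" by blast
  then have f: "frac (x - a) = of_int n / real m" using m0 by (simp add: field_simps)
  have "0 \<le> n" using frac_ge_0[of "x - a"] f m0 by (simp add: zero_le_divide_iff)
  then consider "n = 0" | "1 \<le> n" by linarith
  then show ?thesis
  proof cases
    case 2
    then have "1 \<le> real_of_int n" by simp
    then have "1 / real m \<le> frac (x - a)" unfolding f by (intro divide_right_mono) auto
    then show ?thesis ..
  qed (use f in simp)
qed

text \<open>The first point of the coset at or after a left end would lie in the gap unless it is
  the left end itself.\<close>

lemma coset_leader:
  assumes \<sigma>: "\<sigma> \<in> gap_complex (\<lambda>_. 1 / real m) circle" and s: "0 \<le> s" "s < 1" "coset m s \<subseteq> \<sigma>"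
  obtains a where "a \<in> coset m s" "\<And>x. x \<in> \<sigma> \<Longrightarrow> frac (x - a) = 0 \<or> 1 / real m \<le> frac (x - a)"
proof -
  obtain a where a: "a \<in> \<sigma>" "\<And>x. x \<in> \<sigma> \<Longrightarrow> frac (x - a) = 0 \<or> 1 / real m \<le> frac (x - a)"
    using gap_leader[OF \<sigma>] m0 by auto
  have ac: "a \<in> circle" using a \<sigma> by (auto simp: gap_complex_def)
  define z where "z = frac (a + frac (s - real m * a) / real m)"
  have z: "z \<in> coset m s" "frac (z - a) = frac (s - real m * a) / real m"
    using next_in_coset[OF s(1,2), of a] by (simp_all add: z_def)
  have "frac (s - real m * a) / real m < 1 / real m"
    using m0 frac_lt_1[of "s - real m * a"] by (intro divide_strict_right_mono) auto
  then have "frac (z - a) = 0" using a(2)[of z] z s(3) by force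
  then have "z = a" using frac_diff_eq_0[of z a] z(1) ac by (auto simp: coset_def)
  then show ?thesis using that z(1) a(2) by blast
qed

text \<open>By the argument for \<open>coset_leader\<close>, the left end of the gap belongs to
  every full coset in the face, and cosets are disjoint.\<close>

lemma coset_unique:
  assumes \<sigma>: "\<sigma> \<in> gap_complex (\<lambda>_. 1 / real m) circle"
    and s: "0 \<le> s" "s < 1" "coset m s \<subseteq> \<sigma>" and s': "0 \<le> s'" "s' < 1" "coset m s' \<subseteq> \<sigma>"
  shows "s = s'"
proof -
  obtain a where a: "a \<in> coset m s" "\<And>x. x \<in> \<sigma> \<Longrightarrow> frac (x - a) = 0 \<or> 1 / real m \<le> frac (x - a)"
    using coset_leader[OF \<sigma> s] by blast
  have ac: "a \<in> circle" using a by (simp add: coset_def)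
  define z where "z = frac (a + frac (s' - real m * a) / real m)"
  have z: "z \<in> coset m s'" "frac (z - a) = frac (s' - real m * a) / real m"
    using next_in_coset[OF s'(1,2), of a] by (simp_all add: z_def)
  have "frac (s' - real m * a) / real m < 1 / real m"
    using m0 frac_lt_1[of "s' - real m * a"] by (intro divide_strict_right_mono) auto
  then have "frac (z - a) = 0" using a(2)[of z] z s'(3) by force
  then have "z = a" using frac_diff_eq_0[of z a] z(1) ac by (auto simp: coset_def)
  then show ?thesis using coset_disjoint a(1) z(1) by blast
qed

lemma arc_point_in_grid: "arc_point m s x \<in> grid m"
proof -
  have "real m * arc_point m s x = of_int (\<lfloor>real m * x - s\<rfloor> + 1
      - int m * \<lfloor>x - frac (real m * x - s) / real m + (1 - s) / real m\<rfloor>)"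
    using m0 by (simp add: arc_point_def frac_def field_simps)
  then have "frac (real m * arc_point m s x) = 0" by (metis frac_of_int)
  then show ?thesis unfolding grid_iff[OF m0(1)] by (simp add: arc_point_def frac_in_circle)
qed

text \<open>This fixed-point property makes the carriers below monotone on faces that already lie in
  the bouquet.\<close>

lemma arc_point_grid:
  assumes "x \<in> grid m" "0 < s" "s < 1"
  shows "arc_point m s x = x"
proof -
  have x: "x \<in> circle" "frac (real m * x) = 0" using assms grid_iff[OF m0(1)] by auto
  have "frac (real m * x - s) = 1 - s"
    using frac_diff[of "real m * x" s] x(2) assms by (simp add: frac_eq)
  then show ?thesis using frac_circle[OF x(1)] by (simp add: arc_point_def)
qed

text \<open>\<open>n\<close> counts the full arcs of the coset between \<open>a\<close> and
  \<open>x\<close>. Since \<open>n\<close> is at least 1, the arc of \<open>x\<close>, and with it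
  its grid point, lies beyond the gap.\<close>

lemma arc_point_free:
  assumes a: "a \<in> coset m s" and s: "0 < s" "s < 1" and x: "x \<in> circle" "x \<notin> coset m s"
    and f: "frac (x - a) = 0 \<or> 1 / real m \<le> frac (x - a)"
  shows "1 / real m \<le> frac (arc_point m s x - a)"
proof -
  define n where "n = \<lfloor>real m * frac (x - a)\<rfloor>"
  have ac: "a \<in> circle" "frac (real m * a) = s" using a by (auto simp: coset_def)
  have "frac (x - a) \<noteq> 0" using frac_diff_eq_0[OF x(1) ac(1)] x(2) a by blast
  then have "1 / real m \<le> frac (x - a)" using f by blast
  then have "1 \<le> real m * frac (x - a)" using m0 by (simp add: field_simps)
  then have n1: "1 \<le> n" unfolding n_def by linarith
  have "real m * frac (x - a) < real m" using m0 frac_lt_1[of "x - a"] by simp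
  then have nm: "of_int n < real m" unfolding n_def by linarith
  then have "real_of_int n < real_of_int (int m)" by simp
  then have "n \<le> int m - 1" by (simp only: of_int_less_iff)
  then have "real_of_int n \<le> real_of_int (int m - 1)" by (simp only: of_int_le_iff)
  then have nm': "of_int n \<le> real m - 1" by simp
  have e1: "frac (real m * x - s) = frac (real m * frac (x - a))"
  proof -
    have "real m * x - s = real m * frac (x - a) + of_int (\<lfloor>real m * a\<rfloor> + int m * \<lfloor>x - a\<rfloor>)"
      unfolding ac(2)[symmetric] by (simp add: frac_def algebra_simps)
    then show ?thesis by (metis frac_add_of_int)
  qed
  have "frac (arc_point m s x - a) = frac (x - frac (real m * x - s) / real m + (1 - s) / real m - a)"
    unfolding arc_point_def by (rule frac_diff_frac)
  also have "x - frac (real m * x - s) / real m + (1 - s) / real m - a = (of_int n + 1 - s) / real m + of_int \<lfloor>x - a\<rfloor>"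
    unfolding e1 using m0 by (simp add: frac_def n_def field_simps)
  also have "frac \<dots> = frac ((of_int n + 1 - s) / real m)" by (rule frac_add_of_int)
  also have "\<dots> = (of_int n + 1 - s) / real m"
    using n1 nm' s m0 by (simp add: frac_eq field_simps)
  finally have "frac (arc_point m s x - a) = (of_int n + 1 - s) / real m" .
  moreover have "1 \<le> of_int n + 1 - s" using n1 s by simp
  ultimately show ?thesis using m0 by (simp add: divide_right_mono)
qed

text \<open>The gap is one arc between neighbours of the coset, and no point of the face lies inside
  it. So adding grid points in occupied arcs keeps the gap, and the grid point in the empty arc is
  never added.\<close>

lemma add_arc_points:
  assumes \<sigma>: "\<sigma> \<in> gap_complex (\<lambda>_. 1 / real m) circle" and s: "0 < s" "s < 1" "coset m s \<subseteq> \<sigma>"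
  shows "\<sigma> \<union> arc_point m s ` (\<sigma> - coset m s) \<in> gap_complex (\<lambda>_. 1 / real m) circle"
    and "\<not> grid m \<subseteq> arc_point m s ` (\<sigma> - coset m s)"
proof -
  obtain a where a: "a \<in> coset m s" "\<And>x. x \<in> \<sigma> \<Longrightarrow> frac (x - a) = 0 \<or> 1 / real m \<le> frac (x - a)"
    using coset_leader[OF \<sigma> less_imp_le[OF s(1)] s(2,3)] by blast
  have \<sigma>': "\<sigma> \<subseteq> circle" "finite \<sigma>" "\<sigma> \<noteq> {}" using \<sigma> by (auto simp: gap_complex_def)
  have arc: "1 / real m \<le> frac (y - a)" if "y \<in> arc_point m s ` (\<sigma> - coset m s)" for y
    using that arc_point_free[OF a(1) s(1,2)] a(2) \<sigma>' by blast
  show "\<sigma> \<union> arc_point m s ` (\<sigma> - coset m s) \<in> gap_complex (\<lambda>_. 1 / real m) circle"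
  proof (rule gap_complexI[of _ _ a])
    show "\<sigma> \<union> arc_point m s ` (\<sigma> - coset m s) \<subseteq> circle"
      using \<sigma>' by (auto simp: arc_point_def frac_in_circle)
  qed (use \<sigma>' a arc in \<open>auto simp: coset_def\<close>)
  define z where "z = frac (a + frac (0 - real m * a) / real m)"
  have z: "z \<in> coset m 0" "frac (z - a) = frac (0 - real m * a) / real m"
    using next_in_coset[of 0 a] by (simp_all add: z_def)
  have "frac (0 - real m * a) / real m < 1 / real m"
    using m0 frac_lt_1[of "0 - real m * a"] by (intro divide_strict_right_mono) auto
  then have "z \<notin> arc_point m s ` (\<sigma> - coset m s)" using arc[of z] z(2) by linarith
  then show "\<not> grid m \<subseteq> arc_point m s ` (\<sigma> - coset m s)" using z(1) grid_coset by blast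
qed

text \<open>Rounding with \<open>p = 1\<close>: the orbits of the step \<open>1 / m\<close> are the
  cosets, so \<open>coset_free\<close> is the orbit hypothesis.\<close>

lemma contractible_gap_with_grid:
  assumes X: "finite X" "X \<subseteq> circle" "grid m \<subseteq> X" "coset_free m X"
  shows "contractible_complex (gap_complex (\<lambda>_. 1 / real m) X)"
proof -
  have "contractible_complex (gap_complex (\<lambda>_. real 1 / real m) X)"
  proof (rule contractible_grid_rounding)
    show "grid_floor m ` X \<subseteq> X" using grid_floor_in_grid[OF m0(1)] X by blast
    show "\<exists>k::nat. frac (y - real k * (real 1 / real m)) \<notin> X" if y: "y \<in> X" "frac (real m * y) \<noteq> 0" for y
    proof (rule ccontr)
      assume neg: "\<not> ?thesis"
      have "coset m (frac (real m * y)) \<subseteq> X"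
      proof
        fix z assume "z \<in> coset m (frac (real m * y))"
        then have z: "z \<in> circle" "frac (real m * y) = frac (real m * z)" by (auto simp: coset_def)
        have yc: "y \<in> circle" using y X by blast
        obtain k :: nat where k: "y = frac (z + real k * (1 / real m))"
          using same_offset_orbit[OF m0(1) yc z(2)] by blast
        have "frac (y - real k * (1 / real m)) = frac z"
          unfolding k frac_diff_frac by simp
        then have "frac (y - real k * (1 / real m)) = z" using frac_circle[OF z(1)] by simp
        then show "z \<in> X" using neg by (metis of_nat_1)
      qed
      moreover have "frac (real m * y) \<in> {0<..<1}"
        using y(2) frac_ge_0[of "real m * y"] frac_lt_1[of "real m * y"] by (simp add: less_le)
      ultimately show False using X(4) by (auto simp: coset_free_def)
    qed
    have "{x \<in> X. frac (real m * x) = 0} = grid m" using X grid_iff[OF m0(1)] by blast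
    moreover have "grid m \<in> gap_complex (\<lambda>_. 1 / real m) circle"
    proof (rule gap_complexI[of _ _ 0])
      show "grid m \<noteq> {}" using coset_nonempty[of 0] by (simp add: grid_coset)
      have 0: "0 \<in> coset m 0" by (simp add: coset_def circle_def)
      show "frac (x - 0) = 0 \<or> 1 / real m \<le> frac (x - 0)" if "x \<in> grid m" for x
        using frac_coset_diff[OF _ 0] that by (simp add: grid_coset)
    qed (use coset_sub_circle in \<open>auto simp: finite_coset circle_def grid_coset\<close>)
    then have "gap_complex (\<lambda>_. 1 / real m) (grid m) = all_faces (grid m)" by (rule gap_complex_full)
    ultimately show "contractible_complex (gap_complex (\<lambda>_. real 1 / real m) {x \<in> X. frac (real m * x) = 0})"
      using contractible_all_faces[OF finite_grid[of m]] coset_nonempty[of 0] by (simp add: grid_coset)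
  qed (use X m in auto)
  then show ?thesis by simp
qed

section \<open>The bouquet inside the gap complex\<close>

lemma abstract_complex_bouquet: "abstract_complex (sphere_bouquet m)"
proof (rule abstract_complexI)
  fix \<sigma> \<tau> assume "\<sigma> \<in> sphere_bouquet m" "\<tau> \<subseteq> \<sigma>" "\<tau> \<noteq> {}"
  then show "\<tau> \<in> sphere_bouquet m" unfolding sphere_bouquet_def by blast
next
  fix \<sigma> assume "\<sigma> \<in> sphere_bouquet m"
  then obtain s where "\<sigma> \<subset> coset m s \<union> grid m" by (auto simp: sphere_bouquet_def)
  then show "finite \<sigma>" by (meson finite_UnI finite_coset finite_grid finite_subset psubset_imp_subset)
qed (simp add: sphere_bouquet_def)

text \<open>The \<open>2 * m\<close> points of the coset and the grid alternate around the circle. A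
  proper subset misses the successor of one of its points \<open>a\<close>, and that successor is
  the only one of the points strictly between \<open>a\<close> and \<open>a + 1/m\<close>.\<close>

lemma bouquet_sub_gap: "sphere_bouquet m \<subseteq> gap_complex (\<lambda>_. 1 / real m) circle"
proof
  fix \<rho> assume \<rho>: "\<rho> \<in> sphere_bouquet m"
  then obtain s where "s \<in> {0<..<1}" and sub: "\<rho> \<subset> coset m s \<union> grid m" and ne: "\<rho> \<noteq> {}"
    unfolding sphere_bouquet_def by blast
  then have s: "0 < s" "s < 1" by auto
  \<comment> \<open>The cyclic successor among the \<open>2 * m\<close> points. Two applications
    make the step \<open>1 / m\<close>, so a non-empty set closed under \<open>h\<close> contains
    both cosets.\<close>
  define h where "h a = (if a \<in> grid m then frac (a + s / real m) else frac (a + (1 - s) / real m))" for a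
  have rc: "\<rho> \<subseteq> circle" using sub coset_sub_circle grid_coset by blast
  have shift: "frac (real m * frac (a + u / real m)) = frac (frac (real m * a) + u)" for a u
  proof -
    have "real m * frac (a + u / real m) = frac (real m * a) + u + of_int (\<lfloor>real m * a\<rfloor> - int m * \<lfloor>a + u / real m\<rfloor>)"
      using m0 by (simp add: frac_def field_simps)
    then show ?thesis by (metis frac_add_of_int)
  qed
  have h_grid: "h a \<in> coset m s" if "a \<in> grid m" for a
    using that shift[of a s] s grid_iff[OF m0(1)] by (simp add: h_def coset_def frac_in_circle frac_eq)
  have h_coset: "h a \<in> grid m" if "a \<in> coset m s" for a
  proof -
    have "a \<notin> grid m" using that s coset_disjoint[of a s 0] by (auto simp: grid_coset)
    then show ?thesis
      using that shift[of a "1 - s"] grid_iff[OF m0(1)] by (simp add: h_def coset_def frac_in_circle)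
  qed
  have h2: "frac (a + 1 / real m) = h (h a)" if as: "a \<in> coset m s \<union> grid m" for a
  proof -
    have fr: "frac (frac x + y) = frac (x + y)" for x y using frac_diff_frac[of x "- y"] by simp
    have sum: "a + s / real m + (1 - s) / real m = a + 1 / real m" "a + (1 - s) / real m + s / real m = a + 1 / real m"
      using m0 by (simp_all add: field_simps)
    consider "a \<in> grid m" | "a \<in> coset m s" "a \<notin> grid m" using as by blast
    then show ?thesis
    proof cases
      case 1
      then have "h a \<notin> grid m" using h_grid[OF 1] s coset_disjoint[of "h a" s 0] by (auto simp: grid_coset)
      then have "h (h a) = frac (a + s / real m + (1 - s) / real m)" using 1 fr by (simp add: h_def)
      then show ?thesis by (simp only: sum)
    next
      case 2
      then have "h (h a) = frac (a + (1 - s) / real m + s / real m)" using h_coset[OF 2(1)] fr by (simp add: h_def)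
      then show ?thesis by (simp only: sum)
    qed
  qed
  have "\<exists>a\<in>\<rho>. h a \<notin> \<rho>"
  proof (rule ccontr)
    assume "\<not> ?thesis"
    then have hc: "\<And>a. a \<in> \<rho> \<Longrightarrow> h a \<in> \<rho>" by blast
    have step: "frac (a + 1 / real m) \<in> \<rho>" if "a \<in> \<rho>" for a
      using h2[of a] hc[OF hc[OF that]] that sub by auto
    have full: "coset m u \<subseteq> \<rho>" if "a \<in> \<rho>" "a \<in> coset m u" for a u
    proof
      fix z assume "z \<in> coset m u"
      then have z: "z \<in> circle" "frac (real m * z) = frac (real m * a)" using that by (auto simp: coset_def)
      obtain k :: nat where "z = frac (a + real k * (1 / real m))"
        using same_offset_orbit[OF m0(1) z] by blast
      then show "z \<in> \<rho>" using step_closed_imp_orbit[OF that(1) rc step] by blast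
    qed
    obtain a where a: "a \<in> \<rho>" using ne by blast
    have "coset m s \<subseteq> \<rho> \<and> coset m 0 \<subseteq> \<rho>"
    proof (cases "a \<in> grid m")
      case True
      then show ?thesis using full[OF a, of 0] full[OF hc[OF a], of s] h_grid grid_coset by blast
    next
      case False
      then have "a \<in> coset m s" using a sub by blast
      then show ?thesis using full[OF a, of s] full[OF hc[OF a], of 0] h_coset grid_coset by blast
    qed
    then show False using sub grid_coset by blast
  qed
  then obtain a where a: "a \<in> \<rho>" "h a \<notin> \<rho>" by blast
  show "\<rho> \<in> gap_complex (\<lambda>_. 1 / real m) circle"
  proof (rule gap_complexI[of _ _ a])
    fix x assume x: "x \<in> \<rho>"
    show "frac (x - a) = 0 \<or> 1 / real m \<le> frac (x - a)"
    proof (rule ccontr)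
      assume neg: "\<not> ?thesis"
      define f where "f = real m * frac (x - a)"
      have "0 < frac (x - a)" "frac (x - a) < 1 / real m" using neg frac_ge_0[of "x - a"] by linarith+
      then have f: "0 < f" "f < 1" using m0 by (simp_all add: f_def field_simps)
      have fx: "frac (x - a) = f / real m" using m0 by (simp add: f_def)
      have "a + f / real m = x + of_int (- \<lfloor>x - a\<rfloor>)" unfolding fx[symmetric] by (simp add: frac_def)
      then have "frac (a + f / real m) = frac x" by (metis frac_add_of_int)
      then have xf: "x = frac (a + f / real m)" using x rc frac_circle by auto
      have fm: "frac (real m * x) = frac (frac (real m * a) + f)" unfolding xf by (rule shift)
      have "frac (real m * x) = 0 \<or> frac (real m * x) = s" using x sub by (auto simp: grid_coset coset_def)
      note off = this
      consider "a \<in> grid m" | "a \<in> coset m s" "a \<notin> grid m" using a sub by blast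
      then show False
      proof cases
        case 1
        then have "frac (real m * x) = f" using fm f grid_iff[OF m0(1)] by (simp add: frac_eq)
        then have "f = s" using off f by auto
        then show False using xf 1 a x by (simp add: h_def)
      next
        case 2
        then have fs: "frac (real m * x) = frac (s + f)" using fm by (simp add: coset_def)
        have "frac (s + f) = (if s + f < 1 then s + f else s + f - 1)"
          using frac_add[of s f] s f by (simp add: frac_eq)
        then have "f = 1 - s" using fs off f s by (auto split: if_splits)
        then show False using xf 2 a x by (simp add: h_def)
      qed
    qed
  qed (use rc ne a abstract_complexD(1)[OF abstract_complex_bouquet \<rho>] in auto)
qed

lemma coset_free_insert_grid:
  assumes "coset_free m \<rho>" "z \<in> grid m"
  shows "coset_free m (insert z \<rho>)"
  unfolding coset_free_def
proof (intro ballI notI)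
  fix s assume s: "s \<in> {0<..<1}" "coset m s \<subseteq> insert z \<rho>"
  then have "z \<notin> coset m s" using assms(2) coset_disjoint[of z s 0] by (auto simp: grid_coset)
  then show False using s assms(1) by (auto simp: coset_free_def)
qed

text \<open>A coset-free face misses a point of the coset and not only of the grid, so it stays
  proper when grid points are added. This makes the complexes \<open>Q \<sigma>\<close> below
  cones.\<close>

lemma bouquet_insert_grid:
  assumes "\<rho> \<in> sphere_bouquet m" "coset_free m \<rho>" "z \<in> grid m"
  shows "insert z \<rho> \<in> sphere_bouquet m"
proof -
  obtain s where s: "s \<in> {0<..<1}" "\<rho> \<subset> coset m s \<union> grid m" using assms(1) unfolding sphere_bouquet_def by blast
  have "\<not> coset m s \<subseteq> insert z \<rho>" using coset_free_insert_grid[OF assms(2,3)] s by (auto simp: coset_free_def)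
  then have "insert z \<rho> \<subset> coset m s \<union> grid m" using s assms(3) by blast
  then show ?thesis using s by (auto simp: sphere_bouquet_def)
qed

text \<open>Coset-free faces are handled by rounding down inside \<open>Q \<sigma>\<close> and
  \<open>R \<sigma>\<close>. A face with a full coset needs one more simplex, formed with its arc
  points \<open>A \<sigma>\<close>; it is glued on along a cone whose apex is one of these arc
  points.\<close>

theorem bouquet_gap_equivalence:
  "homotopy_equivalence_map (realization (sphere_bouquet m)) (realization (gap_complex (\<lambda>_. 1 / real m) circle)) id"
proof -
  define C where "C = gap_complex (\<lambda>_. 1 / real m) circle"
  define W where "W = sphere_bouquet m"
  have C: "abstract_complex C" by (simp add: C_def abstract_complex_gap)
  have W: "abstract_complex W" by (simp add: W_def abstract_complex_bouquet)
  have WC: "W \<subseteq> C" unfolding W_def C_def by (rule bouquet_sub_gap)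
  have z0: "0 \<in> grid m" using m0 by (auto simp: grid_iff circle_def)
  define Q where "Q \<sigma> = {\<rho> \<in> W. \<rho> \<subseteq> \<sigma> \<union> grid m \<and> coset_free m \<rho>}" for \<sigma>
  define R where "R \<sigma> = {\<rho> \<in> C. \<rho> \<subseteq> \<sigma> \<union> grid m \<and> coset_free m \<rho>}" for \<sigma>
  \<comment> \<open>By \<open>coset_unique\<close> at most one coset can be chosen for a face of
    \<open>C\<close>, so \<open>co\<close> does not change when a face with a full coset is
    enlarged.\<close>
  define co where "co \<sigma> = (SOME s. 0 < s \<and> s < 1 \<and> coset m s \<subseteq> \<sigma>)" for \<sigma>
  define A where "A \<sigma> = arc_point m (co \<sigma>) ` (\<sigma> - coset m (co \<sigma>))" for \<sigma>
  define \<Psi> where "\<Psi> \<sigma> = (if \<sigma> \<in> W then all_faces \<sigma> else if coset_free m \<sigma> then Q \<sigma>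
      else Q \<sigma> \<union> all_faces (coset m (co \<sigma>) \<union> A \<sigma>))" for \<sigma>
  define \<Theta> where "\<Theta> \<sigma> = (if \<sigma> \<in> W then all_faces \<sigma> else if coset_free m \<sigma> then R \<sigma>
      else R \<sigma> \<union> all_faces (\<sigma> \<union> A \<sigma>))" for \<sigma>
  have sub: "\<sigma> \<subseteq> circle" "finite \<sigma>" "\<sigma> \<noteq> {}" if "\<sigma> \<in> C" for \<sigma> using that by (auto simp: C_def gap_complex_def)
  have free_sub: "coset_free m \<tau>" if "coset_free m \<sigma>" "\<tau> \<subseteq> \<sigma>" for \<sigma> \<tau>
    using that unfolding coset_free_def by blast
  have co: "0 < co \<sigma>" "co \<sigma> < 1" "coset m (co \<sigma>) \<subseteq> \<sigma>" if "\<not> coset_free m \<sigma>" for \<sigma>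
  proof -
    have "\<exists>s. 0 < s \<and> s < 1 \<and> coset m s \<subseteq> \<sigma>" using that by (auto simp: coset_free_def)
    from someI_ex[OF this] show "0 < co \<sigma>" "co \<sigma> < 1" "coset m (co \<sigma>) \<subseteq> \<sigma>" by (auto simp: co_def)
  qed
  have co_eq: "s = co \<sigma>" if "\<sigma> \<in> C" "0 < s" "s < 1" "coset m s \<subseteq> \<sigma>" for \<sigma> s
  proof -
    have "\<not> coset_free m \<sigma>" using that by (auto simp: coset_free_def)
    from co[OF this] show ?thesis
      using coset_unique[OF that(1)[unfolded C_def]] that by (meson less_imp_le)
  qed
  have A_grid: "A \<sigma> \<subseteq> grid m" for \<sigma> using arc_point_in_grid by (auto simp: A_def)
  have AC: "\<sigma> \<union> A \<sigma> \<in> C" and Apr: "\<not> grid m \<subseteq> A \<sigma>" if "\<sigma> \<in> C" "\<not> coset_free m \<sigma>" for \<sigma>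
    using add_arc_points[OF that(1)[unfolded C_def] co[OF that(2)]] by (simp_all add: A_def C_def)
  have AW: "coset m (co \<sigma>) \<union> A \<sigma> \<in> W" if \<sigma>: "\<sigma> \<in> C" "\<not> coset_free m \<sigma>" for \<sigma>
  proof -
    obtain z where z: "z \<in> grid m" "z \<notin> A \<sigma>" using Apr[OF \<sigma>] by blast
    have "z \<notin> coset m (co \<sigma>)" using z co[OF \<sigma>(2)] coset_disjoint[of z "co \<sigma>" 0] by (auto simp: grid_coset)
    then have "coset m (co \<sigma>) \<union> A \<sigma> \<subset> coset m (co \<sigma>) \<union> grid m" using z A_grid by blast
    moreover have "coset m (co \<sigma>) \<noteq> {}" using co[OF that(2)] coset_nonempty by simp
    ultimately show ?thesis using co[OF that(2)] by (auto simp: W_def sphere_bouquet_def)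
  qed
  \<comment> \<open>A point of \<open>A \<sigma>\<close> is the apex along which the extra simplex
    is glued. It is missing only when \<open>\<sigma>\<close> is the coset itself, which already
    lies in \<open>W\<close>.\<close>
  have Ane: "A \<sigma> \<noteq> {}" if "\<sigma> \<in> C" "\<sigma> \<notin> W" "\<not> coset_free m \<sigma>" for \<sigma>
  proof
    assume "A \<sigma> = {}"
    then have "\<sigma> = coset m (co \<sigma>)" using co[OF that(3)] by (auto simp: A_def)
    then show False using AW[OF that(1,3)] \<open>A \<sigma> = {}\<close> that(2) by simp
  qed
  have Qc: "abstract_complex (Q \<sigma>)" for \<sigma>
    unfolding Q_def by (rule abstract_complex_filter[OF W]) (use free_sub in blast)
  have Rc: "abstract_complex (R \<sigma>)" for \<sigma>
    unfolding R_def by (rule abstract_complex_filter[OF C]) (use free_sub in blast)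
  have ins_Q: "insert z \<rho> \<in> Q \<sigma>" if "\<rho> \<in> Q \<sigma>" "z \<in> grid m" for z \<rho> \<sigma>
    using that bouquet_insert_grid coset_free_insert_grid by (auto simp: Q_def W_def)
  have free_z: "coset_free m {z}" if "z \<in> grid m" for z
    using coset_free_insert_grid[OF _ that, of "{}"] coset_nonempty by (auto simp: coset_free_def)
  have zW: "{z} \<in> W" if "z \<in> grid m" for z
  proof -
    have "z \<notin> coset m (1/2)" using that coset_disjoint[of z "1/2" 0] by (auto simp: grid_coset)
    then have "{z} \<subset> coset m (1/2) \<union> grid m" using that coset_nonempty[of "1/2"] by auto
    then show ?thesis unfolding W_def sphere_bouquet_def by (auto intro!: bexI[of _ "1/2"])
  qed
  have zQ: "{z} \<in> Q \<sigma>" if "z \<in> grid m" for z \<sigma>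
    using zW[OF that] free_z[OF that] that by (simp add: Q_def)
  have Q_contr: "contractible_complex (Q \<sigma>)" for \<sigma>
    by (rule contractible_cone[OF Qc, of _ 0]) (use zQ[OF z0, of \<sigma>] ins_Q z0 in blast)+
  have R_free: "R \<sigma> = gap_complex (\<lambda>_. 1 / real m) (\<sigma> \<union> grid m)" if "\<sigma> \<in> C" "coset_free m (\<sigma> \<union> grid m)" for \<sigma>
    using free_sub[OF that(2)] sub[OF that(1)] grid_iff[OF m0(1)] by (auto simp: R_def C_def gap_complex_def)
  have free_grid: "coset_free m (X \<union> grid m)" if "coset_free m X" for X
    unfolding coset_free_def
  proof (intro ballI notI)
    fix s assume s: "s \<in> {0<..<1}" "coset m s \<subseteq> X \<union> grid m"
    then have "coset m s \<inter> grid m = {}" using coset_disjoint[of _ s 0] by (auto simp: grid_coset)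
    then show False using s that unfolding coset_free_def by blast
  qed
  have R_contr: "contractible_complex (R \<sigma>)" if \<sigma>: "\<sigma> \<in> C" for \<sigma>
  proof (cases "coset_free m \<sigma>")
    case True
    then show ?thesis
      unfolding R_free[OF \<sigma> free_grid[OF True]]
      using sub[OF \<sigma>] finite_grid grid_iff[OF m0(1)] free_grid by (intro contractible_gap_with_grid) auto
  next
    case False
    let ?c = "coset m (co \<sigma>)"
    \<comment> \<open>Here the vertex set contains the full coset \<open>?c\<close>, so rounding
      does not apply to it. Deleting the points of \<open>?c\<close> outside the coset-free face
      \<open>\<rho>\<close> leaves a coset-free set that contains \<open>\<rho>\<close> and the grid
      and grows with \<open>\<rho>\<close>.\<close>
    define \<Phi> where "\<Phi> \<rho> = gap_complex (\<lambda>_. 1 / real m) ((\<sigma> \<union> grid m) - (?c - \<rho>))" for \<rho>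
    have Xc: "(\<sigma> \<union> grid m) - (?c - \<rho>) \<subseteq> circle" for \<rho> using sub[OF \<sigma>] grid_iff[OF m0(1)] by blast
    have cg: "?c \<inter> grid m = {}" using co[OF False] coset_disjoint[of _ "co \<sigma>" 0] by (auto simp: grid_coset)
    have fr: "coset_free m ((\<sigma> \<union> grid m) - (?c - \<rho>))" if "coset_free m \<rho>" for \<rho>
      unfolding coset_free_def
    proof (intro ballI notI)
      fix s assume s: "s \<in> {0<..<1}" "coset m s \<subseteq> (\<sigma> \<union> grid m) - (?c - \<rho>)"
      then have "coset m s \<inter> grid m = {}" using coset_disjoint[of _ s 0] by (auto simp: grid_coset)
      then have "coset m s \<subseteq> \<sigma>" using s by blast
      then have "s = co \<sigma>" using co_eq[OF \<sigma>] s by auto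
      then have "?c \<subseteq> \<rho>" using s by blast
      then show False using that s \<open>s = co \<sigma>\<close> by (auto simp: coset_free_def)
    qed
    show ?thesis
    proof (rule contractible_complex_carrier[OF Rc, of _ \<Phi> 0])
      have "{0} \<in> R \<sigma>" using zQ[OF z0, of \<sigma>] WC by (auto simp: Q_def R_def)
      then show "R \<sigma> \<noteq> {}" by blast
      fix \<rho> assume \<rho>: "\<rho> \<in> R \<sigma>"
      have fr\<rho>: "coset_free m \<rho>" using \<rho> by (simp add: R_def)
      show "contractible_complex (\<Phi> \<rho>)"
        unfolding \<Phi>_def using sub[OF \<sigma>] finite_grid Xc fr[OF fr\<rho>] cg
        by (intro contractible_gap_with_grid) auto
      show "\<Phi> \<rho> \<subseteq> R \<sigma>"
      proof
        fix \<tau> assume \<tau>: "\<tau> \<in> \<Phi> \<rho>"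
        then have "\<tau> \<subseteq> (\<sigma> \<union> grid m) - (?c - \<rho>)" by (simp add: \<Phi>_def gap_complex_def)
        moreover have "\<tau> \<in> C" using \<tau> gap_complex_mono[OF Xc] by (auto simp: \<Phi>_def C_def)
        ultimately show "\<tau> \<in> R \<sigma>" using free_sub[OF fr[OF fr\<rho>]] by (auto simp: R_def)
      qed
      show "\<rho> \<in> \<Phi> \<rho>" using \<rho> by (auto simp: \<Phi>_def R_def C_def gap_complex_def)
      have "{0} \<in> C" using zW[OF z0] WC by blast
      then show "{0} \<in> \<Phi> \<rho>" using z0 cg by (auto simp: \<Phi>_def C_def gap_complex_def)
      fix \<tau> assume "\<tau> \<subseteq> \<rho>"
      then show "\<Phi> \<tau> \<subseteq> \<Phi> \<rho>" unfolding \<Phi>_def by (intro gap_complex_mono) blast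
    qed
  qed
  have faces: "all_faces \<sigma> \<subseteq> L" if "abstract_complex L" "\<sigma> \<in> L" for \<sigma> :: "real set" and L
    using abstract_complexD(3)[OF that] by (auto simp: all_faces_def)
  have fin_A: "finite (\<sigma> \<union> A \<sigma>)" "finite (coset m (co \<sigma>) \<union> A \<sigma>)" if "\<sigma> \<in> C" for \<sigma>
    using sub[OF that] finite_coset by (auto simp: A_def)
  have \<Psi>_contr: "contractible_complex (\<Psi> \<sigma>)" and \<Theta>_contr: "contractible_complex (\<Theta> \<sigma>)" if \<sigma>: "\<sigma> \<in> C" for \<sigma>
  proof -
    have 1: "contractible_complex (Q \<sigma> \<union> all_faces (coset m (co \<sigma>) \<union> A \<sigma>))"
      and 2: "contractible_complex (R \<sigma> \<union> all_faces (\<sigma> \<union> A \<sigma>))" if nW: "\<sigma> \<notin> W" "\<not> coset_free m \<sigma>"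
    proof -
      obtain z where z: "z \<in> A \<sigma>" "z \<in> grid m" using Ane[OF \<sigma> nW] A_grid by blast
      show "contractible_complex (Q \<sigma> \<union> all_faces (coset m (co \<sigma>) \<union> A \<sigma>))"
      proof (rule contractible_union[OF Q_contr contractible_all_faces])
        show "contractible_complex (Q \<sigma> \<inter> all_faces (coset m (co \<sigma>) \<union> A \<sigma>))"
        proof (rule contractible_cone[of _ z])
          show "abstract_complex (Q \<sigma> \<inter> all_faces (coset m (co \<sigma>) \<union> A \<sigma>))"
            by (intro abstract_complex_Int Qc abstract_complex_all_faces fin_A \<sigma>)
          have "{z} \<in> Q \<sigma> \<inter> all_faces (coset m (co \<sigma>) \<union> A \<sigma>)" using zQ z by (auto simp: all_faces_def)
          then show "Q \<sigma> \<inter> all_faces (coset m (co \<sigma>) \<union> A \<sigma>) \<noteq> {}" by blast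
        qed (use ins_Q z in \<open>auto simp: all_faces_def\<close>)
      qed (use fin_A[OF \<sigma>] z in auto)
      show "contractible_complex (R \<sigma> \<union> all_faces (\<sigma> \<union> A \<sigma>))"
      proof (rule contractible_union[OF R_contr[OF \<sigma>] contractible_all_faces])
        show "contractible_complex (R \<sigma> \<inter> all_faces (\<sigma> \<union> A \<sigma>))"
        proof (rule contractible_cone[of _ z])
          show "abstract_complex (R \<sigma> \<inter> all_faces (\<sigma> \<union> A \<sigma>))"
            by (intro abstract_complex_Int Rc abstract_complex_all_faces fin_A \<sigma>)
          have "{z} \<in> R \<sigma> \<inter> all_faces (\<sigma> \<union> A \<sigma>)"
            using zQ[OF z(2), of \<sigma>] WC z by (auto simp: all_faces_def Q_def R_def)
          then show "R \<sigma> \<inter> all_faces (\<sigma> \<union> A \<sigma>) \<noteq> {}" by blast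
          fix \<rho> assume \<rho>: "\<rho> \<in> R \<sigma> \<inter> all_faces (\<sigma> \<union> A \<sigma>)"
          have af: "insert z \<rho> \<in> all_faces (\<sigma> \<union> A \<sigma>)" using \<rho> z by (auto simp: all_faces_def)
          then have "insert z \<rho> \<in> C" using faces[OF C AC[OF \<sigma> nW(2)]] by blast
          then show "insert z \<rho> \<in> R \<sigma> \<inter> all_faces (\<sigma> \<union> A \<sigma>)"
            using af \<rho> z coset_free_insert_grid by (auto simp: R_def)
        qed
      qed (use fin_A[OF \<sigma>] z in auto)
    qed
    show "contractible_complex (\<Psi> \<sigma>)"
      using 1 Q_contr contractible_all_faces[OF sub(2,3)[OF \<sigma>]] by (simp add: \<Psi>_def)
    show "contractible_complex (\<Theta> \<sigma>)"
      using 2 R_contr[OF \<sigma>] contractible_all_faces[OF sub(2,3)[OF \<sigma>]] by (simp add: \<Theta>_def)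
  qed
  have QR: "Q \<sigma> \<subseteq> R \<sigma>" for \<sigma> using WC by (auto simp: Q_def R_def)
  have "homotopy_equivalence_map (realization W) (realization C) id"
  proof (rule inclusion_homotopy_equivalence[OF C W WC, of \<Psi> \<Theta>])
    fix \<sigma> assume \<sigma>: "\<sigma> \<in> C"
    show "contractible_complex (\<Psi> \<sigma>)" by (rule \<Psi>_contr[OF \<sigma>])
    show "contractible_complex (\<Theta> \<sigma>)" by (rule \<Theta>_contr[OF \<sigma>])
    show "\<Psi> \<sigma> \<subseteq> W"
      using faces[OF W, of \<sigma>] faces[OF W AW[OF \<sigma>]] by (auto simp: \<Psi>_def Q_def)
    show "\<Theta> \<sigma> \<subseteq> C"
      using faces[OF C \<sigma>] faces[OF C AC[OF \<sigma>]] by (auto simp: \<Theta>_def R_def)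
    show "\<sigma> \<in> \<Theta> \<sigma>" using \<sigma> sub[OF \<sigma>] by (auto simp: \<Theta>_def R_def all_faces_def)
    show "\<Psi> \<sigma> \<subseteq> \<Theta> \<sigma>"
    proof -
      have "all_faces (coset m (co \<sigma>) \<union> A \<sigma>) \<subseteq> all_faces (\<sigma> \<union> A \<sigma>)" if "\<not> coset_free m \<sigma>"
        using co(3)[OF that] by (auto simp: all_faces_def)
      then show ?thesis using QR[of \<sigma>] by (auto simp: \<Psi>_def \<Theta>_def)
    qed
    fix \<tau> assume \<tau>: "\<tau> \<in> C" "\<tau> \<subseteq> \<sigma>"
    have W\<tau>: "\<tau> \<in> W" if "\<sigma> \<in> W" using abstract_complexD(3)[OF W that \<tau>(2)] sub(3)[OF \<tau>(1)] by blast
    have af: "all_faces \<tau> \<subseteq> all_faces \<sigma>" using \<tau> by (auto simp: all_faces_def)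
    have Q\<tau>: "Q \<tau> \<subseteq> Q \<sigma>" "R \<tau> \<subseteq> R \<sigma>" using \<tau> by (auto simp: Q_def R_def)
    have free\<tau>: "coset_free m \<tau>" if "coset_free m \<sigma>" using free_sub[OF that \<tau>(2)] .
    have co\<tau>: "co \<tau> = co \<sigma>" "A \<tau> \<subseteq> A \<sigma>" if "\<not> coset_free m \<tau>"
    proof -
      show "co \<tau> = co \<sigma>" using co_eq[OF \<sigma>] co[OF that] \<tau>(2) by blast
      then show "A \<tau> \<subseteq> A \<sigma>" using \<tau>(2) unfolding A_def by auto
    qed
    \<comment> \<open>The delicate case of monotonicity. A face in the bouquet that contains a full
      coset has all its other points on the grid, where \<open>arc_point\<close> is the identity; so
      it lies in the extra simplex attached to \<open>\<sigma>\<close>.\<close>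
    have W_faces: "\<rho> \<in> Q \<sigma> \<or> (\<not> coset_free m \<sigma> \<and> \<rho> \<subseteq> coset m (co \<sigma>) \<union> A \<sigma>)"
      if \<rho>: "\<rho> \<in> all_faces \<tau>" and "\<tau> \<in> W" for \<rho>
    proof -
      have \<rho>W: "\<rho> \<in> W" using faces[OF W \<open>\<tau> \<in> W\<close>] \<rho> by blast
      have \<rho>\<sigma>: "\<rho> \<subseteq> \<sigma>" using \<rho> \<tau> by (auto simp: all_faces_def)
      show ?thesis
      proof (cases "coset_free m \<rho>")
        case True
        then show ?thesis using \<rho>W \<rho>\<sigma> by (auto simp: Q_def)
      next
        case False
        have nf: "\<not> coset_free m \<sigma>" using free_sub[OF _ \<rho>\<sigma>] False by blast
        obtain s where s: "s \<in> {0<..<1}" "\<rho> \<subseteq> coset m s \<union> grid m" using \<rho>W unfolding W_def sphere_bouquet_def by blast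
        have c: "co \<rho> = co \<sigma>" using co_eq[OF \<sigma>] co[OF False] \<rho>\<sigma> by blast
        have cs: "co \<rho> = s"
          using coset_sub_coset[of "co \<rho>" s] co[OF False] s by auto
        have "x \<in> coset m (co \<sigma>) \<union> A \<sigma>" if "x \<in> \<rho>" for x
        proof (cases "x \<in> coset m (co \<sigma>)")
          case xn: False
          then have "x \<in> grid m" using that s cs c by auto
          then have "arc_point m (co \<sigma>) x = x" using arc_point_grid co[OF nf] by blast
          moreover have "x \<in> \<sigma> - coset m (co \<sigma>)" using that \<rho>\<sigma> xn by blast
          ultimately have "x \<in> A \<sigma>" unfolding A_def by force
          then show ?thesis by blast
        qed blast
        then show ?thesis using nf by blast
      qed
    qed
    show "\<Psi> \<tau> \<subseteq> \<Psi> \<sigma>"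
    proof (cases "\<sigma> \<in> W")
      case True
      then show ?thesis using W\<tau> af by (simp add: \<Psi>_def)
    next
      case nW: False
      show ?thesis
      proof (cases "\<tau> \<in> W")
        case True
        show ?thesis
        proof
          fix \<rho> assume "\<rho> \<in> \<Psi> \<tau>"
          then have \<rho>: "\<rho> \<in> all_faces \<tau>" using True by (simp add: \<Psi>_def)
          then have "\<rho> \<noteq> {}" by (simp add: all_faces_def)
          then show "\<rho> \<in> \<Psi> \<sigma>" using W_faces[OF \<rho> True] nW by (auto simp: \<Psi>_def all_faces_def)
        qed
      next
        case False
        then show ?thesis
          using nW Q\<tau> free\<tau> co\<tau> by (auto simp: \<Psi>_def all_faces_def)
      qed
    qed
    show "\<Theta> \<tau> \<subseteq> \<Theta> \<sigma>"
    proof (cases "\<sigma> \<in> W")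
      case True
      then show ?thesis using W\<tau> af by (simp add: \<Theta>_def)
    next
      case nW: False
      show ?thesis
      proof (cases "\<tau> \<in> W")
        case True
        show ?thesis
        proof
          fix \<rho> assume "\<rho> \<in> \<Theta> \<tau>"
          then have \<rho>: "\<rho> \<in> all_faces \<tau>" using True by (simp add: \<Theta>_def)
          then have "\<rho> \<noteq> {}" "\<rho> \<subseteq> \<sigma>" using \<tau> by (auto simp: all_faces_def)
          then show "\<rho> \<in> \<Theta> \<sigma>" using W_faces[OF \<rho> True] nW QR by (auto simp: \<Theta>_def all_faces_def)
        qed
      next
        case False
        have "all_faces (\<tau> \<union> A \<tau>) \<subseteq> all_faces (\<sigma> \<union> A \<sigma>)" if "\<not> coset_free m \<tau>"
          using co\<tau>(2)[OF that] \<tau>(2) unfolding all_faces_def by blast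
        then show ?thesis
          using nW False Q\<tau>(2) free\<tau> by (auto simp: \<Theta>_def)
      qed
    qed
  next
    fix \<sigma> assume \<sigma>: "\<sigma> \<in> W"
    then show "\<sigma> \<in> \<Psi> \<sigma>" using abstract_complexD(2)[OF W] by (auto simp: \<Psi>_def all_faces_def)
  qed
  then show ?thesis by (simp add: W_def C_def)
qed

end

section \<open>Spheres as boundaries of simplices\<close>

lemma continuous_map_Min:
  assumes "finite I" "I \<noteq> {}" "\<And>i. i \<in> I \<Longrightarrow> continuous_map X euclideanreal (\<lambda>x. f x i)"
  shows "continuous_map X euclideanreal (\<lambda>x. Min (f x ` I))"
  using assms
proof (induction I rule: finite_ne_induct)
  case (insert i I)
  have "Min (f x ` insert i I) = min (f x i) (Min (f x ` I))" for x
    using insert.hyps by simp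
  then show ?case using insert by (simp add: continuous_map_real_min)
qed simp

lemma continuous_map_real_sqrt:
  assumes "continuous_map X euclideanreal f"
  shows "continuous_map X euclideanreal (\<lambda>x. sqrt (f x))"
proof -
  have "continuous_map euclideanreal euclideanreal sqrt"
    by (simp add: continuous_on_real_sqrt[OF continuous_on_id, unfolded id_def])
  then have "continuous_map X euclideanreal (sqrt \<circ> f)"
    by (rule continuous_map_compose[OF assms])
  then show ?thesis by (simp add: o_def)
qed

text \<open>A set closed in each simplex is a finite union of closed sets, so the weak topology is
  the subspace topology of the product. This allows maps into a simplex boundary to be checked by
  coordinates.\<close>

lemma realization_finite:
  assumes K: "abstract_complex K" and fin: "finite K"
  shows "realization K = subtopology (powertop_real UNIV) (realization_set K)"
proof (rule topology_eq[THEN iffD2], intro allI)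
  fix U
  have c: "closedin (powertop_real UNIV) (closed_simplex \<sigma>)" if "\<sigma> \<in> K" for \<sigma>
    using closedin_closed_simplex abstract_complexD(1)[OF K that] by blast
  let ?S = "realization_set K"
  have S: "?S = (\<Union>\<sigma>\<in>K. closed_simplex \<sigma>)" by (rule realization_set_eq[OF K])
  show "openin (realization K) U = openin (subtopology (powertop_real UNIV) ?S) U"
  proof
    assume U: "openin (realization K) U"
    then have US: "U \<subseteq> ?S" and Uo: "\<And>\<sigma>. \<sigma> \<in> K \<Longrightarrow> openin (simplex_space \<sigma>) (U \<inter> closed_simplex \<sigma>)"
      by (auto simp: openin_realization)
    have "closedin (powertop_real UNIV) (closed_simplex \<sigma> - U)" if "\<sigma> \<in> K" for \<sigma>
    proof -
      have "closedin (simplex_space \<sigma>) (topspace (simplex_space \<sigma>) - U \<inter> closed_simplex \<sigma>)"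
        by (rule openin_closedin_eq[THEN iffD1, THEN conjunct2]) (rule Uo[OF that])
      moreover have "topspace (simplex_space \<sigma>) - U \<inter> closed_simplex \<sigma> = closed_simplex \<sigma> - U" by auto
      ultimately show ?thesis
        using closedin_trans_full c[OF that] by metis
    qed
    then have "closedin (powertop_real UNIV) (\<Union>\<sigma>\<in>K. closed_simplex \<sigma> - U)"
      using fin by (intro closedin_Union) auto
    moreover have "(\<Union>\<sigma>\<in>K. closed_simplex \<sigma> - U) = ?S - U" unfolding S by auto
    ultimately have "openin (powertop_real UNIV) (UNIV - (?S - U))"
      by (simp add: closedin_def)
    moreover have "U = (UNIV - (?S - U)) \<inter> ?S" using US by auto
    ultimately show "openin (subtopology (powertop_real UNIV) ?S) U"
      unfolding openin_subtopology by blast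
  next
    assume "openin (subtopology (powertop_real UNIV) ?S) U"
    then obtain T where T: "openin (powertop_real UNIV) T" "U = T \<inter> ?S"
      unfolding openin_subtopology by blast
    show "openin (realization K) U"
      unfolding openin_realization
    proof (intro conjI ballI)
      fix \<sigma> assume "\<sigma> \<in> K"
      then have "U \<inter> closed_simplex \<sigma> = T \<inter> closed_simplex \<sigma>" using T(2) S by auto
      then show "openin (simplex_space \<sigma>) (U \<inter> closed_simplex \<sigma>)"
        unfolding openin_subtopology using T(1) by blast
    qed (use T in auto)
  qed
qed

section \<open>Simplex boundaries and radial projection\<close>

definition simplex_boundary :: "'a set \<Rightarrow> 'a set set" where
  "simplex_boundary V = all_faces V - {V}"

lemma abstract_complex_boundary: "finite V \<Longrightarrow> abstract_complex (simplex_boundary V)"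
  by (rule abstract_complexI) (auto simp: simplex_boundary_def all_faces_def intro: finite_subset)

lemma simplex_boundary_set:
  assumes "finite V"
  shows "realization_set (simplex_boundary V) = {\<alpha> \<in> closed_simplex V. \<exists>x\<in>V. \<alpha> x = 0}"
proof (intro subset_antisym subsetI)
  fix \<alpha> assume "\<alpha> \<in> realization_set (simplex_boundary V)"
  then obtain \<sigma> where \<sigma>: "\<sigma> \<in> simplex_boundary V" "\<alpha> \<in> closed_simplex \<sigma>"
    using realization_set_eq[OF abstract_complex_boundary[OF assms]] by blast
  then have "\<sigma> \<subset> V" by (auto simp: simplex_boundary_def all_faces_def)
  then obtain x where "x \<in> V" "x \<notin> \<sigma>" by blast
  then show "\<alpha> \<in> {\<alpha> \<in> closed_simplex V. \<exists>x\<in>V. \<alpha> x = 0}"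
    using \<sigma> closed_simplex_mono[OF assms, of \<sigma>] \<open>\<sigma> \<subset> V\<close> by (auto simp: closed_simplex_def)
next
  fix \<alpha> assume "\<alpha> \<in> {\<alpha> \<in> closed_simplex V. \<exists>x\<in>V. \<alpha> x = 0}"
  then obtain x where x: "\<alpha> \<in> closed_simplex V" "x \<in> V" "\<alpha> x = 0" by blast
  let ?\<sigma> = "{v. \<alpha> v \<noteq> 0}"
  have "?\<sigma> \<in> simplex_boundary V" "\<alpha> \<in> closed_simplex ?\<sigma>"
    using closed_simplex_support[OF assms x(1)] x by (auto simp: simplex_boundary_def all_faces_def)
  then show "\<alpha> \<in> realization_set (simplex_boundary V)"
    using realization_set_eq[OF abstract_complex_boundary[OF assms]] by blast
qed

lemma continuous_map_into_boundary:
  assumes V: "finite V" and "\<And>x. continuous_map X euclideanreal (\<lambda>p. f p x)"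
    and "\<And>p. p \<in> topspace X \<Longrightarrow> f p \<in> realization_set (simplex_boundary V)"
  shows "continuous_map X (realization (simplex_boundary V)) f"
proof -
  have "finite (simplex_boundary V)"
    by (rule finite_subset[of _ "Pow V"]) (auto simp: simplex_boundary_def all_faces_def V)
  show ?thesis
    using assms(2,3) unfolding realization_finite[OF abstract_complex_boundary[OF V] \<open>finite (simplex_boundary V)\<close>]
    by (auto simp: continuous_map_in_subtopology continuous_map_componentwise_UNIV)
qed

lemma continuous_map_boundary_coord:
  assumes V: "finite V"
  shows "continuous_map (realization (simplex_boundary V)) euclideanreal (\<lambda>\<alpha>. \<alpha> x)"
  unfolding continuous_map_from_realization[OF abstract_complex_boundary[OF V]]
  by (intro ballI continuous_map_from_subtopology continuous_map_product_projection) auto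

text \<open>Radial projection from the barycentre, for functions that are not constant on \<open>V\<close>.\<close>

definition boundary_proj :: "'a set \<Rightarrow> ('a \<Rightarrow> real) \<Rightarrow> 'a \<Rightarrow> real" where
  "boundary_proj V z = (\<lambda>x. if x \<in> V then (z x - Min (z ` V)) / (\<Sum>y\<in>V. z y - Min (z ` V)) else 0)"

lemma boundary_proj_sum_pos:
  fixes z :: "'a \<Rightarrow> real"
  assumes V: "finite V" and x: "x \<in> V" "y \<in> V" "z x \<noteq> z y"
  shows "0 < (\<Sum>y\<in>V. z y - Min (z ` V))"
proof -
  define M where "M = Min (z ` V)"
  have le: "M \<le> z u" if "u \<in> V" for u unfolding M_def using V that by simp
  have "M < z x \<or> M < z y" using le[OF x(1)] le[OF x(2)] x(3) by auto
  then obtain u where u: "u \<in> V" "M < z u" using x by blast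
  have "0 < (\<Sum>y\<in>V. z y - M)"
    by (rule sum_pos2[OF V u(1)]) (use u le in auto)
  then show ?thesis by (simp only: M_def)
qed

lemma boundary_proj_in_boundary:
  assumes V: "finite V" and x: "x \<in> V" "y \<in> V" "z x \<noteq> z y"
  shows "boundary_proj V z \<in> realization_set (simplex_boundary V)"
proof -
  let ?s = "\<Sum>y\<in>V. z y - Min (z ` V)"
  have s: "0 < ?s" by (rule boundary_proj_sum_pos[OF assms])
  have "Min (z ` V) \<in> z ` V" using V x by (intro Min_in) auto
  then obtain u where u: "u \<in> V" "Min (z ` V) = z u" by auto
  have "sum (boundary_proj V z) V = (\<Sum>x\<in>V. (z x - Min (z ` V)) / ?s)"
    by (rule sum.cong) (auto simp: boundary_proj_def)
  also have "\<dots> = 1" using s by (simp flip: sum_divide_distrib)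
  finally have "boundary_proj V z \<in> closed_simplex V"
    using s V by (auto simp: closed_simplex_def boundary_proj_def intro!: divide_nonneg_nonneg)
  moreover have "boundary_proj V z u = 0" using u by (simp add: boundary_proj_def)
  ultimately show ?thesis using u simplex_boundary_set[OF V] by blast
qed

lemma boundary_proj_id:
  assumes V: "finite V" and \<alpha>: "\<alpha> \<in> realization_set (simplex_boundary V)"
  shows "boundary_proj V \<alpha> = \<alpha>"
proof -
  obtain x where x: "\<alpha> \<in> closed_simplex V" "x \<in> V" "\<alpha> x = 0"
    using \<alpha> unfolding simplex_boundary_set[OF V] by blast
  have "Min (\<alpha> ` V) = 0"
  proof (rule Min_eqI)
    show "0 \<in> \<alpha> ` V" using x by force
    show "\<And>y. y \<in> \<alpha> ` V \<Longrightarrow> 0 \<le> y" using x by (auto simp: closed_simplex_def)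
  qed (use V in auto)
  then show ?thesis using x by (auto simp: boundary_proj_def closed_simplex_def)
qed

text \<open>The projection depends only on the ray of \<open>z\<close> modulo constants; so it can
  undo the normalisation made on the sphere.\<close>

lemma boundary_proj_affine:
  assumes V: "finite V" "V \<noteq> {}" and c: "0 < c" and z': "\<And>x. x \<in> V \<Longrightarrow> z' x = c * (z x - b)"
  shows "boundary_proj V z' = boundary_proj V z"
proof -
  have "z' ` V = (\<lambda>t. c * (t - b)) ` (z ` V)" using z' by (auto simp: image_image)
  moreover have "mono (\<lambda>t. c * (t - b))" using c by (auto intro!: monoI mult_left_mono)
  ultimately have M: "Min (z' ` V) = c * (Min (z ` V) - b)"
    using mono_Min_commute[of "\<lambda>t. c * (t - b)" "z ` V"] V by simp
  have d: "z' x - Min (z' ` V) = c * (z x - Min (z ` V))" if "x \<in> V" for x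
    using z'[OF that] M by (simp add: algebra_simps)
  then have "(\<Sum>y\<in>V. z' y - Min (z' ` V)) = c * (\<Sum>y\<in>V. z y - Min (z ` V))"
    by (simp add: sum_distrib_left)
  then show ?thesis using d c by (auto simp: boundary_proj_def)
qed

lemma continuous_map_boundary_proj:
  assumes V: "finite V" and z: "\<And>x. x \<in> V \<Longrightarrow> continuous_map X euclideanreal (\<lambda>p. z p x)"
    and nc: "\<And>p. p \<in> topspace X \<Longrightarrow> \<exists>x\<in>V. \<exists>y\<in>V. z p x \<noteq> z p y"
  shows "continuous_map X (realization (simplex_boundary V)) (\<lambda>p. boundary_proj V (z p))"
proof (rule continuous_map_into_boundary[OF V])
  show "boundary_proj V (z p) \<in> realization_set (simplex_boundary V)" if "p \<in> topspace X" for p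
    using nc[OF that] boundary_proj_in_boundary[OF V] by blast
  show "continuous_map X euclideanreal (\<lambda>p. boundary_proj V (z p) x)" for x
  proof (cases "x \<in> V")
    case True
    then have M: "continuous_map X euclideanreal (\<lambda>p. Min (z p ` V))"
      using z V by (intro continuous_map_Min) auto
    have "continuous_map X euclideanreal (\<lambda>p. (z p x - Min (z p ` V)) / (\<Sum>y\<in>V. z p y - Min (z p ` V)))"
    proof (intro continuous_intros z[OF True] M V z)
      show "(\<Sum>y\<in>V. z p y - Min (z p ` V)) \<noteq> 0" if "p \<in> topspace X" for p
        using nc[OF that] boundary_proj_sum_pos[OF V, of _ _ "z p"] by (metis less_irrefl)
    qed auto
    then show ?thesis using True by (simp add: boundary_proj_def)
  qed (simp add: boundary_proj_def)
qed

text \<open>Both spaces parametrise the rays of non-constant functions on the \<open>n + 2\<close>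
  vertices modulo constants. The sphere uses the representative with value 0 at the last vertex and
  Euclidean norm 1, the simplex boundary the one with minimum 0 and sum 1.\<close>

definition to_sphere :: "nat \<Rightarrow> (nat \<Rightarrow> 'a) \<Rightarrow> ('a \<Rightarrow> real) \<Rightarrow> nat \<Rightarrow> real" where
  "to_sphere n v \<alpha> = (\<lambda>i. if i \<le> n then (\<alpha> (v i) - \<alpha> (v (Suc n))) /
      sqrt (\<Sum>j\<le>n. (\<alpha> (v j) - \<alpha> (v (Suc n)))\<^sup>2) else 0)"

text \<open>Points of the sphere vanish at all indices above \<open>n\<close>, so index
  \<open>Suc n\<close> supplies the value 0 at the last vertex.\<close>

definition from_sphere :: "nat \<Rightarrow> (nat \<Rightarrow> 'a) \<Rightarrow> (nat \<Rightarrow> real) \<Rightarrow> 'a \<Rightarrow> real" where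
  "from_sphere n v y = boundary_proj (v ` {..Suc n}) (\<lambda>x. y (inv_into {..Suc n} v x))"

lemma sphere_homeomorphic_maps:
  assumes v: "inj_on v {..Suc n}"
  shows "homeomorphic_maps (realization (simplex_boundary (v ` {..Suc n}))) (nsphere n) (to_sphere n v) (from_sphere n v)"
proof -
  let ?V = "v ` {..Suc n}"
  have V: "finite ?V" "?V \<noteq> {}" by auto
  let ?R = "realization (simplex_boundary ?V)"
  have tR: "topspace ?R = realization_set (simplex_boundary ?V)"
    by (rule topspace_realization[OF abstract_complex_boundary[OF V(1)]])
  let ?N = "\<lambda>\<alpha>. \<Sum>j\<le>n. (\<alpha> (v j) - \<alpha> (v (Suc n)))\<^sup>2"
  have iv: "inv_into {..Suc n} v (v i) = i" if "i \<le> Suc n" for i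
    using that v by (simp add: inv_into_f_f)
  have npos: "0 < ?N \<alpha>" if \<alpha>: "\<alpha> \<in> topspace ?R" for \<alpha>
  proof (rule ccontr)
    assume "\<not> ?thesis"
    then have "?N \<alpha> = 0" using sum_nonneg[of "{..n}" "\<lambda>j. (\<alpha> (v j) - \<alpha> (v (Suc n)))\<^sup>2"] by force
    then have "\<alpha> (v j) = \<alpha> (v (Suc n))" if "j \<le> n" for j
      using that by (simp add: sum_nonneg_eq_0_iff)
    then have all: "\<alpha> (v j) = \<alpha> (v (Suc n))" if "j \<le> Suc n" for j
      using that by (cases "j = Suc n") auto
    have eq: "\<alpha> x = \<alpha> (v (Suc n))" if x: "x \<in> ?V" for x
    proof -
      obtain j where "j \<le> Suc n" "x = v j" using x by auto
      then show ?thesis using all by blast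
    qed
    obtain x where x: "\<alpha> \<in> closed_simplex ?V" "x \<in> ?V" "\<alpha> x = 0"
      using \<alpha> unfolding tR simplex_boundary_set[OF V(1)] by blast
    have "\<alpha> y = 0" if "y \<in> ?V" for y using eq[OF that] eq[OF x(2)] x(3) by simp
    then have "sum \<alpha> ?V = 0" by (intro sum.neutral) auto
    then show False using x(1) by (simp add: closed_simplex_def)
  qed
  have tN: "topspace (nsphere n) = {x. (\<Sum>i\<le>n. x i ^ 2) = 1 \<and> (\<forall>i>n. x i = 0)}"
    by (simp add: nsphere)
  have ync: "\<exists>x\<in>?V. \<exists>x'\<in>?V. y (inv_into {..Suc n} v x) \<noteq> y (inv_into {..Suc n} v x')"
    if "y \<in> topspace (nsphere n)" for y
  proof (rule ccontr)
    assume neg: "\<not> ?thesis"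
    have "y i = y (Suc n)" if "i \<le> n" for i
    proof -
      have "y (inv_into {..Suc n} v (v i)) = y (inv_into {..Suc n} v (v (Suc n)))" using neg that by auto
      then show ?thesis using iv that by simp
    qed
    moreover have "y (Suc n) = 0" using \<open>y \<in> topspace (nsphere n)\<close> by (simp add: tN)
    ultimately have "(\<Sum>i\<le>n. y i ^ 2) = 0" by simp
    then show False using \<open>y \<in> topspace (nsphere n)\<close> by (simp add: tN)
  qed
  have c1: "continuous_map ?R (nsphere n) (to_sphere n v)"
    unfolding nsphere continuous_map_in_subtopology continuous_map_componentwise_UNIV
  proof (intro conjI allI)
    fix i
    have N: "continuous_map ?R euclideanreal ?N"
      unfolding power2_eq_square
      by (intro continuous_map_sum finite_atMost continuous_map_real_mult continuous_map_diff continuous_map_boundary_coord V(1))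
    have "sqrt (?N \<alpha>) \<noteq> 0" if "\<alpha> \<in> topspace ?R" for \<alpha>
      using npos[OF that] by (metis less_irrefl real_sqrt_eq_zero_cancel_iff)
    then have "continuous_map ?R euclideanreal (\<lambda>\<alpha>. (\<alpha> (v i) - \<alpha> (v (Suc n))) / sqrt (?N \<alpha>))"
      by (intro continuous_map_real_divide continuous_map_diff continuous_map_real_sqrt N continuous_map_boundary_coord V(1))
    then show "continuous_map ?R euclideanreal (\<lambda>\<alpha>. to_sphere n v \<alpha> i)"
      by (cases "i \<le> n") (auto simp: to_sphere_def)
    show "to_sphere n v \<in> topspace ?R \<rightarrow> {x. (\<Sum>i\<le>n. x i ^ 2) = 1 \<and> (\<forall>i>n. x i = 0)}"
    proof
      fix \<alpha> assume a: "\<alpha> \<in> topspace ?R"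
      have "(\<Sum>i\<le>n. (to_sphere n v \<alpha> i)\<^sup>2) = (\<Sum>i\<le>n. (\<alpha> (v i) - \<alpha> (v (Suc n)))\<^sup>2 / ?N \<alpha>)"
        using npos[OF a] by (intro sum.cong) (auto simp: to_sphere_def power_divide)
      also have "\<dots> = 1" using npos[OF a] by (simp flip: sum_divide_distrib)
      finally show "to_sphere n v \<alpha> \<in> {x. (\<Sum>i\<le>n. x i ^ 2) = 1 \<and> (\<forall>i>n. x i = 0)}"
        by (simp add: to_sphere_def)
    qed
  qed
  have c2: "continuous_map (nsphere n) ?R (from_sphere n v)"
    unfolding from_sphere_def
    by (intro continuous_map_boundary_proj V(1) continuous_map_nsphere_projection ync)
  have i1: "from_sphere n v (to_sphere n v \<alpha>) = \<alpha>" if a: "\<alpha> \<in> topspace ?R" for \<alpha>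
  proof -
    have "from_sphere n v (to_sphere n v \<alpha>) = boundary_proj ?V \<alpha>"
      unfolding from_sphere_def
    proof (rule boundary_proj_affine[OF V, of "1 / sqrt (?N \<alpha>)" _ _ "\<alpha> (v (Suc n))"])
      show "0 < 1 / sqrt (?N \<alpha>)" using npos[OF a] by simp
      fix x assume "x \<in> ?V"
      then obtain i where i: "i \<le> Suc n" "x = v i" by auto
      then show "to_sphere n v \<alpha> (inv_into {..Suc n} v x) = 1 / sqrt (?N \<alpha>) * (\<alpha> x - \<alpha> (v (Suc n)))"
        using iv by (cases "i = Suc n") (auto simp: to_sphere_def)
    qed
    then show ?thesis using boundary_proj_id[OF V(1)] a tR by simp
  qed
  have i2: "to_sphere n v (from_sphere n v y) = y" if y: "y \<in> topspace (nsphere n)" for y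
  proof -
    define z where "z = (\<lambda>x. y (inv_into {..Suc n} v x))"
    define s where "s = (\<Sum>x\<in>?V. z x - Min (z ` ?V))"
    have s: "0 < s" using ync[OF y] boundary_proj_sum_pos[OF V(1), of _ _ z] unfolding s_def z_def by blast
    have f: "from_sphere n v y (v i) = (y i - Min (z ` ?V)) / s" if "i \<le> Suc n" for i
      using that iv[OF that] by (simp add: from_sphere_def boundary_proj_def z_def s_def)
    have d: "from_sphere n v y (v i) - from_sphere n v y (v (Suc n)) = y i / s" if "i \<le> n" for i
    proof -
      have "y (Suc n) = 0" using y by (simp add: tN)
      moreover have "(a - M) / s - (0 - M) / s = a / s" for a M :: real by (simp add: diff_divide_distrib)
      ultimately show ?thesis using f[of i] f[of "Suc n"] that by (simp only: le_SucI order_refl)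
    qed
    have "(\<Sum>j\<le>n. (from_sphere n v y (v j) - from_sphere n v y (v (Suc n)))\<^sup>2) = (\<Sum>j\<le>n. (y j)\<^sup>2 / s\<^sup>2)"
      using d by (intro sum.cong) (auto simp: power_divide)
    also have "\<dots> = 1 / s\<^sup>2" using y by (simp add: tN flip: sum_divide_distrib)
    finally have "sqrt (\<Sum>j\<le>n. (from_sphere n v y (v j) - from_sphere n v y (v (Suc n)))\<^sup>2) = 1 / s"
      using s by (simp add: real_sqrt_divide)
    then show ?thesis using d s y by (auto simp: to_sphere_def tN)
  qed
  show ?thesis
    unfolding homeomorphic_maps_def using c1 c2 i1 i2 by blast
qed

lemma simplex_boundary_homeomorphic_sphere:
  assumes "finite V" "card V = n + 2"
  shows "realization (simplex_boundary V) homeomorphic_space nsphere n"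
proof -
  obtain v where v: "bij_betw v {0..<card V} V" using ex_bij_betw_nat_finite[OF assms(1)] by blast
  have "{0..<card V} = {..Suc n}" using assms(2) by auto
  then have "inj_on v {..Suc n}" "v ` {..Suc n} = V" using v by (auto simp: bij_betw_def)
  then show ?thesis
    using sphere_homeomorphic_maps[of v n] homeomorphic_space_def by metis
qed

section \<open>The bouquet of spheres\<close>

lemma quotient_map_quotient_topology: "quotient_map X (quotient_topology X f) f"
proof -
  have 1: "{x \<in> topspace X. f x \<in> S \<inter> T} = {x \<in> topspace X. f x \<in> S} \<inter> {x \<in> topspace X. f x \<in> T}" for S T
    by auto
  have 2: "{x \<in> topspace X. f x \<in> \<Union>\<K>} = (\<Union>U\<in>\<K>. {x \<in> topspace X. f x \<in> U})" for \<K>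
    by auto
  have "istopology (\<lambda>U. U \<subseteq> f ` topspace X \<and> openin X {x \<in> topspace X. f x \<in> U})"
    unfolding istopology_def 1 2 by blast
  then have op: "openin (quotient_topology X f) U \<longleftrightarrow> U \<subseteq> f ` topspace X \<and> openin X {x \<in> topspace X. f x \<in> U}" for U
    by (simp add: quotient_topology_def)
  have "{x \<in> topspace X. f x \<in> f ` topspace X} = topspace X" by auto
  then have "openin (quotient_topology X f) (f ` topspace X)" using op by simp
  then have "topspace (quotient_topology X f) = f ` topspace X"
    using op by (meson openin_subset openin_topspace subset_antisym)
  then show ?thesis unfolding quotient_map_def using op by auto
qed

lemma continuous_map_from_sum:
  assumes h: "\<And>i. i \<in> I \<Longrightarrow> continuous_map (X i) Y (\<lambda>x. h (i,x))"
  shows "continuous_map (sum_topology X I) Y h"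
  unfolding continuous_map_def
proof (intro conjI allI impI)
  show "h \<in> topspace (sum_topology X I) \<rightarrow> topspace Y"
  proof
    fix q assume "q \<in> topspace (sum_topology X I)"
    then obtain i x where q: "q = (i,x)" "i \<in> I" "x \<in> topspace (X i)" by auto
    then show "h q \<in> topspace Y"
      using subsetD[OF continuous_map_image_subset_topspace[OF h[OF q(2)]], OF imageI[of x]] by simp
  qed
  fix U assume U: "openin Y U"
  have "openin (X i) {x \<in> topspace (X i). h (i,x) \<in> U}" if "i \<in> I" for i
    using h[OF that] U unfolding continuous_map_def by blast
  moreover have "{x. (i,x) \<in> {p \<in> topspace (sum_topology X I). h p \<in> U}} = {x \<in> topspace (X i). h (i,x) \<in> U}" if "i \<in> I" for i
    using that by auto
  ultimately show "openin (sum_topology X I) {p \<in> topspace (sum_topology X I). h p \<in> U}"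
    unfolding openin_sum_topology by auto
qed

text \<open>A homotopy of the boundary of the simplex \<open>c \<union> G\<close> that contracts the face \<open>G\<close> to its vertex \<open>p\<close>.
  The straight push of the mass on \<open>G\<close> towards \<open>p\<close> could only meet the barycentre where \<open>c\<close> carries
  mass \<open>1/2\<close>, so it is switched off there.\<close>

definition squeeze :: "'a set \<Rightarrow> 'a set \<Rightarrow> 'a \<Rightarrow> real \<Rightarrow> ('a \<Rightarrow> real) \<Rightarrow> 'a \<Rightarrow> real" where
  "squeeze c G p t \<alpha> = (\<lambda>x. if x \<in> G then (1 - t * max 0 (1 - 2 * sum \<alpha> c)) * \<alpha> x
      + t * max 0 (1 - 2 * sum \<alpha> c) * ((1 - sum \<alpha> c) * (if x = p then 1 else 0)) else \<alpha> x)"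

definition squash :: "'a set \<Rightarrow> 'a set \<Rightarrow> 'a \<Rightarrow> real \<Rightarrow> ('a \<Rightarrow> real) \<Rightarrow> 'a \<Rightarrow> real" where
  "squash c G p t \<alpha> = boundary_proj (c \<union> G) (squeeze c G p t \<alpha>)"

context
  fixes c G :: "'a set" and p :: 'a
  assumes fin: "finite c" "finite G" and disj: "c \<inter> G = {}" and crd: "card c = card G" and p: "p \<in> G"
begin

text \<open>The push preserves the total mass on \<open>G\<close>, so a constant result gives
  \<open>c\<close> and \<open>G\<close> equal mass, their cardinalities being equal. Then
  \<open>c\<close> carries \<open>1/2\<close>, the push is switched off, and \<open>\<alpha>\<close>
  itself would be constant although it has a zero coordinate.\<close>

lemma squeeze_not_constant:
  assumes \<alpha>: "\<alpha> \<in> realization_set (simplex_boundary (c \<union> G))"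
  shows "\<exists>x\<in>c \<union> G. \<exists>y\<in>c \<union> G. squeeze c G p t \<alpha> x \<noteq> squeeze c G p t \<alpha> y"
proof (rule ccontr)
  assume neg: "\<not> ?thesis"
  define \<kappa> where "\<kappa> = squeeze c G p t \<alpha> p"
  have const: "squeeze c G p t \<alpha> x = \<kappa>" if "x \<in> c \<union> G" for x
    using neg that p unfolding \<kappa>_def by blast
  obtain x where x: "\<alpha> \<in> closed_simplex (c \<union> G)" "x \<in> c \<union> G" "\<alpha> x = 0"
    using \<alpha> unfolding simplex_boundary_set[OF finite_UnI[OF fin]] by blast
  define A where "A = sum \<alpha> c"
  have "sum \<alpha> (c \<union> G) = sum \<alpha> c + sum \<alpha> G" using fin disj by (rule sum.union_disjoint)
  then have G: "sum \<alpha> G = 1 - A" using x(1) by (simp add: closed_simplex_def A_def)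
  have c\<kappa>: "\<alpha> y = \<kappa>" if "y \<in> c" for y
    using const[of y] that disj by (auto simp: squeeze_def)
  then have A: "A = real (card c) * \<kappa>" by (simp add: A_def)
  define l where "l = t * max 0 (1 - 2 * A)"
  have "(\<Sum>y\<in>G. squeeze c G p t \<alpha> y) = (\<Sum>y\<in>G. (1 - l) * \<alpha> y + l * (1 - A) * (if y = p then 1 else 0))"
    by (intro sum.cong) (auto simp: squeeze_def l_def A_def)
  also have "\<dots> = (1 - l) * sum \<alpha> G + l * (1 - A) * (\<Sum>y\<in>G. if y = p then 1 else 0)"
    by (simp only: sum.distrib sum_distrib_left)
  also have "(\<Sum>y\<in>G. if y = p then 1 else 0::real) = 1" using fin p by simp
  also have "(1 - l) * sum \<alpha> G + l * (1 - A) * 1 = 1 - A" unfolding G by (simp add: algebra_simps)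
  finally have "1 - A = (\<Sum>y\<in>G. \<kappa>)" using const by simp
  then have "1 - A = A" using A crd by simp
  then have A2: "A = 1 / 2" by simp
  then have "squeeze c G p t \<alpha> = \<alpha>" by (auto simp: squeeze_def A_def)
  then have "\<alpha> x = \<kappa>" using const x(2) by metis
  then show False using A A2 x(3) by simp
qed

lemma squash_in_boundary:
  assumes "\<alpha> \<in> realization_set (simplex_boundary (c \<union> G))"
  shows "squash c G p t \<alpha> \<in> realization_set (simplex_boundary (c \<union> G))"
  using squeeze_not_constant[OF assms] boundary_proj_in_boundary[OF finite_UnI[OF fin]]
  unfolding squash_def by blast

lemma continuous_map_squash:
  assumes \<tau>: "continuous_map X euclideanreal \<tau>" and a: "\<And>x. continuous_map X euclideanreal (\<lambda>q. a q x)"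
    and b: "\<And>q. q \<in> topspace X \<Longrightarrow> a q \<in> realization_set (simplex_boundary (c \<union> G))"
  shows "continuous_map X (realization (simplex_boundary (c \<union> G))) (\<lambda>q. squash c G p (\<tau> q) (a q))"
  unfolding squash_def
proof (rule continuous_map_boundary_proj)
  have s: "continuous_map X euclideanreal (\<lambda>q. sum (a q) c)" using fin a by (intro continuous_map_sum) auto
  have l: "continuous_map X euclideanreal (\<lambda>q. \<tau> q * max 0 (1 - 2 * sum (a q) c))"
    by (intro continuous_map_real_mult \<tau> continuous_map_real_max continuous_map_diff s) auto
  fix x
  show "continuous_map X euclideanreal (\<lambda>q. squeeze c G p (\<tau> q) (a q) x)"
  proof (cases "x \<in> G")
    case True
    then show ?thesis
      unfolding squeeze_def if_P[OF True]
      by (intro continuous_map_add continuous_map_real_mult continuous_map_diff l a s) auto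
  next
    case False
    then show ?thesis using a by (simp add: squeeze_def)
  qed
qed (use fin squeeze_not_constant b in auto)

lemma squash_0:
  assumes "\<alpha> \<in> realization_set (simplex_boundary (c \<union> G))"
  shows "squash c G p 0 \<alpha> = \<alpha>"
proof -
  have "squeeze c G p 0 \<alpha> = \<alpha>" by (auto simp: squeeze_def)
  then show ?thesis using boundary_proj_id[OF finite_UnI[OF fin] assms] by (simp add: squash_def)
qed

lemma face_in_boundary:
  assumes "\<alpha> \<in> closed_simplex G"
  shows "\<alpha> \<in> realization_set (simplex_boundary (c \<union> G))"
proof -
  have "G \<noteq> {}" using p by blast
  then have "c \<noteq> {}" using crd fin by auto
  then obtain x where "x \<in> c" "x \<notin> G" using disj by blast
  then have "\<alpha> x = 0" using assms by (simp add: closed_simplex_def)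
  moreover have "\<alpha> \<in> closed_simplex (c \<union> G)" using closed_simplex_mono[of "c \<union> G" G] fin assms by auto
  ultimately show ?thesis unfolding simplex_boundary_set[OF finite_UnI[OF fin]] using \<open>x \<in> c\<close> by blast
qed

text \<open>On \<open>G\<close> the set \<open>c\<close> carries no mass and the push has full
  strength. The result does not involve \<open>c\<close>, so the homotopies of different spheres
  agree on their common simplex, and at time 1 this simplex has shrunk to \<open>p\<close>.\<close>

lemma squash_face:
  assumes \<alpha>: "\<alpha> \<in> closed_simplex G" and t: "0 \<le> t" "t \<le> 1"
  shows "squash c G p t \<alpha> = (\<lambda>x. (1 - t) * \<alpha> x + t * (if x = p then 1 else 0))"
proof -
  define \<beta> where "\<beta> = (\<lambda>x. (1 - t) * \<alpha> x + t * (if x = p then 1 else 0))"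
  have z: "\<alpha> x = 0" if "x \<notin> G" for x using \<alpha> that by (simp add: closed_simplex_def)
  then have "sum \<alpha> c = 0" using disj by (intro sum.neutral) auto
  then have "squeeze c G p t \<alpha> = \<beta>"
    using z p by (auto simp: squeeze_def \<beta>_def)
  moreover have "\<beta> \<in> closed_simplex G"
  proof -
    have "sum \<beta> G = (1 - t) * sum \<alpha> G + t * (\<Sum>x\<in>G. if x = p then 1 else 0)"
      unfolding \<beta>_def by (simp only: sum.distrib sum_distrib_left)
    also have "(\<Sum>x\<in>G. if x = p then 1 else 0::real) = 1" using fin p by simp
    finally have "sum \<beta> G = 1" using \<alpha> by (simp add: closed_simplex_def)
    then show ?thesis using \<alpha> t p by (auto simp: closed_simplex_def \<beta>_def)
  qed
  ultimately show ?thesis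
    using boundary_proj_id[OF finite_UnI[OF fin] face_in_boundary] by (simp add: squash_def \<beta>_def)
qed

end

text \<open>Placing \<open>p\<close> at index 0 lets the homeomorphism send that vertex to the base
  point of the sphere.\<close>

lemma enumeration_from:
  assumes "finite V" "card V = n + 2" "p \<in> V"
  obtains v :: "nat \<Rightarrow> 'a" where "inj_on v {..Suc n}" "v ` {..Suc n} = V" "v 0 = p"
proof -
  have "card (V - {p}) = Suc n" using assms by simp
  then obtain u where u: "bij_betw u {0..<Suc n} (V - {p})"
    using ex_bij_betw_nat_finite[of "V - {p}"] assms(1) by auto
  define v where "v i = (case i of 0 \<Rightarrow> p | Suc j \<Rightarrow> u j)" for i
  have img: "v ` {..Suc n} = insert p (u ` {0..<Suc n})"
    unfolding atMost_Suc_eq_insert_0 image_insert image_image by (auto simp: v_def)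
  have uV: "u ` {0..<Suc n} = V - {p}" and inj: "inj_on u {0..<Suc n}" using u by (auto simp: bij_betw_def)
  have "inj_on v {..Suc n}"
  proof (rule inj_onI)
    fix i j assume ij: "i \<in> {..Suc n}" "j \<in> {..Suc n}" "v i = v j"
    have ne: "u k \<noteq> p" if "k < Suc n" for k using uV that by force
    show "i = j"
    proof (cases i)
      case i: 0
      show ?thesis
      proof (cases j)
        case (Suc k)
        then have "u k = p" "k < Suc n" using ij i by (auto simp: v_def)
        then show ?thesis using ne by blast
      qed (simp add: i)
    next
      case i: (Suc k)
      show ?thesis
      proof (cases j)
        case 0
        then have "u k = p" "k < Suc n" using ij i by (auto simp: v_def)
        then show ?thesis using ne by blast
      next
        case j: (Suc k')
        then have "u k = u k'" "k \<in> {0..<Suc n}" "k' \<in> {0..<Suc n}" using ij i by (auto simp: v_def)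
        then show ?thesis using inj_onD[OF inj] i j by blast
      qed
    qed
  qed
  moreover have "v ` {..Suc n} = V" using img uV assms(3) by auto
  ultimately show ?thesis using that by (simp add: v_def)
qed

text \<open>The spheres share a simplex instead of a point. Squashing at time 1 collapses this
  simplex, so the homeomorphisms fit together to a map into the wedge; their inverses give the map
  back without any squashing. Both composites are the squash at time 1, read in the bouquet or in
  the wedge, and the squash homotopy joins them to the identities.\<close>

theorem bouquet_equivalent_wedge:
  assumes m: "2 \<le> m"
  shows "realization (sphere_bouquet m) homotopy_equivalent_space continuum_wedge_spheres (2 * m - 2)"
proof -
  define n where "n = 2 * m - 2"
  define W where "W = sphere_bouquet m"
  define V where "V s = coset m s \<union> grid m" for s
  define bd where "bd s = realization_set (simplex_boundary (V s))" for s
  define R where "R s = realization (simplex_boundary (V s))" for s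
  define e0 where "e0 = (\<lambda>x::real. if x = 0 then 1 else 0::real)"
  have W: "abstract_complex W" unfolding W_def by (rule abstract_complex_bouquet[OF m])
  have finV: "finite (V s)" for s using finite_coset[OF m] finite_grid by (simp add: V_def)
  have disj: "coset m s \<inter> grid m = {}" if "0 < s" for s
    using coset_disjoint[OF m, of _ s 0] that by (auto simp: grid_coset[OF m])
  have crd: "card (coset m s) = card (grid m)" if "0 < s" "s < 1" for s
    using card_coset[OF m] that by (simp add: grid_coset[OF m])
  have z0: "0 \<in> grid m" using m by (auto simp: grid_iff circle_def)
  have cardV: "card (V s) = n + 2" if "0 < s" "s < 1" for s
    using card_Un_disjoint[OF finite_coset[OF m] finite_grid disj[OF that(1)]] card_coset[OF m] that m
    by (simp add: V_def n_def grid_coset[OF m])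
  note ctx = finite_coset[OF m] finite_grid
  have "\<exists>v. 0 < s \<and> s < 1 \<longrightarrow> inj_on v {..Suc n} \<and> v ` {..Suc n} = V s \<and> v 0 = (0::real)" for s
  proof (cases "0 < s \<and> s < 1")
    case True
    then obtain v where "inj_on v {..Suc n}" "v ` {..Suc n} = V s" "v 0 = (0::real)"
      using enumeration_from[OF finV cardV, of s 0] z0 by (auto simp: V_def)
    then show ?thesis by blast
  qed blast
  then obtain v :: "real \<Rightarrow> nat \<Rightarrow> real" where v: "\<And>s. 0 < s \<Longrightarrow> s < 1 \<Longrightarrow> inj_on (v s) {..Suc n}"
    "\<And>s. 0 < s \<Longrightarrow> s < 1 \<Longrightarrow> v s ` {..Suc n} = V s" "\<And>s. 0 < s \<Longrightarrow> s < 1 \<Longrightarrow> v s 0 = 0"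
    by metis
  define hs where "hs s = to_sphere n (v s)" for s
  define ks where "ks s = from_sphere n (v s)" for s
  have homeo: "homeomorphic_maps (R s) (nsphere n) (hs s) (ks s)" if "0 < s" "s < 1" for s
    using sphere_homeomorphic_maps[OF v(1)[OF that]] v(2)[OF that] by (simp add: R_def hs_def ks_def)
  have tR: "topspace (R s) = bd s" for s
    unfolding R_def bd_def by (rule topspace_realization[OF abstract_complex_boundary[OF finV]])
  have hk: "continuous_map (R s) (nsphere n) (hs s)" "continuous_map (nsphere n) (R s) (ks s)"
    "\<And>\<alpha>. \<alpha> \<in> bd s \<Longrightarrow> ks s (hs s \<alpha>) = \<alpha>" "\<And>y. y \<in> topspace (nsphere n) \<Longrightarrow> hs s (ks s y) = y"
    "\<And>\<alpha>. \<alpha> \<in> bd s \<Longrightarrow> hs s \<alpha> \<in> topspace (nsphere n)" "\<And>y. y \<in> topspace (nsphere n) \<Longrightarrow> ks s y \<in> bd s"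
    if "0 < s" "s < 1" for s
    using homeo[OF that] tR[of s] unfolding homeomorphic_maps_def continuous_map_def by auto
  have e0G: "e0 \<in> closed_simplex (grid m)"
    unfolding e0_def by (rule vertex_in_closed_simplex[OF finite_grid z0])
  have Gbd: "\<alpha> \<in> bd s" if "\<alpha> \<in> closed_simplex (grid m)" "0 < s" "s < 1" for \<alpha> s
    unfolding bd_def V_def by (rule face_in_boundary[OF ctx disj crd z0 that(1)]) (use that in auto)
  have base_top: "sphere_base \<in> topspace (nsphere n)"
    using in_topspace_nsphere[of n] by (simp add: sphere_base_def)
  have h_e0: "hs s e0 = sphere_base" if "0 < s" "s < 1" for s
  proof -
    have v0: "v s i = 0 \<longleftrightarrow> i = 0" if "i \<le> Suc n" for i
      using v(1,3)[OF \<open>0 < s\<close> \<open>s < 1\<close>] that by (metis atMost_iff inj_onD le0)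
    have "(\<Sum>j\<le>n. (e0 (v s j) - e0 (v s (Suc n)))\<^sup>2) = (\<Sum>j\<le>n. if j = 0 then 1 else 0)"
      using v0 by (intro sum.cong) (auto simp: e0_def)
    then have "(\<Sum>j\<le>n. (e0 (v s j) - e0 (v s (Suc n)))\<^sup>2) = 1" by simp
    then show ?thesis using v0 by (auto simp: hs_def to_sphere_def sphere_base_def e0_def)
  qed
  have k_base: "ks s sphere_base = e0" if "0 < s" "s < 1" for s
    using hk(3)[OF that Gbd[OF e0G that]] h_e0[OF that] by simp
  define co where "co s t = squash (coset m s) (grid m) 0 t" for s t
  have co_bd: "co s t \<alpha> \<in> bd s" if "0 < s" "s < 1" "\<alpha> \<in> bd s" for s t \<alpha>
    using squash_in_boundary[OF ctx disj crd z0] that by (simp add: co_def bd_def V_def)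
  have co_0: "co s 0 \<alpha> = \<alpha>" if "0 < s" "s < 1" "\<alpha> \<in> bd s" for s \<alpha>
    using squash_0[OF ctx disj crd z0] that by (simp add: co_def bd_def V_def)
  have co_G: "co s t \<alpha> = (\<lambda>x. (1 - t) * \<alpha> x + t * e0 x)"
    if "0 < s" "s < 1" "\<alpha> \<in> closed_simplex (grid m)" "0 \<le> t" "t \<le> 1" for s t \<alpha>
    unfolding co_def e0_def using squash_face[OF ctx disj crd z0] that by blast
  have co_e0: "co s t e0 = e0" if "0 < s" "s < 1" "0 \<le> t" "t \<le> 1" for s t
    unfolding co_G[OF that(1,2) e0G that(3,4)] by (simp add: algebra_simps)
  have co_cont: "continuous_map X (R s) (\<lambda>q. co s (\<tau> q) (a q))"
    if "0 < s" "s < 1" "continuous_map X euclideanreal \<tau>" "\<And>x. continuous_map X euclideanreal (\<lambda>q. a q x)"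
      "\<And>q. q \<in> topspace X \<Longrightarrow> a q \<in> bd s" for s \<tau> a and X :: "'q topology"
    unfolding R_def V_def co_def
    by (rule continuous_map_squash[OF ctx disj crd z0 that(3,4)]) (use that(1,2,5) in \<open>auto simp: bd_def V_def\<close>)
  \<comment> \<open>Recovers the index of the sphere from an off-grid vertex of the support. Points
    supported on the grid lie on all spheres; the default \<open>1/2\<close> is harmless for them
    because all squashes agree there.\<close>
  define sel where "sel \<alpha> = (if \<exists>x. \<alpha> x \<noteq> 0 \<and> frac (real m * x) \<noteq> 0
      then frac (real m * (SOME x. \<alpha> x \<noteq> 0 \<and> frac (real m * x) \<noteq> 0)) else 1/2)" for \<alpha> :: "real \<Rightarrow> real"
  have bdD: "\<alpha> \<in> closed_simplex (V s)" if "\<alpha> \<in> bd s" for \<alpha> s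
    using that simplex_boundary_set[OF finV] by (simp add: bd_def)
  have sel: "sel \<alpha> = s \<or> (\<alpha> \<in> closed_simplex (grid m) \<and> sel \<alpha> = 1/2)" if \<alpha>: "\<alpha> \<in> bd s" and s: "0 < s" "s < 1" for \<alpha> s
  proof (cases "\<exists>x. \<alpha> x \<noteq> 0 \<and> frac (real m * x) \<noteq> 0")
    case True
    define x where "x = (SOME x. \<alpha> x \<noteq> 0 \<and> frac (real m * x) \<noteq> 0)"
    have x: "\<alpha> x \<noteq> 0" "frac (real m * x) \<noteq> 0" using someI_ex[OF True] by (auto simp: x_def)
    then have "x \<in> V s" using bdD[OF \<alpha>] by (auto simp: closed_simplex_def)
    then have "frac (real m * x) = s" using x(2) by (auto simp: V_def grid_coset[OF m] coset_def)
    then show ?thesis using True by (simp add: sel_def x_def)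
  next
    case False
    then have z: "\<alpha> x = 0" if "x \<notin> grid m" for x
    proof -
      have "x \<notin> V s \<or> frac (real m * x) \<noteq> 0"
        using that s by (auto simp: V_def grid_coset[OF m] coset_def)
      then show ?thesis using bdD[OF \<alpha>] False by (auto simp: closed_simplex_def)
    qed
    have "sum \<alpha> (V s) = sum \<alpha> (grid m)"
      using finV z by (intro sum.mono_neutral_right) (auto simp: V_def)
    then have "\<alpha> \<in> closed_simplex (grid m)" using bdD[OF \<alpha>] z by (auto simp: closed_simplex_def)
    moreover have "sel \<alpha> = 1/2" unfolding sel_def by (rule if_not_P[OF False])
    ultimately show ?thesis by blast
  qed
  \<comment> \<open>The wedge is indexed by the reals and the bouquet by the open unit interval;
    \<open>\<theta>\<close> and \<open>\<beta>\<close> are inverse bijections between the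
    two.\<close>
  define \<theta> where "\<theta> x = arctan x / pi + 1 / 2" for x
  define \<beta> where "\<beta> s = tan (pi * (s - 1 / 2))" for s
  have \<theta>: "0 < \<theta> x" "\<theta> x < 1" for x
    using arctan_lbound[of x] arctan_ubound[of x] by (auto simp: \<theta>_def field_simps)
  have \<beta>\<theta>: "\<beta> (\<theta> x) = x" for x by (simp add: \<beta>_def \<theta>_def tan_arctan)
  have \<theta>\<beta>: "\<theta> (\<beta> s) = s" if "0 < s" "s < 1" for s
  proof -
    have "pi * s < pi * 1" using that by (intro mult_strict_left_mono) auto
    moreover have "0 < pi * s" using that by simp
    ultimately have "- (pi / 2) < pi * (s - 1 / 2)" "pi * (s - 1 / 2) < pi / 2"
      by (auto simp: algebra_simps)
    then show ?thesis by (simp add: \<theta>_def \<beta>_def arctan_tan)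
  qed
  define Sm where "Sm = sum_topology (\<lambda>_::real. nsphere n) UNIV"
  define Y where "Y = continuum_wedge_spheres n"
  have quot: "quotient_map Sm Y wedge_collapse"
    unfolding Y_def continuum_wedge_spheres_def Sm_def by (rule quotient_map_quotient_topology)
  have topSm: "topspace Sm = UNIV \<times> topspace (nsphere n)" by (auto simp: Sm_def)
  have topY: "topspace Y = wedge_collapse ` topspace Sm" using quotient_imp_surjective_map[OF quot] by simp
  have collapse_cont: "continuous_map Sm Y wedge_collapse" by (rule quotient_imp_continuous_map[OF quot])
  have inj_cont: "continuous_map (nsphere n) Y (\<lambda>y. wedge_collapse (i,y))" for i
  proof -
    have "continuous_map (nsphere n) Sm (\<lambda>y. (i,y))"
      unfolding Sm_def by (rule continuous_map_component_injection) simp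
    then show ?thesis using continuous_map_compose[OF _ collapse_cont] by (simp add: o_def)
  qed
  have base_collapse: "wedge_collapse (i, sphere_base) = (0, sphere_base)" for i by (simp add: wedge_collapse_def)
  have pieces: "simplex_boundary (V s) \<subseteq> W" if "0 < s" "s < 1" for s
    using that by (auto simp: simplex_boundary_def all_faces_def W_def sphere_bouquet_def V_def)
  have R_to_W: "continuous_map (R s) (realization W) (\<lambda>x. x)" if "0 < s" "s < 1" for s
    unfolding R_def by (rule continuous_map_realization_mono[OF abstract_complex_boundary[OF finV] W pieces[OF that]])
  have W_piece: "\<exists>s. 0 < s \<and> s < 1 \<and> \<sigma> \<in> simplex_boundary (V s)" if "\<sigma> \<in> W" for \<sigma>
    using that unfolding W_def sphere_bouquet_def simplex_boundary_def all_faces_def V_def by auto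
  have piece_bd: "closed_simplex \<sigma> \<subseteq> bd s" if "\<sigma> \<in> simplex_boundary (V s)" for \<sigma> s
    using realization_set_eq[OF abstract_complex_boundary[OF finV]] that by (auto simp: bd_def)
  have W_bd: "\<exists>s. 0 < s \<and> s < 1 \<and> \<alpha> \<in> bd s" if "\<alpha> \<in> topspace (realization W)" for \<alpha>
    using that W_piece piece_bd unfolding topspace_realization[OF W] realization_set_eq[OF W] by blast
  define F where "F = (\<lambda>(t,\<alpha>). co (sel \<alpha>) t \<alpha>)"
  define f where "f \<alpha> = wedge_collapse (\<beta> (sel \<alpha>), hs (sel \<alpha>) (co (sel \<alpha>) 1 \<alpha>))" for \<alpha>
  define g where "g = (\<lambda>(i,y). ks (\<theta> i) y)"
  have F_eq: "F (t,\<alpha>) = co s t \<alpha>" if "0 < s" "s < 1" "\<alpha> \<in> bd s" "0 \<le> t" "t \<le> 1" for s t \<alpha>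
    using sel[OF that(3,1,2)]
  proof
    assume "\<alpha> \<in> closed_simplex (grid m) \<and> sel \<alpha> = 1/2"
    then have \<alpha>: "\<alpha> \<in> closed_simplex (grid m)" "sel \<alpha> = 1/2" by blast+
    have "F (t,\<alpha>) = co (1/2) t \<alpha>" unfolding F_def prod.case \<alpha>(2) by (rule refl)
    then show ?thesis using co_G[OF _ _ \<alpha>(1) that(4,5), of "1/2"] co_G[OF that(1,2) \<alpha>(1) that(4,5)] by simp
  qed (simp add: F_def)
  have f_eq: "f \<alpha> = wedge_collapse (\<beta> s, hs s (co s 1 \<alpha>))" if "0 < s" "s < 1" "\<alpha> \<in> bd s" for s \<alpha>
  proof (cases "sel \<alpha> = s")
    case False
    then have \<alpha>: "\<alpha> \<in> closed_simplex (grid m)" "sel \<alpha> = 1/2" using sel[OF that(3,1,2)] by auto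
    have "co s 1 \<alpha> = e0" "co (1/2) 1 \<alpha> = e0" using co_G[OF _ _ \<alpha>(1), of _ 1] that by simp_all
    then show ?thesis unfolding f_def \<alpha>(2) using h_e0[of s] h_e0[of "1/2"] that base_collapse by simp
  qed (simp add: f_def)
  have coord: "continuous_map (simplex_space \<sigma>) euclideanreal (\<lambda>\<alpha>. \<alpha> x)" for \<sigma> :: "real set" and x
    by (intro continuous_map_from_subtopology continuous_map_product_projection) auto
  have f_cont: "continuous_map (realization W) Y f"
    unfolding continuous_map_from_realization[OF W]
  proof
    fix \<sigma> assume "\<sigma> \<in> W"
    then obtain s where s: "0 < s" "s < 1" "\<sigma> \<in> simplex_boundary (V s)" using W_piece by blast
    have "continuous_map (simplex_space \<sigma>) (R s) (\<lambda>\<alpha>. co s 1 \<alpha>)"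
      using piece_bd[OF s(3)] by (intro co_cont[OF s(1,2)] coord) auto
    then have "continuous_map (simplex_space \<sigma>) (nsphere n) (hs s \<circ> co s 1)"
      by (rule continuous_map_compose[OF _ hk(1)[OF s(1,2)]])
    then have "continuous_map (simplex_space \<sigma>) Y ((\<lambda>y. wedge_collapse (\<beta> s, y)) \<circ> (hs s \<circ> co s 1))"
      by (rule continuous_map_compose[OF _ inj_cont])
    then show "continuous_map (simplex_space \<sigma>) Y f"
      by (rule continuous_map_eq) (use f_eq[OF s(1,2)] piece_bd[OF s(3)] in auto)
  qed
  have g_collapse: "g (wedge_collapse (i,y)) = ks (\<theta> i) y" if "y \<in> topspace (nsphere n)" for i y
    using k_base[OF \<theta>] by (auto simp: g_def wedge_collapse_def)
  have g_cont: "continuous_map Y (realization W) g"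
  proof (rule continuous_compose_quotient_map[OF quot])
    show "continuous_map Sm (realization W) (g \<circ> wedge_collapse)"
      unfolding Sm_def
    proof (rule continuous_map_from_sum)
      fix i :: real
      have "continuous_map (nsphere n) (realization W) ((\<lambda>x. x) \<circ> ks (\<theta> i))"
        by (rule continuous_map_compose[OF hk(2)[OF \<theta>] R_to_W[OF \<theta>]])
      then show "continuous_map (nsphere n) (realization W) (\<lambda>y. (g \<circ> wedge_collapse) (i,y))"
        by (rule continuous_map_eq) (use g_collapse in auto)
    qed
  qed
  have gf: "g (f \<alpha>) = co s 1 \<alpha>" if "0 < s" "s < 1" "\<alpha> \<in> bd s" for s \<alpha>
    using f_eq[OF that] g_collapse[OF hk(5)[OF that(1,2) co_bd[OF that]]] hk(3)[OF that(1,2) co_bd[OF that]] \<theta>\<beta>[OF that(1,2)]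
    by simp
  have h1: "homotopic_with (\<lambda>x. True) (realization W) (realization W) id (g \<circ> f)"
  proof (rule homotopic_with_realizationI[OF W, of _ F])
    fix \<sigma> assume "\<sigma> \<in> W"
    then obtain s where s: "0 < s" "s < 1" "\<sigma> \<in> simplex_boundary (V s)" using W_piece by blast
    let ?P = "prod_topology (top_of_set {0..1::real}) (simplex_space \<sigma>)"
    have "continuous_map ?P (top_of_set {0..1::real}) fst" by (rule continuous_map_fst)
    then have 1: "continuous_map ?P euclideanreal fst" by (simp add: continuous_map_in_subtopology)
    have 2: "continuous_map ?P euclideanreal (\<lambda>q. snd q x)" for x
      by (rule continuous_map_simplex_coord[OF continuous_map_snd])
    have "continuous_map ?P (R s) (\<lambda>q. co s (fst q) (snd q))"
      using piece_bd[OF s(3)] by (intro co_cont[OF s(1,2) 1 2]) auto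
    then have "continuous_map ?P (realization W) ((\<lambda>x. x) \<circ> (\<lambda>q. co s (fst q) (snd q)))"
      by (rule continuous_map_compose[OF _ R_to_W[OF s(1,2)]])
    then show "continuous_map ?P (realization W) F"
      by (rule continuous_map_eq) (use F_eq[OF s(1,2)] piece_bd[OF s(3)] in auto)
  next
    fix \<alpha> assume "\<alpha> \<in> topspace (realization W)"
    then obtain s where s: "0 < s" "s < 1" "\<alpha> \<in> bd s" using W_bd by blast
    show "F (0,\<alpha>) = id \<alpha>" using F_eq[OF s, of 0] co_0[OF s] by simp
    show "F (1,\<alpha>) = (g \<circ> f) \<alpha>" using F_eq[OF s, of 1] gf[OF s] by simp
  qed
  \<comment> \<open>The squash homotopy transported to the wedge. It fixes the base point on every
    sphere because \<open>co_e0\<close> keeps the vertex \<open>e0\<close> in place, so it respects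
    the identification.\<close>
  define L where "L = (\<lambda>(t,(i,y)). wedge_collapse (i, hs (\<theta> i) (co (\<theta> i) t (ks (\<theta> i) y))))"
  have L_collapse: "L (t, wedge_collapse (i,y)) = L (t,(i,y))" if "0 \<le> t" "t \<le> 1" for t i y
  proof (cases "y = sphere_base")
    case True
    have "L (t,(j,sphere_base)) = (0,sphere_base)" for j
      using k_base[OF \<theta>] co_e0[OF \<theta> that] h_e0[OF \<theta>] base_collapse by (simp add: L_def)
    then show ?thesis using True by (simp add: base_collapse)
  qed (simp add: wedge_collapse_def)
  have h2: "homotopic_with (\<lambda>x. True) Y Y id (f \<circ> g)"
  proof -
    let ?I = "top_of_set {0..1::real}"
    \<comment> \<open>Multiplying by the compact interval keeps the collapse a quotient map, so the
      homotopy may be checked on the disjoint sum.\<close>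
    have qq: "quotient_map (prod_topology ?I Sm) (prod_topology ?I Y) (\<lambda>(x,y). (x, wedge_collapse y))"
      by (rule quotient_map_prod_right[OF _ _ quot])
        (auto intro!: compact_imp_locally_compact_space simp: compact_space_subtopology Hausdorff_space_subtopology)
    have "continuous_map (prod_topology ?I Sm) Y L"
      unfolding Sm_def
    proof (rule continuous_map_from_prod_sum)
      fix i :: real
      let ?P = "prod_topology ?I (nsphere n)"
      have "continuous_map ?P ?I fst" by (rule continuous_map_fst)
      then have 1: "continuous_map ?P euclideanreal fst" by (simp add: continuous_map_in_subtopology)
      have "continuous_map ?P (R (\<theta> i)) (ks (\<theta> i) \<circ> snd)"
        by (rule continuous_map_compose[OF continuous_map_snd hk(2)[OF \<theta>]])
      then have "continuous_map ?P euclideanreal ((\<lambda>\<alpha>. \<alpha> x) \<circ> (ks (\<theta> i) \<circ> snd))" for x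
        unfolding R_def by (rule continuous_map_compose[OF _ continuous_map_boundary_coord[OF finV]])
      then have 2: "continuous_map ?P euclideanreal (\<lambda>q. ks (\<theta> i) (snd q) x)" for x by (simp add: o_def)
      have "continuous_map ?P (R (\<theta> i)) (\<lambda>q. co (\<theta> i) (fst q) (ks (\<theta> i) (snd q)))"
        using hk(6)[OF \<theta>] by (intro co_cont[OF \<theta> 1 2]) auto
      then have "continuous_map ?P (nsphere n) (hs (\<theta> i) \<circ> (\<lambda>q. co (\<theta> i) (fst q) (ks (\<theta> i) (snd q))))"
        by (rule continuous_map_compose[OF _ hk(1)[OF \<theta>]])
      then have "continuous_map ?P Y ((\<lambda>y. wedge_collapse (i,y)) \<circ> (hs (\<theta> i) \<circ> (\<lambda>q. co (\<theta> i) (fst q) (ks (\<theta> i) (snd q)))))"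
        by (rule continuous_map_compose[OF _ inj_cont])
      then show "continuous_map ?P Y (\<lambda>(t,y). L (t,(i,y)))"
        by (simp add: o_def L_def case_prod_unfold)
    qed
    then have "continuous_map (prod_topology ?I Sm) Y (L \<circ> (\<lambda>(x,y). (x, wedge_collapse y)))"
      by (rule continuous_map_eq) (use L_collapse in \<open>auto simp: topSm\<close>)
    then have "continuous_map (prod_topology ?I Y) Y L"
      by (rule continuous_compose_quotient_map[OF qq])
    then have "homotopic_with (\<lambda>x. True) Y Y (\<lambda>x. L (0,x)) (\<lambda>x. L (1,x))"
      unfolding homotopic_with_def by auto
    then show ?thesis
    proof (rule homotopic_with_eq)
      fix q assume "q \<in> topspace Y"
      then obtain i y where q: "q = wedge_collapse (i,y)" "y \<in> topspace (nsphere n)" by (auto simp: topY topSm)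
      have k: "ks (\<theta> i) y \<in> bd (\<theta> i)" by (rule hk(6)[OF \<theta> q(2)])
      show "id q = L (0,q)"
        using L_collapse[of 0 i y] co_0[OF \<theta> k] hk(4)[OF \<theta> q(2)] by (simp add: q L_def)
      show "(f \<circ> g) q = L (1,q)"
        using L_collapse[of 1 i y] f_eq[OF \<theta> k] g_collapse[OF q(2), of i] \<beta>\<theta> by (simp add: q(1)) (simp add: L_def)
    qed simp
  qed
  have "realization W homotopy_equivalent_space Y"
    unfolding homotopy_equivalent_space_def
    using f_cont g_cont homotopic_with_sym h1 h2 by metis
  then show ?thesis by (simp add: W_def Y_def n_def)
qed

section \<open>Homotopy types\<close>

lemma homotopy_equivalence_map_imp_equivalent:
  assumes "homotopy_equivalence_map X Y f"
  shows "X homotopy_equivalent_space Y"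
  using assms unfolding homotopy_equivalence_map_def homotopy_equivalent_space_def by blast

text \<open>All lengths strictly between \<open>1/m\<close> and \<open>1/(m - 1)\<close> give the
  same homotopy type, and it is read off at \<open>2/(2m - 1)\<close>.\<close>

lemma gap_complex_equivalent_sphere:
  fixes m :: nat and \<delta> :: real
  assumes m: "2 \<le> m" and \<delta>: "1 < real m * \<delta>" "(real m - 1) * \<delta> < 1"
  shows "realization (gap_complex (\<lambda>_. \<delta>) circle) homotopy_equivalent_space nsphere (2 * m - 3)"
proof -
  define q where "q = 2 * m - 1"
  define d where "d = 2 / real q"
  have q: "real q = 2 * real m - 1" "0 < real q" using m by (auto simp: q_def of_nat_diff)
  have d: "1 < real m * d" "(real m - 1) * d < 1" using q by (auto simp: d_def field_simps)
  have "inj_on (\<lambda>k. real k / real q) {..<q}" using q(2) by (auto simp: inj_on_def)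
  then have "card (grid q) = (2 * m - 3) + 2" using m by (simp add: grid_def card_image q_def)
  then have 1: "realization (simplex_boundary (grid q)) homotopy_equivalent_space nsphere (2 * m - 3)"
    by (intro homeomorphic_imp_homotopy_equivalent_space simplex_boundary_homeomorphic_sphere finite_grid)
  have 2: "realization (simplex_boundary (grid q)) homotopy_equivalent_space realization (gap_complex (\<lambda>_. d) circle)"
    using homotopy_equivalence_map_imp_equivalent[OF gap_two_steps[OF m]] by (simp add: simplex_boundary_def q_def d_def)
  have "realization (gap_complex (\<lambda>_. \<delta>) circle) homotopy_equivalent_space realization (gap_complex (\<lambda>_. d) circle)"
  \<comment> \<open>The larger length has the smaller complex, so the inclusion between the two
    complexes points either way according to this case.\<close>
  proof (cases "\<delta> \<le> d")
    case True
    then show ?thesis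
      using homotopy_equivalence_map_imp_equivalent[OF gap_complex_inclusion_equivalence[OF m \<delta>(1) True d(2)]]
        homotopy_equivalent_space_sym by blast
  next
    case False
    then show ?thesis
      using homotopy_equivalence_map_imp_equivalent[OF gap_complex_inclusion_equivalence[OF m d(1) _ \<delta>(2)]] by simp
  qed
  then show ?thesis
    using 1 2 homotopy_equivalent_space_sym homotopy_eqv_trans by blast
qed

theorem theorem9p7:
  fixes r :: real
  assumes "0 < r" and "r < 1/2"
  shows "(\<forall>l::nat. real l / (2 * (real l + 1)) < r \<and> r < (real l + 1) / (2 * (real l + 2))
            \<longrightarrow> realization (cech_le circle r) homotopy_equivalent_space nsphere (2 * l + 1))
       \<and> (\<forall>l::nat. r = real l / (2 * (real l + 1))
            \<longrightarrow> realization (cech_le circle r) homotopy_equivalent_space continuum_wedge_spheres (2 * l))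
       \<and> (\<forall>l::nat. \<forall>r'. real l / (2 * (real l + 1)) < r \<and> r \<le> r' \<and> r' < (real l + 1) / (2 * (real l + 2))
            \<longrightarrow> homotopy_equivalence_map (realization (cech_le circle r))
                   (realization (cech_le circle r')) id)"
proof (intro conjI allI impI)
  have cech: "cech_le circle r = gap_complex (\<lambda>_. 1 - 2 * r) circle"
    by (rule cech_le_eq_gap_complex[OF assms])
  \<comment> \<open>The two bounds on the radius are the bounds on the gap length for
    \<open>m = l + 2\<close>.\<close>
  have lower: "(real (l + 2) - 1) * (1 - 2 * x) < 1" if "real l / (2 * (real l + 1)) < x" for l and x :: real
    using that by (simp add: field_simps)
  have upper: "1 < real (l + 2) * (1 - 2 * x)" if "x < (real l + 1) / (2 * (real l + 2))" for l and x :: real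
    using that by (simp add: field_simps)
  {
    fix l :: nat
    assume l: "real l / (2 * (real l + 1)) < r \<and> r < (real l + 1) / (2 * (real l + 2))"
    then have "realization (cech_le circle r) homotopy_equivalent_space nsphere (2 * (l + 2) - 3)"
      unfolding cech by (intro gap_complex_equivalent_sphere upper lower) auto
    moreover have "2 * (l + 2) - 3 = 2 * l + 1" by simp
    ultimately show "realization (cech_le circle r) homotopy_equivalent_space nsphere (2 * l + 1)"
      by simp
  next
    fix l :: nat
    assume l: "r = real l / (2 * (real l + 1))"
    \<comment> \<open>For \<open>l = 0\<close> the critical radius is 0, which is excluded. The
      critical case has \<open>m = l + 1\<close>, and the bouquet requires \<open>m\<close> to be at
      least 2.\<close>
    have "l \<noteq> 0"
    proof
      assume "l = 0"
      then have "r = 0" using l by simp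
      then show False using assms(1) by simp
    qed
    then have m: "2 \<le> l + 1" by simp
    have eq: "1 - 2 * r = 1 / real (l + 1)" unfolding l by (simp add: field_simps)
    have "realization (cech_le circle r) homotopy_equivalent_space realization (sphere_bouquet (l + 1))"
      unfolding cech eq
      using homotopy_equivalence_map_imp_equivalent[OF bouquet_gap_equivalence[OF m]] homotopy_equivalent_space_sym
      by blast
    then have "realization (cech_le circle r) homotopy_equivalent_space continuum_wedge_spheres (2 * (l + 1) - 2)"
      using bouquet_equivalent_wedge[OF m] homotopy_eqv_trans by blast
    then show "realization (cech_le circle r) homotopy_equivalent_space continuum_wedge_spheres (2 * l)"
      by simp
  next
    fix l :: nat and r' :: real
    assume l: "real l / (2 * (real l + 1)) < r \<and> r \<le> r' \<and> r' < (real l + 1) / (2 * (real l + 2))"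
    have "(real l + 1) / (2 * (real l + 2)) < 1 / 2" by (simp add: field_simps)
    then have "cech_le circle r' = gap_complex (\<lambda>_. 1 - 2 * r') circle"
      using l assms by (intro cech_le_eq_gap_complex) linarith+
    \<comment> \<open>The smaller radius has the longer gap, so \<open>1 - 2 * r\<close> takes the
      part of the larger length: the lower bound is applied to \<open>r\<close> and the upper bound
      to \<open>r'\<close>.\<close>
    then show "homotopy_equivalence_map (realization (cech_le circle r)) (realization (cech_le circle r')) id"
      unfolding cech using gap_complex_inclusion_equivalence[of "l + 2", OF _ upper _ lower] l by simp
  }
qed

end
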